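(* Let $(X_t)_{t\ge0}$ be a Markov chain on $\mathcal{X}$ with transition kernel $P$. Assume that $(X_t)$ is reversible with respect to the probability measure $\pi$ and that it has nonnegative eigenvalues. Also assume that $(X_t)$ has a drift function with respect to a small set $C\subset\mathcal{X}$. Let $V$, $0<\lambda<1$, $K<\infty$ be the data associated with the drift function, and let $\nu$, $m\ge1$, $\varepsilon>0$ be the data associated with the small set. Define \[ B=\frac{1-\lambda^m}{1-\lambda}(K-\lambda)+\lambda^m . \] If $\varepsilon=1$, set $\rho=\lambda$ and $r=1$. If $\varepsilon<1$, set \[ \rho=\max\left\{\lambda,\ \exp\left(\frac{-\log(1-\varepsilon)\log\lambda}{-m\log\lambda+\log(B-\varepsilon)-\log(1-\varepsilon)}\right)\right\},\qquad r=\frac{\log\rho}{\log\lambda}. \] Let \[ D=\frac12\sqrt{\left[\frac{B-(1-\varepsilon)}{\varepsilon}\right]^r\frac{\rho^{2-m}}{1-\rho}}, \] \[ F_0(x)=(1-D)_+\,\rho^{1-m}V(x)^r+D,\qquad F_1(x)=(1-\rho)\rho^{-m}D\,V(x)^r . \] Then \[ \|P^t(x,\cdot)-\pi\|_{\mathrm{TV}}\le[F_1(x)t+F_0(x)]\rho^t\qquad\text{for all } x\in\mathcal{X} \text{ and integers } t\ge0 . \] Next, let \[ G_0(x)=V(x)+\frac{K-\lambda}{1-\lambda}. \] If $\rho=\lambda$, define \[ G_1(x)=K\lambda^{-1}[2F_0(x)-F_1(x)],\qquad G_2(x)=K\lambda^{-1}F_1(x); \] then \[ \|P^t(x,\cdot)-\pi\|_V\le[G_2(x)t^2+G_1(x)t+G_0(x)]\lambda^t\qquad\text{for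 all } x\in\mathcal{X} \text{ and integers } t\ge0 . \] If $\rho>\lambda$, define \[ H_0(x)=2K\left[\frac{F_0(x)}{\rho-\lambda}-\frac{\rho F_1(x)}{(\rho-\lambda)^2}\right],\qquad H_1(x)=\frac{2KF_1(x)}{\rho-\lambda}; \] then \[ \|P^t(x,\cdot)-\pi\|_V\le[H_1(x)t+H_0(x)]\rho^t+[G_0(x)-H_0(x)]\lambda^t\qquad\text{for all } x\in\mathcal{X} \text{ and integers } t\ge0 . \]
   Context: $\mathcal{X}$ is a general (measurable) state space; all subsets and functions considered are measurable. Notation: $Pf(x)=\int f(y)P(x,dy)$; $\mu(f)=\int f\,d\mu$; $P^t(x,\cdot)$ is the law of the chain started from $x$ after $t$ steps; $r_+=\max(r,0)$ for $r\in\mathbb{R}$. Total variation distance: $\|\mu-\mu'\|_{\mathrm{TV}}=\sup_{S\subset\mathcal{X}}|\mu(S)-\mu'(S)|$. $V$-norm distance: $\|\mu-\mu'\|_V=\sup_{|f|\le V}|\mu(f)-\mu'(f)|$, for probability measures $\mu,\mu'$. Reversibility: $(X_t)$ is reversible with respect to $\pi$ if $\pi(dx)P(x,dy)=\pi(dy)P(y,dx)$ as measures on $\mathcal{X}\times\mathcal{X}$; equivalently $f\mapsto Pf$ is a self-adjoint operator on the space $L^2(\pi)$ of real-valued functions. Its spectrum is then contained in $[-1,1]$; the chain has nonnegative eigenvalues if the $L^2(\pi)$ spectrum of $P$ is contained in $[0,1]$. Drift function: a function $V:\mathcal{X}\to[1,\infty)$ together with constants $\lambda$ ($0<\lambda<1$)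 and $K<\infty$ such that $PV(x)\le\lambda V(x)$ for $x\notin C$ and $PV(x)\le K$ for $x\in C$ is a drift function for $(X_t)$ with respect to $C$. Small set: $C\subset\mathcal{X}$ is a small set if there are an integer $m\ge1$, a constant $\varepsilon>0$ and a probability measure $\nu$ on $\mathcal{X}$ such that $P^m(x,S)\ge\varepsilon\nu(S)$ for all $x\in C$ and $S\subset\mathcal{X}$. *)

theory Defs
  imports "HOL-Probability.Probability"
begin

text \<open>
  A transition kernel on a measurable space \<open>M\<close> is a map
  \<open>P \<in> M \<rightarrow>\<^sub>M prob_algebra M\<close>.  Only the law \<open>P\<^sup>t(x,\<cdot>)\<close> of the chain is
  needed, so the chain itself is represented by its kernel.
\<close>

primrec kernel_power :: "'a measure \<Rightarrow> ('a \<Rightarrow> 'a measure) \<Rightarrow> nat \<Rightarrow> 'a \<Rightarrow> 'a measure" where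
  "kernel_power M P 0 x = return M x"
| "kernel_power M P (Suc t) x = kernel_power M P t x \<bind> P"

definition kernel_op :: "('a \<Rightarrow> 'a measure) \<Rightarrow> ('a \<Rightarrow> real) \<Rightarrow> 'a \<Rightarrow> real" where
  "kernel_op P f x = (\<integral>y. f y \<partial>P x)"

text \<open>\<open>\<pi>(dx) P(x,dy) = \<pi>(dy) P(y,dx)\<close> as measures on the product space.\<close>

definition reversible :: "'a measure \<Rightarrow> ('a \<Rightarrow> 'a measure) \<Rightarrow> 'a measure \<Rightarrow> bool" where
  "reversible M P \<pi> \<longleftrightarrow>
     \<pi> \<bind> (\<lambda>x. P x \<bind> (\<lambda>y. return (M \<Otimes>\<^sub>M M) (x, y))) =
     \<pi> \<bind> (\<lambda>y. P y \<bind> (\<lambda>x. return (M \<Otimes>\<^sub>M M) (x, y)))"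

text \<open>
  Elements of the real space \<open>L\<^sup>2(\<mu>)\<close> are represented by functions, and equality in \<open>L\<^sup>2(\<mu>)\<close>
  by equality almost everywhere.  A real \<open>c\<close> is in the resolvent set of \<open>T\<close> if \<open>c I - T\<close> is a
  bijection of \<open>L\<^sup>2(\<mu>)\<close> (first two clauses) with bounded inverse (last clause).
  The spectrum is that of an operator on a real Hilbert space; for a self-adjoint operator it
  coincides with the spectrum of the complexification.
\<close>

definition L2_space :: "'a measure \<Rightarrow> ('a \<Rightarrow> real) set" where
  "L2_space \<mu> = {f \<in> borel_measurable \<mu>. integrable \<mu> (\<lambda>x. (f x)\<^sup>2)}"

definition L2_norm :: "'a measure \<Rightarrow> ('a \<Rightarrow> real) \<Rightarrow> real" where
  "L2_norm \<mu> f = sqrt (\<integral>x. (f x)\<^sup>2 \<partial>\<mu>)"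

definition L2_resolvent_set :: "'a measure \<Rightarrow> (('a \<Rightarrow> real) \<Rightarrow> 'a \<Rightarrow> real) \<Rightarrow> real set" where
  "L2_resolvent_set \<mu> T = {c.
     (\<forall>f\<in>L2_space \<mu>. \<forall>g\<in>L2_space \<mu>.
        (AE x in \<mu>. c * f x - T f x = c * g x - T g x) \<longrightarrow> (AE x in \<mu>. f x = g x)) \<and>
     (\<forall>g\<in>L2_space \<mu>. \<exists>f\<in>L2_space \<mu>. AE x in \<mu>. c * f x - T f x = g x) \<and>
     (\<exists>R. \<forall>f\<in>L2_space \<mu>. L2_norm \<mu> f \<le> R * L2_norm \<mu> (\<lambda>x. c * f x - T f x))}"

definition L2_spectrum :: "'a measure \<Rightarrow> (('a \<Rightarrow> real) \<Rightarrow> 'a \<Rightarrow> real) \<Rightarrow> real set" where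
  "L2_spectrum \<mu> T = - L2_resolvent_set \<mu> T"

definition nonneg_eigenvalues :: "('a \<Rightarrow> 'a measure) \<Rightarrow> 'a measure \<Rightarrow> bool" where
  "nonneg_eigenvalues P \<pi> \<longleftrightarrow> L2_spectrum \<pi> (kernel_op P) \<subseteq> {0..1}"

text \<open>
  \<open>PV\<close> is taken as an integral with values in \<open>[0,\<infinity>]\<close>, so that the bounds below include its
  finiteness (the real-valued integral of a non-integrable function is \<open>0\<close>).
\<close>

definition drift_function ::
  "'a measure \<Rightarrow> ('a \<Rightarrow> 'a measure) \<Rightarrow> 'a set \<Rightarrow> ('a \<Rightarrow> real) \<Rightarrow> real \<Rightarrow> real \<Rightarrow> bool" where
  "drift_function M P C V lam K \<longleftrightarrow>
     V \<in> borel_measurable M \<and> (\<forall>x\<in>space M. 1 \<le> V x) \<and> 0 < lam \<and> lam < 1 \<and>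
     (\<forall>x\<in>space M - C. (\<integral>\<^sup>+y. ennreal (V y) \<partial>P x) \<le> ennreal (lam * V x)) \<and>
     (\<forall>x\<in>C. (\<integral>\<^sup>+y. ennreal (V y) \<partial>P x) \<le> ennreal K)"

definition small_set ::
  "'a measure \<Rightarrow> ('a \<Rightarrow> 'a measure) \<Rightarrow> 'a set \<Rightarrow> nat \<Rightarrow> real \<Rightarrow> 'a measure \<Rightarrow> bool" where
  "small_set M P C m eps \<nu> \<longleftrightarrow>
     C \<in> sets M \<and> 1 \<le> m \<and> 0 < eps \<and> prob_space \<nu> \<and> sets \<nu> = sets M \<and>
     (\<forall>x\<in>C. \<forall>S\<in>sets M. measure (kernel_power M P m x) S \<ge> eps * measure \<nu> S)"

text \<open>Both distances are meant for probability measures with the same measurable sets.\<close>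

definition tv_dist :: "'a measure \<Rightarrow> 'a measure \<Rightarrow> real" where
  "tv_dist \<mu> \<mu>' = (SUP S\<in>sets \<mu>. \<bar>measure \<mu> S - measure \<mu>' S\<bar>)"

text \<open>
  If \<open>V\<close> is not integrable under one of the measures, then \<open>\<mu>(f)\<close> is not defined for all
  \<open>\<bar>f\<bar> \<le> V\<close>; the distance is then set to \<open>\<infinity>\<close>, so that a finite upper bound on it includes the
  integrability of \<open>V\<close>.
\<close>

definition V_dist :: "('a \<Rightarrow> real) \<Rightarrow> 'a measure \<Rightarrow> 'a measure \<Rightarrow> ereal" where
  "V_dist V \<mu> \<mu>' =
     (if integrable \<mu> V \<and> integrable \<mu>' V
      then SUP f\<in>{f \<in> borel_measurable \<mu>. \<forall>x\<in>space \<mu>. \<bar>f x\<bar> \<le> V x}.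
             ereal \<bar>(\<integral>x. f x \<partial>\<mu>) - (\<integral>x. f x \<partial>\<mu>')\<bar>
      else \<infinity>)"

end

theory Submission
  imports Defs
begin

text \<open>
  The chain is compared with \<open>\<pi>\<close> through a regeneration time. From a point outside \<open>C\<close> move by
  \<open>P\<close>; from a point \<open>x \<in> C\<close> wait \<open>m\<close> steps and split \<open>P\<^sup>m(x,\<cdot>) = \<epsilon>\<nu> + R(x,\<cdot>)\<close> into a regeneration with
  law \<open>\<nu>\<close> and a residual part \<open>R\<close>, from which the procedure is repeated. If \<open>T\<close> is the time of the
  first regeneration, the law of the chain after \<open>T\<close> is that of the chain started from \<open>\<nu>\<close>, whatever
  the value of \<open>T\<close>. In terms of functions, with \<open>w\<^sub>t g(x) = E\<^sub>x[g(X\<^sub>t); T > t]\<close> and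
  \<open>a\<^sub>s(x) = Pr\<^sub>x(T = s)\<close>, this is the renewal identity
  \<open>P\<^sup>t g = w\<^sub>t g + (\<Sum>s\<le>t. a\<^sub>s \<nu>(P\<^sup>t\<^sup>-\<^sup>s g))\<close> (lemma \<open>renewal\<close>).

  The exponent \<open>r\<close> is chosen so that \<open>\<phi> = V\<^sup>r\<close> satisfies \<open>P\<phi> \<le> \<rho>\<phi>\<close> outside \<open>C\<close> and \<open>R\<phi> \<le> \<rho>\<^sup>m\<close> on \<open>C\<close>;
  both follow from the drift condition by concavity of the power function. Hence
  \<open>Pr\<^sub>x(T > t) \<le> \<rho>\<^sup>t\<^sup>+\<^sup>1\<^sup>-\<^sup>m \<phi>(x)\<close> (lemma \<open>survival_le\<close>).

  It remains to control \<open>\<nu>P\<^sup>n - \<pi>\<close>, and this is where reversibility and nonnegativity of the spectrum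
  enter. The measure \<open>\<nu>\<close> has a bounded density \<open>f\<close> with respect to \<open>\<pi>\<close>. Put
  \<open>g\<^sub>n = \<nu>(P\<^sup>n f) = \<langle>f, P\<^sup>n f\<rangle>\<close>. Since \<open>P\<close> is self-adjoint and \<open>0 \<le> P\<^sup>2 \<le> P \<le> 1\<close> as quadratic forms, \<open>g\<^sub>n\<close> is decreasing. Let
  \<open>p\<^sub>n = Pr\<^sub>\<nu>(T > n)\<close>. Summation by parts in the renewal identity for \<open>g\<close> gives
  \<open>(\<Sum>k=1..n. (g\<^sub>k\<^sub>-\<^sub>1 - g\<^sub>k) p\<^sub>n\<^sub>-\<^sub>k) = g\<^sub>0 p\<^sub>n - \<nu>(w\<^sub>n f) \<le> g\<^sub>0 p\<^sub>n\<close>.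
  Every term on the left is nonnegative. Comparing generating functions, the factor \<open>\<Sum>n. p\<^sub>n z\<^sup>n\<close>,
  which is finite for \<open>z < 1/\<rho>\<close>, cancels, so \<open>(\<Sum>k\<ge>1. (g\<^sub>k\<^sub>-\<^sub>1 - g\<^sub>k) \<rho>\<^sup>-\<^sup>k) \<le> g\<^sub>0\<close>. With \<open>lim g\<^sub>n \<le> 1\<close> this
  yields \<open>g\<^sub>n - 1 \<le> \<rho>\<^sup>n\<^sup>+\<^sup>1 g\<^sub>0\<close>; the case \<open>n = 0\<close> bounds \<open>g\<^sub>0\<close> by \<open>1/(1 - \<rho>)\<close>, so that
  \<open>g\<^sub>n - 1 \<le> \<rho>\<^sup>n\<^sup>+\<^sup>1/(1 - \<rho>)\<close> (lemma \<open>renewal_sequence_convergence\<close>).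
  As \<open>g\<^sub>2\<^sub>n - 1\<close> is the square of the \<open>L\<^sup>2(\<pi>)\<close> norm of \<open>P\<^sup>n f - 1\<close>, the total variation distance
  of \<open>\<nu>P\<^sup>n\<close> and \<open>\<pi>\<close> is at most \<open>\<rho>\<^sup>n sqrt(\<rho>/(1 - \<rho>))/2 \<le> D \<rho>\<^sup>n\<close>.

  Inserting this bound and the tail bound for \<open>T\<close> into the renewal identity from \<open>x\<close>, with one more
  summation by parts, gives the total variation bound. For the \<open>V\<close>-norm, \<open>Pf\<close> with \<open>\<bar>f\<bar> \<le> V\<close> splits
  into a part on \<open>C\<close>, bounded by \<open>K\<close> and hence controlled by the total variation distance, and a part
  off \<open>C\<close>, bounded by \<open>\<lambda>V\<close>. So the distances \<open>v\<^sub>t\<close> in the \<open>V\<close>-norm and \<open>\<tau>\<^sub>t\<close> in total variation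
  satisfy \<open>v\<^sub>t\<^sub>+\<^sub>1 \<le> \<lambda> v\<^sub>t + 2K \<tau>\<^sub>t\<close>, and the closed forms in the theorem solve this recursion.
\<close>

section \<open>Markov kernels acting on bounded measurable functions\<close>

text \<open>
  Bounded functions suffice for everything that concerns total variation and the spectrum; all
  operators below preserve this class, so no integrability has to be tracked there.
\<close>
definition bounded_measurable :: "'a measure \<Rightarrow> ('a \<Rightarrow> real) set" where
  "bounded_measurable M = {f \<in> borel_measurable M. \<exists>b. \<forall>x\<in>space M. \<bar>f x\<bar> \<le> b}"

lemma bounded_measurableI:
  "f \<in> borel_measurable M \<Longrightarrow> (\<And>x. x \<in> space M \<Longrightarrow> \<bar>f x\<bar> \<le> b) \<Longrightarrow> f \<in> bounded_measurable M"
  unfolding bounded_measurable_def by blast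

lemma bounded_measurable_measurable [measurable_dest]:
  "f \<in> bounded_measurable M \<Longrightarrow> f \<in> borel_measurable M"
  unfolding bounded_measurable_def by blast

lemma bounded_measurable_const: "(\<lambda>_. c) \<in> bounded_measurable M"
  by (rule bounded_measurableI[where b = "\<bar>c\<bar>"]) auto

lemma bounded_measurable_add:
  assumes "f \<in> bounded_measurable M" "g \<in> bounded_measurable M"
  shows "(\<lambda>x. f x + g x) \<in> bounded_measurable M"
proof -
  obtain a b where "\<forall>x\<in>space M. \<bar>f x\<bar> \<le> a" "\<forall>x\<in>space M. \<bar>g x\<bar> \<le> b"
    using assms unfolding bounded_measurable_def by blast
  with assms show ?thesis
    by (intro bounded_measurableI[where b = "a + b"]) (auto intro: order_trans[OF abs_triangle_ineq] add_mono)
qed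

lemma bounded_measurable_mult:
  assumes "f \<in> bounded_measurable M" "g \<in> bounded_measurable M"
  shows "(\<lambda>x. f x * g x) \<in> bounded_measurable M"
proof -
  obtain a b where "\<forall>x\<in>space M. \<bar>f x\<bar> \<le> a" "\<forall>x\<in>space M. \<bar>g x\<bar> \<le> b"
    using assms unfolding bounded_measurable_def by blast
  with assms show ?thesis
    by (intro bounded_measurableI[where b = "a * b"])
       (auto simp: abs_mult intro!: mult_mono intro: order_trans[OF abs_ge_zero])
qed

lemma bounded_measurable_scale:
  "f \<in> bounded_measurable M \<Longrightarrow> (\<lambda>x. c * f x) \<in> bounded_measurable M"
  by (rule bounded_measurable_mult[OF bounded_measurable_const])

lemma bounded_measurable_diff:
  "f \<in> bounded_measurable M \<Longrightarrow> g \<in> bounded_measurable M \<Longrightarrow> (\<lambda>x. f x - g x) \<in> bounded_measurable M"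
  using bounded_measurable_add[of f M "\<lambda>x. -1 * g x"] bounded_measurable_scale[of g M "-1"] by simp

lemma bounded_measurable_power2:
  "f \<in> bounded_measurable M \<Longrightarrow> (\<lambda>x. (f x)\<^sup>2) \<in> bounded_measurable M"
  unfolding power2_eq_square by (rule bounded_measurable_mult)

lemma bounded_measurable_sum:
  "(\<And>i. i \<in> I \<Longrightarrow> f i \<in> bounded_measurable M) \<Longrightarrow> (\<lambda>x. \<Sum>i\<in>I. f i x) \<in> bounded_measurable M"
  by (induction I rule: infinite_finite_induct)
     (auto intro: bounded_measurable_const bounded_measurable_add)

lemmas bounded_measurable_intros =
  bounded_measurable_const bounded_measurable_add bounded_measurable_diff
  bounded_measurable_mult bounded_measurable_power2 bounded_measurable_sum

lemma integrable_bounded_measurable: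
  assumes "f \<in> bounded_measurable M" "prob_space N" "sets N = sets M"
  shows "integrable N f"
proof -
  interpret prob_space N by fact
  obtain b where "\<forall>x\<in>space M. \<bar>f x\<bar> \<le> b"
    using assms(1) unfolding bounded_measurable_def by blast
  moreover have "f \<in> borel_measurable N"
    using assms(1,3) by (auto simp: bounded_measurable_def cong: measurable_cong_sets)
  ultimately show ?thesis
    using sets_eq_imp_space_eq[OF assms(3)] by (intro integrable_const_bound[of _ b]) auto
qed

locale markov_kernel =
  fixes M :: "'a measure" and P :: "'a \<Rightarrow> 'a measure"
  assumes kernel: "P \<in> M \<rightarrow>\<^sub>M prob_algebra M"
begin

lemma kernel_subprob [measurable]: "P \<in> M \<rightarrow>\<^sub>M subprob_algebra M"
  using kernel by (rule measurable_prob_algebraD)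

lemma prob_space_kernel: "x \<in> space M \<Longrightarrow> prob_space (P x)"
  and sets_kernel_eq: "x \<in> space M \<Longrightarrow> sets (P x) = sets M"
  using measurable_space[OF kernel] by (auto simp: space_prob_algebra)

lemma kernel_op_measurable [measurable]:
  "f \<in> borel_measurable M \<Longrightarrow> kernel_op P f \<in> borel_measurable M"
  unfolding kernel_op_def [abs_def]
  by (rule measurable_compose [OF kernel_subprob integral_measurable_subprob_algebra])

lemma integrable_kernel: "f \<in> bounded_measurable M \<Longrightarrow> x \<in> space M \<Longrightarrow> integrable (P x) f"
  by (rule integrable_bounded_measurable [OF _ prob_space_kernel sets_kernel_eq])

lemma kernel_op_mono:
  assumes "f \<in> bounded_measurable M" "g \<in> bounded_measurable M" "x \<in> space M"
    and "\<And>y. y \<in> space M \<Longrightarrow> f y \<le> g y"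
  shows "kernel_op P f x \<le> kernel_op P g x"
  unfolding kernel_op_def
  using assms sets_eq_imp_space_eq[OF sets_kernel_eq[OF assms(3)]]
  by (intro integral_mono integrable_kernel) auto

lemma kernel_op_const: "x \<in> space M \<Longrightarrow> kernel_op P (\<lambda>_. c) x = c"
  unfolding kernel_op_def using prob_space.prob_space[OF prob_space_kernel] by simp

lemma kernel_op_cong:
  assumes "x \<in> space M" "\<And>y. y \<in> space M \<Longrightarrow> f y = g y"
  shows "kernel_op P f x = kernel_op P g x"
  unfolding kernel_op_def
  using assms sets_eq_imp_space_eq[OF sets_kernel_eq] by (intro Bochner_Integration.integral_cong) auto

lemma kernel_op_add:
  "f \<in> bounded_measurable M \<Longrightarrow> g \<in> bounded_measurable M \<Longrightarrow> x \<in> space M \<Longrightarrow>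
    kernel_op P (\<lambda>y. f y + g y) x = kernel_op P f x + kernel_op P g x"
  unfolding kernel_op_def
  by (intro Bochner_Integration.integral_add integrable_kernel)

lemma kernel_op_scale: "kernel_op P (\<lambda>y. c * f y) x = c * kernel_op P f x"
  unfolding kernel_op_def by simp

lemma kernel_op_diff:
  "f \<in> bounded_measurable M \<Longrightarrow> g \<in> bounded_measurable M \<Longrightarrow> x \<in> space M \<Longrightarrow>
    kernel_op P (\<lambda>y. f y - g y) x = kernel_op P f x - kernel_op P g x"
  unfolding kernel_op_def
  by (intro Bochner_Integration.integral_diff integrable_kernel)

lemma kernel_op_sum:
  "x \<in> space M \<Longrightarrow> (\<And>i. i \<in> I \<Longrightarrow> f i \<in> bounded_measurable M) \<Longrightarrow>
    kernel_op P (\<lambda>y. \<Sum>i\<in>I. f i y) x = (\<Sum>i\<in>I. kernel_op P (f i) x)"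
  by (induction I rule: infinite_finite_induct)
     (auto simp: kernel_op_const[of x 0, simplified] kernel_op_add bounded_measurable_sum)

lemma kernel_op_bounded_measurable:
  assumes "f \<in> bounded_measurable M" shows "kernel_op P f \<in> bounded_measurable M"
proof -
  obtain b where b: "\<forall>x\<in>space M. \<bar>f x\<bar> \<le> b"
    using assms unfolding bounded_measurable_def by blast
  have "\<bar>kernel_op P f x\<bar> \<le> b" if "x \<in> space M" for x
  proof -
    have "kernel_op P f x \<le> kernel_op P (\<lambda>_. b) x" "kernel_op P (\<lambda>_. -b) x \<le> kernel_op P f x"
      using that assms b by (force intro!: kernel_op_mono bounded_measurable_const simp: abs_le_iff)+
    then show ?thesis using that by (simp add: kernel_op_const)
  qed
  with assms show ?thesis by (intro bounded_measurableI) auto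
qed

lemma integral_bind_kernel:
  assumes "prob_space N" "sets N = sets M" "f \<in> bounded_measurable M"
  shows "(\<integral>x. f x \<partial>(N \<bind> P)) = (\<integral>x. kernel_op P f x \<partial>N)"
proof -
  obtain b where b: "\<And>x. x \<in> space M \<Longrightarrow> \<bar>f x\<bar> \<le> b"
    using assms(3) unfolding bounded_measurable_def by blast
  have N: "P \<in> N \<rightarrow>\<^sub>M subprob_algebra M"
    using kernel_subprob assms(2) by (simp cong: measurable_cong_sets)
  have sp: "space N = space M" using assms(2) by (rule sets_eq_imp_space_eq)
  have ae: "AE x in N. emeasure (P x) (space (P x)) \<le> ennreal 1"
    using sp prob_space.emeasure_space_1[OF prob_space_kernel] by (intro AE_I2) auto
  show ?thesis
    unfolding kernel_op_def
    by (rule integral_bind [where K = M and B = b and B' = 1])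
       (use assms b N ae prob_space.axioms(1)[OF assms(1)] in \<open>auto simp: prob_space_def\<close>)
qed

lemma markov_kernel_power: "markov_kernel M (kernel_power M P t)"
proof
  show "kernel_power M P t \<in> M \<rightarrow>\<^sub>M prob_algebra M"
  proof (induction t)
    case 0
    show ?case by (simp cong: measurable_cong)
  next
    case (Suc t)
    show ?case
      using measurable_bind_prob_space [OF Suc kernel] by (simp cong: measurable_cong)
  qed
qed

interpretation pow: markov_kernel M "kernel_power M P t" for t
  by (rule markov_kernel_power)

abbreviation Pt :: "nat \<Rightarrow> ('a \<Rightarrow> real) \<Rightarrow> 'a \<Rightarrow> real" where
  "Pt t \<equiv> kernel_op (kernel_power M P t)"

lemma kernel_power_op_0: "x \<in> space M \<Longrightarrow> f \<in> borel_measurable M \<Longrightarrow> Pt 0 f x = f x"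
  unfolding kernel_op_def by (simp add: integral_return)

lemma kernel_power_op_Suc:
  assumes "f \<in> bounded_measurable M" "x \<in> space M"
  shows "Pt (Suc t) f x = Pt t (kernel_op P f) x"
  using integral_bind_kernel [OF pow.prob_space_kernel pow.sets_kernel_eq assms(1), of x t] assms(2)
  by (simp add: kernel_op_def)

lemma kernel_power_op_add:
  assumes "f \<in> bounded_measurable M" "x \<in> space M"
  shows "Pt (s + t) f x =
    Pt s (Pt t f) x"
  using assms(1)
proof (induction t arbitrary: f)
  case 0
  have "Pt s (Pt 0 f) x = Pt s f x"
    using 0 assms(2) by (intro pow.kernel_op_cong kernel_power_op_0) auto
  then show ?case by (simp del: kernel_power.simps)
next
  case (Suc t)
  have "Pt (s + Suc t) f x = Pt (s + t) (kernel_op P f) x"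
    using kernel_power_op_Suc[OF Suc.prems assms(2), of "s + t"] by simp
  also have "\<dots> = Pt s (Pt t (kernel_op P f)) x"
    by (rule Suc.IH) (rule kernel_op_bounded_measurable [OF Suc.prems])
  also have "\<dots> = Pt s (Pt (Suc t) f) x"
    using Suc.prems assms(2) by (intro pow.kernel_op_cong kernel_power_op_Suc[symmetric]) auto
  finally show ?case .
qed

lemma kernel_power_op_1:
  assumes "f \<in> bounded_measurable M" "x \<in> space M"
  shows "Pt 1 f x = kernel_op P f x"
  using kernel_power_op_Suc[OF assms, of 0] kernel_power_op_0[OF assms(2), of "kernel_op P f"] assms(1)
  by simp

lemma kernel_power_op_Suc':
  assumes "f \<in> bounded_measurable M" "x \<in> space M"
  shows "Pt (Suc t) f x = kernel_op P (Pt t f) x"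
  using kernel_power_op_add[OF assms, of 1 t] kernel_power_op_1[OF pow.kernel_op_bounded_measurable[OF assms(1)] assms(2)]
  by simp

end

locale reversible_kernel = markov_kernel +
  fixes \<pi> :: "'a measure"
  assumes prob_pi: "prob_space \<pi>" and sets_pi: "sets \<pi> = sets M"
    and reversible: "reversible M P \<pi>"
begin

lemma space_pi: "space \<pi> = space M"
  by (rule sets_eq_imp_space_eq [OF sets_pi])

lemma borel_measurable_pi [simp]: "borel_measurable \<pi> = borel_measurable M"
  by (rule measurable_cong_sets [OF sets_pi refl])

lemma integrable_pi: "f \<in> bounded_measurable M \<Longrightarrow> integrable \<pi> f"
  by (rule integrable_bounded_measurable [OF _ prob_pi sets_pi])

text \<open>
  Both sides of the detailed balance equation have this form: \<open>h\<close> is the identity for the law of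
  \<open>(X\<^sub>0, X\<^sub>1)\<close> and the swap for that of \<open>(X\<^sub>1, X\<^sub>0)\<close>.
\<close>
lemma integral_pair_kernel:
  assumes "f \<in> borel_measurable (M \<Otimes>\<^sub>M M)" "\<And>z. z \<in> space (M \<Otimes>\<^sub>M M) \<Longrightarrow> \<bar>f z\<bar> \<le> (b::real)"
    and "(\<lambda>(x,y). h x y) \<in> M \<Otimes>\<^sub>M M \<rightarrow>\<^sub>M M \<Otimes>\<^sub>M M"
  shows "(\<integral>z. f z \<partial>(\<pi> \<bind> (\<lambda>x. P x \<bind> (\<lambda>y. return (M \<Otimes>\<^sub>M M) (h x y))))) = (\<integral>x. \<integral>y. f (h x y) \<partial>P x \<partial>\<pi>)"
proof -
  note assms(1,3)[measurable]
  let ?N = "M \<Otimes>\<^sub>M M"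
  interpret prob_space \<pi> by (rule prob_pi)
  have m1: "(\<lambda>y. return ?N (h x y)) \<in> M \<rightarrow>\<^sub>M prob_algebra ?N" if "x \<in> space M" for x
    using that by measurable
  have m2: "(\<lambda>x. P x \<bind> (\<lambda>y. return ?N (h x y))) \<in> M \<rightarrow>\<^sub>M prob_algebra ?N"
    using kernel by measurable
  have "(\<integral>z. f z \<partial>(\<pi> \<bind> (\<lambda>x. P x \<bind> (\<lambda>y. return ?N (h x y))))) =
    (\<integral>x. (\<integral>z. f z \<partial>(P x \<bind> (\<lambda>y. return ?N (h x y)))) \<partial>\<pi>)"
  proof (rule integral_bind [where K = ?N and B = b and B' = 1])
    show "(\<lambda>x. P x \<bind> (\<lambda>y. return ?N (h x y))) \<in> \<pi> \<rightarrow>\<^sub>M subprob_algebra ?N"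
      using measurable_prob_algebraD[OF m2] sets_pi by (simp cong: measurable_cong_sets)
    show "AE x in \<pi>. emeasure (P x \<bind> (\<lambda>y. return ?N (h x y))) (space (P x \<bind> (\<lambda>y. return ?N (h x y)))) \<le> ennreal 1"
      using measurable_space[OF m2] by (auto simp: space_prob_algebra space_pi prob_space.emeasure_space_1)
  qed (use assms in \<open>auto intro: finite_measure_axioms\<close>)
  also have "\<dots> = (\<integral>x. \<integral>y. f (h x y) \<partial>P x \<partial>\<pi>)"
  proof (rule Bochner_Integration.integral_cong)
    fix x assume "x \<in> space \<pi>"
    then have x: "x \<in> space M" by (simp add: space_pi)
    have "(\<integral>z. f z \<partial>(P x \<bind> (\<lambda>y. return ?N (h x y)))) = (\<integral>y. (\<integral>z. f z \<partial>return ?N (h x y)) \<partial>P x)"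
    proof (rule integral_bind [where K = ?N and B = b and B' = 1])
      show "(\<lambda>y. return ?N (h x y)) \<in> P x \<rightarrow>\<^sub>M subprob_algebra ?N"
        using measurable_prob_algebraD[OF m1[OF x]] sets_kernel_eq[OF x] by (simp cong: measurable_cong_sets)
      show "finite_measure (P x)" using prob_space_kernel[OF x] by (simp add: prob_space_def)
      show "AE y in P x. emeasure (return ?N (h x y)) (space (return ?N (h x y))) \<le> ennreal 1"
        by (auto intro!: AE_I2 simp: indicator_def)
    qed (use assms in auto)
    also have "\<dots> = (\<integral>y. f (h x y) \<partial>P x)"
    proof (rule Bochner_Integration.integral_cong)
      fix y assume "y \<in> space (P x)"
      then have "y \<in> space M" using sets_eq_imp_space_eq[OF sets_kernel_eq[OF x]] by simp
      with x have "h x y \<in> space ?N"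
        using measurable_space[OF assms(3), of "(x,y)"] by (simp add: space_pair_measure)
      then show "(\<integral>z. f z \<partial>return ?N (h x y)) = f (h x y)"
        by (intro integral_return) auto
    qed simp
    finally show "(\<integral>z. f z \<partial>(P x \<bind> (\<lambda>y. return ?N (h x y)))) = (\<integral>y. f (h x y) \<partial>P x)" .
  qed simp
  finally show ?thesis .
qed

text \<open>
  Detailed balance integrated against the product function \<open>u(x) v(y)\<close>.
\<close>
lemma kernel_op_self_adjoint:
  assumes u: "u \<in> bounded_measurable M" and v: "v \<in> bounded_measurable M"
  shows "(\<integral>x. u x * kernel_op P v x \<partial>\<pi>) = (\<integral>x. kernel_op P u x * v x \<partial>\<pi>)"
proof -
  obtain a b where ab: "\<And>x. x \<in> space M \<Longrightarrow> \<bar>u x\<bar> \<le> a" "\<And>x. x \<in> space M \<Longrightarrow> \<bar>v x\<bar> \<le> b"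
    using u v unfolding bounded_measurable_def by blast
  note [measurable] = bounded_measurable_measurable[OF u] bounded_measurable_measurable[OF v]
  let ?f = "\<lambda>z. u (fst z) * v (snd z)"
  have f: "?f \<in> borel_measurable (M \<Otimes>\<^sub>M M)" by measurable
  have bound: "\<bar>?f z\<bar> \<le> a * b" if "z \<in> space (M \<Otimes>\<^sub>M M)" for z
    using that ab[of "fst z"] ab[of "snd z"]
    by (auto simp: space_pair_measure abs_mult intro!: mult_mono intro: order_trans[OF abs_ge_zero])
  have "(\<integral>x. u x * kernel_op P v x \<partial>\<pi>) = (\<integral>x. \<integral>y. ?f (x, y) \<partial>P x \<partial>\<pi>)"
    by (simp add: kernel_op_def)
  also have "\<dots> = (\<integral>z. ?f z \<partial>(\<pi> \<bind> (\<lambda>x. P x \<bind> (\<lambda>y. return (M \<Otimes>\<^sub>M M) (x, y)))))"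
    by (rule integral_pair_kernel[symmetric, OF f bound]) simp_all
  also have "\<dots> = (\<integral>z. ?f z \<partial>(\<pi> \<bind> (\<lambda>y. P y \<bind> (\<lambda>x. return (M \<Otimes>\<^sub>M M) (x, y)))))"
    using reversible unfolding reversible_def by simp
  also have "\<dots> = (\<integral>y. \<integral>x. ?f (x, y) \<partial>P y \<partial>\<pi>)"
    by (rule integral_pair_kernel[OF f bound]) simp_all
  also have "\<dots> = (\<integral>x. kernel_op P u x * v x \<partial>\<pi>)"
    by (simp add: kernel_op_def)
  finally show ?thesis .
qed

lemma integral_kernel_op:
  assumes "f \<in> bounded_measurable M"
  shows "(\<integral>x. kernel_op P f x \<partial>\<pi>) = (\<integral>x. f x \<partial>\<pi>)"
proof -
  have "(\<integral>x. kernel_op P f x \<partial>\<pi>) = (\<integral>x. kernel_op P (\<lambda>_. 1) x * f x \<partial>\<pi>)"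
    using kernel_op_self_adjoint[OF bounded_measurable_const assms, of 1] by simp
  also have "\<dots> = (\<integral>x. f x \<partial>\<pi>)"
    by (rule Bochner_Integration.integral_cong) (auto simp: kernel_op_const space_pi)
  finally show ?thesis .
qed

end

section \<open>Quadratic forms of a reversible kernel\<close>

context markov_kernel
begin

text \<open>
  Jensen, in the form that variances are nonnegative.
\<close>
lemma kernel_op_square_le:
  assumes "f \<in> bounded_measurable M" "x \<in> space M"
  shows "(kernel_op P f x)\<^sup>2 \<le> kernel_op P (\<lambda>y. (f y)\<^sup>2) x"
proof -
  interpret prob_space "P x" using assms(2) by (rule prob_space_kernel)
  have "0 \<le> variance f" by (rule variance_positive)
  also have "variance f = expectation (\<lambda>y. (f y)\<^sup>2) - (expectation f)\<^sup>2"
    using assms by (intro variance_eq integrable_kernel bounded_measurable_power2)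
  finally show ?thesis by (simp add: kernel_op_def)
qed

end

context reversible_kernel
begin

text \<open>
  The inner product of \<open>L\<^sup>2(\<pi>)\<close>.
\<close>
definition inner_pi :: "('a \<Rightarrow> real) \<Rightarrow> ('a \<Rightarrow> real) \<Rightarrow> real" where
  "inner_pi u v = (\<integral>x. u x * v x \<partial>\<pi>)"

lemma inner_pi_commute: "inner_pi u v = inner_pi v u"
  unfolding inner_pi_def by (simp add: mult.commute)

lemma inner_pi_cong:
  "(\<And>x. x \<in> space M \<Longrightarrow> u x = u' x) \<Longrightarrow> (\<And>x. x \<in> space M \<Longrightarrow> v x = v' x) \<Longrightarrow> inner_pi u v = inner_pi u' v'"
  unfolding inner_pi_def by (rule Bochner_Integration.integral_cong) (auto simp: space_pi)

lemma inner_pi_self_nonneg: "0 \<le> inner_pi u u"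
  unfolding inner_pi_def by simp

lemma inner_pi_scale_left: "inner_pi (\<lambda>x. c * u x) v = c * inner_pi u v"
  unfolding inner_pi_def by (simp add: mult.assoc)

lemma inner_pi_scale_right: "inner_pi u (\<lambda>x. c * v x) = c * inner_pi u v"
  using inner_pi_scale_left[of c v u] by (simp add: inner_pi_commute)

lemma inner_pi_add_left:
  "u \<in> bounded_measurable M \<Longrightarrow> u' \<in> bounded_measurable M \<Longrightarrow> v \<in> bounded_measurable M \<Longrightarrow>
    inner_pi (\<lambda>x. u x + u' x) v = inner_pi u v + inner_pi u' v"
  unfolding inner_pi_def by (simp add: distrib_right integrable_pi bounded_measurable_mult)

lemma inner_pi_diff_left:
  "u \<in> bounded_measurable M \<Longrightarrow> u' \<in> bounded_measurable M \<Longrightarrow> v \<in> bounded_measurable M \<Longrightarrow>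
    inner_pi (\<lambda>x. u x - u' x) v = inner_pi u v - inner_pi u' v"
  unfolding inner_pi_def by (simp add: left_diff_distrib integrable_pi bounded_measurable_mult)

lemma inner_pi_add_right:
  "u \<in> bounded_measurable M \<Longrightarrow> u' \<in> bounded_measurable M \<Longrightarrow> v \<in> bounded_measurable M \<Longrightarrow>
    inner_pi v (\<lambda>x. u x + u' x) = inner_pi v u + inner_pi v u'"
  using inner_pi_add_left[of u u' v] by (simp add: inner_pi_commute)

lemma inner_pi_diff_right:
  "u \<in> bounded_measurable M \<Longrightarrow> u' \<in> bounded_measurable M \<Longrightarrow> v \<in> bounded_measurable M \<Longrightarrow>
    inner_pi v (\<lambda>x. u x - u' x) = inner_pi v u - inner_pi v u'"
  using inner_pi_diff_left[of u u' v] by (simp add: inner_pi_commute)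

lemmas inner_pi_expand = inner_pi_scale_left inner_pi_scale_right inner_pi_add_left inner_pi_add_right inner_pi_diff_left inner_pi_diff_right
  bounded_measurable_add bounded_measurable_diff bounded_measurable_scale kernel_op_bounded_measurable

lemma inner_pi_kernel_op:
  "u \<in> bounded_measurable M \<Longrightarrow> v \<in> bounded_measurable M \<Longrightarrow> inner_pi u (kernel_op P v) = inner_pi (kernel_op P u) v"
  unfolding inner_pi_def by (rule kernel_op_self_adjoint)

lemma kernel_op_contraction:
  assumes "f \<in> bounded_measurable M"
  shows "inner_pi (kernel_op P f) (kernel_op P f) \<le> inner_pi f f"
proof -
  have "inner_pi (kernel_op P f) (kernel_op P f) = (\<integral>x. (kernel_op P f x)\<^sup>2 \<partial>\<pi>)"
    by (simp add: inner_pi_def power2_eq_square)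
  also have "\<dots> \<le> (\<integral>x. kernel_op P (\<lambda>y. (f y)\<^sup>2) x \<partial>\<pi>)"
    using assms
    by (intro integral_mono integrable_pi bounded_measurable_power2 kernel_op_bounded_measurable)
       (auto simp: space_pi intro: kernel_op_square_le)
  also have "\<dots> = inner_pi f f"
    using integral_kernel_op[OF bounded_measurable_power2[OF assms]]
    by (simp add: inner_pi_def power2_eq_square)
  finally show ?thesis .
qed

lemma inner_pi_kernel_op_bounds:
  assumes f: "f \<in> bounded_measurable M"
  shows "- inner_pi f f \<le> inner_pi f (kernel_op P f)" "inner_pi f (kernel_op P f) \<le> inner_pi f f"
proof -
  note Pf = kernel_op_bounded_measurable[OF f]
  have "0 \<le> inner_pi (\<lambda>x. f x + kernel_op P f x) (\<lambda>x. f x + kernel_op P f x)" by (rule inner_pi_self_nonneg)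
  then show "- inner_pi f f \<le> inner_pi f (kernel_op P f)"
    using kernel_op_contraction[OF f] f Pf by (simp add: inner_pi_expand inner_pi_commute[of "kernel_op P f" f])
  have "0 \<le> inner_pi (\<lambda>x. f x - kernel_op P f x) (\<lambda>x. f x - kernel_op P f x)" by (rule inner_pi_self_nonneg)
  then show "inner_pi f (kernel_op P f) \<le> inner_pi f f"
    using kernel_op_contraction[OF f] f Pf by (simp add: inner_pi_expand inner_pi_commute[of "kernel_op P f" f])
qed

text \<open>
  The form of \<open>S = P - a\<close> is nonnegative and bounded by \<open>1 - a\<close>. Evaluating it at \<open>u = f - t S f\<close> with
  \<open>t = 1/(1 - a)\<close> gives the bound, which is the Cauchy-Schwarz inequality of that form for \<open>f\<close> and \<open>S f\<close>.
\<close>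
lemma inner_pi_shifted_kernel_op_le:
  assumes lower: "\<And>u. u \<in> bounded_measurable M \<Longrightarrow> a * inner_pi u u \<le> inner_pi u (kernel_op P u)"
    and a: "a < 1" and f: "f \<in> bounded_measurable M"
  defines "g \<equiv> \<lambda>x. kernel_op P f x - a * f x"
  shows "inner_pi g g \<le> (1 - a) * (inner_pi f (kernel_op P f) - a * inner_pi f f)"
proof -
  define t where "t = 1 / (1 - a)"
  have t: "(1 - a) * t = 1" and t_pos: "0 < t" using a by (auto simp: t_def)
  have Pf: "kernel_op P f \<in> bounded_measurable M" by (rule kernel_op_bounded_measurable[OF f])
  have g: "g \<in> bounded_measurable M" unfolding g_def using f Pf by (simp add: inner_pi_expand)
  have Pg: "kernel_op P g \<in> bounded_measurable M" by (rule kernel_op_bounded_measurable[OF g])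
  define u where "u = (\<lambda>x. f x - t * g x)"
  have u: "u \<in> bounded_measurable M" unfolding u_def using f g by (simp add: inner_pi_expand)
  have "inner_pi u (kernel_op P u) = inner_pi u (\<lambda>x. kernel_op P f x - t * kernel_op P g x)"
    using f g by (intro inner_pi_cong) (auto simp: u_def kernel_op_diff kernel_op_scale bounded_measurable_scale)
  also have "\<dots> = inner_pi f (kernel_op P f) - t * inner_pi f (kernel_op P g) - t * inner_pi g (kernel_op P f)
      + t\<^sup>2 * inner_pi g (kernel_op P g)"
    unfolding u_def using f g Pf Pg by (simp add: inner_pi_expand power2_eq_square algebra_simps)
  finally have form: "0 \<le> inner_pi f (kernel_op P f) - t * inner_pi f (kernel_op P g) - t * inner_pi g (kernel_op P f)
      + t\<^sup>2 * inner_pi g (kernel_op P g) - a * (inner_pi f f - 2 * t * inner_pi f g + t\<^sup>2 * inner_pi g g)"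
    using lower[OF u] f g unfolding u_def
    by (simp add: inner_pi_expand inner_pi_commute[of g f] power2_eq_square algebra_simps)
  have gg: "inner_pi g g = inner_pi g (kernel_op P f) - a * inner_pi f g"
    using f g Pf by (subst (2) g_def) (simp add: inner_pi_expand inner_pi_commute[of g f])
  have sym: "inner_pi f (kernel_op P g) = inner_pi g (kernel_op P f)"
    using inner_pi_kernel_op[OF f g] by (simp add: inner_pi_commute)
  have "t\<^sup>2 * inner_pi g (kernel_op P g) \<le> t\<^sup>2 * inner_pi g g"
    using inner_pi_kernel_op_bounds(2)[OF g] by (simp add: mult_left_mono)
  with form have "0 \<le> inner_pi f (kernel_op P f) - a * inner_pi f f - 2 * t * inner_pi g g + t\<^sup>2 * (1 - a) * inner_pi g g"
    unfolding gg sym by (simp add: algebra_simps)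
  also have "t\<^sup>2 * (1 - a) = t" using t by (simp add: power2_eq_square mult.commute)
  finally have "t * inner_pi g g \<le> inner_pi f (kernel_op P f) - a * inner_pi f f" by simp
  then have "(1 - a) * (t * inner_pi g g) \<le> (1 - a) * (inner_pi f (kernel_op P f) - a * inner_pi f f)"
    using a by (intro mult_left_mono) auto
  then show ?thesis using t by (simp add: mult.assoc[symmetric])
qed

text \<open>
  A nonnegative spectrum makes the quadratic form nonnegative: let \<open>a\<close> be the best constant with
  \<open>\<langle>u, P u\<rangle> \<ge> a \<langle>u, u\<rangle>\<close> and suppose \<open>a < 0\<close>. Then \<open>a\<close> is not in the spectrum, so \<open>\<parallel>u\<parallel> \<le> R \<parallel>(P - a) u\<parallel>\<close>,
  and \<open>\<parallel>(P - a) u\<parallel>\<^sup>2\<close> is at most \<open>1 - a\<close> times \<open>\<langle>u, (P - a) u\<rangle>\<close>. Thus the form of \<open>P - a\<close> is bounded below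
  by a positive multiple of \<open>\<langle>u, u\<rangle>\<close>, and \<open>a\<close> was not optimal.
\<close>
lemma inner_pi_kernel_op_nonneg:
  assumes nonneg: "nonneg_eigenvalues P \<pi>" and f: "f \<in> bounded_measurable M"
  shows "0 \<le> inner_pi f (kernel_op P f)"
proof -
  define A where "A = {a. a \<le> 0 \<and> (\<forall>u\<in>bounded_measurable M. a * inner_pi u u \<le> inner_pi u (kernel_op P u))}"
  define a where "a = Sup A"
  have A1: "-1 \<in> A" using inner_pi_kernel_op_bounds(1) by (auto simp: A_def)
  have bdd: "bdd_above A" by (rule bdd_aboveI[of _ 0]) (auto simp: A_def)
  have a0: "a \<le> 0" unfolding a_def
  proof (rule cSup_least)
    show "A \<noteq> {}" using A1 by blast
  qed (simp add: A_def)
  have lower: "a * inner_pi u u \<le> inner_pi u (kernel_op P u)" if u: "u \<in> bounded_measurable M" for u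
  proof (cases "inner_pi u u = 0")
    case True
    then show ?thesis using inner_pi_kernel_op_bounds(1)[OF u] by simp
  next
    case False
    then have pos: "0 < inner_pi u u" using inner_pi_self_nonneg[of u] by simp
    have "a \<le> inner_pi u (kernel_op P u) / inner_pi u u"
      unfolding a_def
    proof (rule cSup_least)
      show "A \<noteq> {}" using A1 by blast
    qed (use u pos in \<open>simp add: A_def field_simps\<close>)
    then show ?thesis using pos by (simp add: field_simps)
  qed
  have "\<not> a < 0"
  proof
    assume neg: "a < 0"
    then have "a \<in> L2_resolvent_set \<pi> (kernel_op P)"
      using nonneg by (auto simp: nonneg_eigenvalues_def L2_spectrum_def)
    then obtain R where R: "\<And>u. u \<in> L2_space \<pi> \<Longrightarrow>
        L2_norm \<pi> u \<le> R * L2_norm \<pi> (\<lambda>x. a * u x - kernel_op P u x)"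
      unfolding L2_resolvent_set_def by blast
  \<comment> \<open>The summand \<open>1\<close> keeps \<open>d\<close> positive even if \<open>R = 0\<close>.\<close>
    define d where "d = R\<^sup>2 * (1 - a) + 1"
    have d: "0 < d" using neg by (auto simp: d_def intro!: add_nonneg_pos mult_nonneg_nonneg)
    have gap: "(a + 1 / d) * inner_pi u u \<le> inner_pi u (kernel_op P u)" if u: "u \<in> bounded_measurable M" for u
    proof -
      define g where "g = (\<lambda>x. kernel_op P u x - a * u x)"
      have "u \<in> L2_space \<pi>"
        using u integrable_pi[OF bounded_measurable_power2[OF u]] by (auto simp: L2_space_def)
      from R[OF this] have "sqrt (inner_pi u u) \<le> R * sqrt (inner_pi g g)"
        by (simp add: L2_norm_def inner_pi_def power2_eq_square g_def algebra_simps)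
      then have "(sqrt (inner_pi u u))\<^sup>2 \<le> (R * sqrt (inner_pi g g))\<^sup>2"
        by (intro power_mono) (auto simp: inner_pi_self_nonneg)
      then have "inner_pi u u \<le> R\<^sup>2 * inner_pi g g" by (simp add: power_mult_distrib inner_pi_self_nonneg)
      also have "\<dots> \<le> R\<^sup>2 * ((1 - a) * (inner_pi u (kernel_op P u) - a * inner_pi u u))"
        using inner_pi_shifted_kernel_op_le[OF lower _ u] neg by (intro mult_left_mono) (auto simp: g_def)
      also have "\<dots> \<le> d * (inner_pi u (kernel_op P u) - a * inner_pi u u)"
        using lower[OF u] by (simp add: d_def algebra_simps)
      finally show ?thesis using d by (simp add: field_simps)
    qed
    have "min 0 (a + 1 / d) \<in> A"
    proof -
      have "min 0 (a + 1 / d) * inner_pi u u \<le> inner_pi u (kernel_op P u)" if "u \<in> bounded_measurable M" for u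
        using gap[OF that] inner_pi_self_nonneg[of u]
        by (meson dual_order.trans min.cobounded2 mult_right_mono)
      then show ?thesis by (simp add: A_def)
    qed
    then have "min 0 (a + 1 / d) \<le> a" unfolding a_def using bdd by (rule cSup_upper)
    with neg d show False by (simp add: min_def split: if_splits)
  qed
  with a0 have "a = 0" by simp
  with lower[OF f] show ?thesis by simp
qed

text \<open>
  This is \<open>P\<^sup>2 \<le> P\<close>; on even and odd powers, \<open>P \<le> 1\<close> and \<open>P\<^sup>2 \<le> P\<close> together make \<open>\<langle>f, P\<^sup>n f\<rangle>\<close> decreasing.
\<close>
lemma inner_pi_square_kernel_op_le:
  assumes nonneg: "nonneg_eigenvalues P \<pi>" and f: "f \<in> bounded_measurable M"
  shows "inner_pi (kernel_op P f) (kernel_op P f) \<le> inner_pi f (kernel_op P f)"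
  using inner_pi_shifted_kernel_op_le[of 0 f] inner_pi_kernel_op_nonneg[OF nonneg] f by simp

interpretation pow: markov_kernel M "kernel_power M P t" for t
  by (rule markov_kernel_power)

lemma inner_pi_power:
  assumes "u \<in> bounded_measurable M" "v \<in> bounded_measurable M"
  shows "inner_pi u (Pt n v) = inner_pi (Pt n u) v"
  using assms(1)
proof (induction n arbitrary: u)
  case 0
  then show ?case
    using assms(2) by (intro inner_pi_cong) (auto simp: kernel_power_op_0 bounded_measurable_measurable simp del: kernel_power.simps)
next
  case (Suc n)
  note Pu = kernel_op_bounded_measurable[OF Suc.prems]
  have "inner_pi u (Pt (Suc n) v) = inner_pi u (kernel_op P (Pt n v))"
    using assms(2) by (intro inner_pi_cong) (auto intro: kernel_power_op_Suc')
  also have "\<dots> = inner_pi (kernel_op P u) (Pt n v)"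
    by (rule inner_pi_kernel_op[OF Suc.prems pow.kernel_op_bounded_measurable[OF assms(2)]])
  also have "\<dots> = inner_pi (Pt n (kernel_op P u)) v" by (rule Suc.IH[OF Pu])
  also have "\<dots> = inner_pi (Pt (Suc n) u) v"
    using Suc.prems by (intro inner_pi_cong) (auto intro: kernel_power_op_Suc[symmetric])
  finally show ?case .
qed

lemma inner_pi_const_left: "inner_pi (\<lambda>_. c) u = c * (\<integral>x. u x \<partial>\<pi>)"
  by (simp add: inner_pi_def)

lemma integral_power:
  assumes "f \<in> bounded_measurable M"
  shows "(\<integral>x. Pt n f x \<partial>\<pi>) = (\<integral>x. f x \<partial>\<pi>)"
proof -
  have "inner_pi (\<lambda>_. 1) (Pt n f) = inner_pi (Pt n (\<lambda>_. 1)) f"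
    by (rule inner_pi_power[OF bounded_measurable_const assms])
  also have "\<dots> = inner_pi (\<lambda>_. 1) f"
    by (rule inner_pi_cong) (auto simp: pow.kernel_op_const)
  finally show ?thesis by (simp add: inner_pi_const_left)
qed

text \<open>
  With \<open>u = P\<^sup>k f\<close>, the step from \<open>n = 2k\<close> is \<open>\<langle>u, P u\<rangle> \<le> \<langle>u, u\<rangle>\<close> and that from \<open>n = 2k + 1\<close> is
  \<open>\<langle>P u, P u\<rangle> \<le> \<langle>u, P u\<rangle>\<close>.
\<close>
lemma inner_pi_power_decseq:
  assumes nonneg: "nonneg_eigenvalues P \<pi>" and f: "f \<in> bounded_measurable M"
  shows "decseq (\<lambda>n. inner_pi f (Pt n f))"
proof (rule decseq_SucI)
  fix n
  have step: "inner_pi f (Pt (i + j) f) = inner_pi (Pt i f) (Pt j f)" for i j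
  proof -
    have "inner_pi f (Pt (i + j) f) = inner_pi f (Pt i (Pt j f))"
      by (rule inner_pi_cong) (auto intro: kernel_power_op_add[OF f])
    then show ?thesis using f by (simp add: inner_pi_power pow.kernel_op_bounded_measurable)
  qed
  have half: "inner_pi (Pt i f) (Pt (Suc j) f) = inner_pi (Pt i f) (kernel_op P (Pt j f))" for i j
    by (rule inner_pi_cong) (auto intro: kernel_power_op_Suc'[OF f])
  show "inner_pi f (Pt (Suc n) f) \<le> inner_pi f (Pt n f)"
  proof (cases "even n")
    case True
    then obtain k where k: "n = k + k" by (auto elim: evenE simp: mult_2)
    have "inner_pi f (Pt (Suc n) f) = inner_pi (Pt k f) (kernel_op P (Pt k f))"
      using step[of k "Suc k"] half[of k k] by (simp add: k)
    also have "\<dots> \<le> inner_pi (Pt k f) (Pt k f)"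
      by (rule inner_pi_kernel_op_bounds(2)) (rule pow.kernel_op_bounded_measurable[OF f])
    finally show ?thesis using step[of k k] by (simp add: k)
  next
    case False
    then obtain k where k: "n = Suc k + k" by (auto elim: oddE simp: mult_2)
    have "inner_pi f (Pt (Suc n) f) = inner_pi (Pt (Suc k) f) (Pt (Suc k) f)"
      using step[of "Suc k" "Suc k"] by (simp add: k del: kernel_power.simps)
    also have "\<dots> = inner_pi (kernel_op P (Pt k f)) (kernel_op P (Pt k f))"
      by (rule inner_pi_cong) (auto intro: kernel_power_op_Suc'[OF f])
    also have "\<dots> \<le> inner_pi (Pt k f) (kernel_op P (Pt k f))"
      by (rule inner_pi_square_kernel_op_le[OF nonneg pow.kernel_op_bounded_measurable[OF f]])
    also have "\<dots> = inner_pi f (Pt n f)"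
      using step[of k "Suc k"] half[of k k] by (simp add: k add.commute del: kernel_power.simps)
    finally show ?thesis .
  qed
qed

end

section \<open>The regeneration time\<close>

locale minorized_kernel = markov_kernel +
  fixes C :: "'a set" and m :: nat and eps :: real and \<nu> :: "'a measure"
  assumes small: "small_set M P C m eps \<nu>"
begin

interpretation pow: markov_kernel M "kernel_power M P t" for t
  by (rule markov_kernel_power)

lemma C_sets [measurable]: "C \<in> sets M" and m_pos: "1 \<le> m" and eps_pos: "0 < eps"
  and prob_nu: "prob_space \<nu>" and sets_nu: "sets \<nu> = sets M"
  and minorization: "\<And>x S. x \<in> C \<Longrightarrow> S \<in> sets M \<Longrightarrow> eps * measure \<nu> S \<le> measure (kernel_power M P m x) S"
  using small unfolding small_set_def by auto

lemma C_space: "x \<in> C \<Longrightarrow> x \<in> space M"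
  using sets.sets_into_space[OF C_sets] by blast

lemma space_nu: "space \<nu> = space M"
  by (rule sets_eq_imp_space_eq [OF sets_nu])

lemma borel_measurable_nu [simp]: "borel_measurable \<nu> = borel_measurable M"
  by (rule measurable_cong_sets [OF sets_nu refl])

lemma integrable_nu: "f \<in> bounded_measurable M \<Longrightarrow> integrable \<nu> f"
  by (rule integrable_bounded_measurable [OF _ prob_nu sets_nu])

lemma measure_nu_space [simp]: "measure \<nu> (space \<nu>) = 1"
  by (rule prob_space.prob_space [OF prob_nu])

text \<open>
  Domination passes from sets to functions. It is stated for unbounded \<open>g\<close> because it is applied to
  \<open>V\<close> and its powers, whose \<open>\<nu>\<close>-integrability comes from this lemma.
\<close>
lemma nu_dominated:
  assumes x: "x \<in> C" and g: "integrable (kernel_power M P m x) g" "\<And>y. y \<in> space M \<Longrightarrow> 0 \<le> (g y::real)"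
  shows "integrable \<nu> g" "eps * (\<integral>y. g y \<partial>\<nu>) \<le> (\<integral>y. g y \<partial>kernel_power M P m x)"
proof -
  let ?Q = "kernel_power M P m x"
  note xM = C_space[OF x]
  interpret Q: prob_space ?Q by (rule pow.prob_space_kernel[OF xM])
  interpret nu: prob_space \<nu> by (rule prob_nu)
  have sets: "sets ?Q = sets M" by (rule pow.sets_kernel_eq[OF xM])
  have sp: "space ?Q = space M" by (rule sets_eq_imp_space_eq[OF sets])
  have gM: "g \<in> borel_measurable M"
    using borel_measurable_integrable[OF g(1)] sets by (simp cong: measurable_cong_sets)
  have le: "scale_measure (ennreal eps) \<nu> \<le> ?Q"
  proof (subst le_measure)
    show "\<forall>A\<in>sets (scale_measure (ennreal eps) \<nu>). emeasure (scale_measure (ennreal eps) \<nu>) A \<le> emeasure ?Q A"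
      using minorization[OF x] eps_pos
      by (auto simp: sets_nu Q.emeasure_eq_measure nu.emeasure_eq_measure ennreal_mult[symmetric] intro!: ennreal_leI)
  qed (simp add: sets_nu sets)
  have nn: "ennreal eps * (\<integral>\<^sup>+y. g y \<partial>\<nu>) \<le> (\<integral>\<^sup>+y. g y \<partial>?Q)"
    using nn_integral_mono_measure[OF _ le, of "\<lambda>y. ennreal (g y)"] gM
    by (simp add: nn_integral_scale_measure sets_nu sets)
  have Qnn: "(\<integral>\<^sup>+y. g y \<partial>?Q) = ennreal (\<integral>y. g y \<partial>?Q)"
    using g sp by (intro nn_integral_eq_integral) auto
  have "(\<integral>\<^sup>+y. g y \<partial>\<nu>) < \<infinity>"
    using nn eps_pos unfolding Qnn
    by (metis ennreal_less_top ennreal_mult_eq_top_iff infinity_ennreal_def less_top not_le top.not_eq_extremum ennreal_eq_0_iff)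
  then show int: "integrable \<nu> g"
    using g(2) gM by (intro integrableI_nonneg) (auto simp: space_nu)
  have "(\<integral>\<^sup>+y. g y \<partial>\<nu>) = ennreal (\<integral>y. g y \<partial>\<nu>)"
    using g(2) int by (intro nn_integral_eq_integral) (auto simp: space_nu)
  with nn Qnn show "eps * (\<integral>y. g y \<partial>\<nu>) \<le> (\<integral>y. g y \<partial>?Q)"
    using eps_pos integral_nonneg_AE[OF AE_I2, of "kernel_power M P m x" g] g(2) sp
    by (simp add: ennreal_mult'[symmetric])
qed

text \<open>
  The residual part \<open>R = P\<^sup>m - \<epsilon>\<nu>\<close> as an operator. The minorization makes it positive at points of \<open>C\<close>, where alone it is used.
\<close>
definition residual :: "('a \<Rightarrow> real) \<Rightarrow> 'a \<Rightarrow> real" where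
  "residual g x = Pt m g x - eps * (\<integral>y. g y \<partial>\<nu>)"

lemma residual_nonneg:
  assumes "x \<in> C" "integrable (kernel_power M P m x) g" "\<And>y. y \<in> space M \<Longrightarrow> 0 \<le> g y"
  shows "0 \<le> residual g x"
  using nu_dominated(2)[OF assms] by (simp add: residual_def kernel_op_def)

lemma residual_diff:
  assumes "x \<in> C" "integrable (kernel_power M P m x) f" "integrable \<nu> f"
    "integrable (kernel_power M P m x) g" "integrable \<nu> g"
  shows "residual (\<lambda>y. f y - g y) x = residual f x - residual g x"
  using assms by (simp add: residual_def kernel_op_def algebra_simps)

lemma residual_mono:
  assumes "x \<in> C" "integrable (kernel_power M P m x) f" "integrable \<nu> f"
    "integrable (kernel_power M P m x) g" "integrable \<nu> g" "\<And>y. y \<in> space M \<Longrightarrow> f y \<le> g y"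
  shows "residual f x \<le> residual g x"
  using residual_nonneg[OF assms(1), of "\<lambda>y. g y - f y"] assms residual_diff[of x g f]
  by simp

lemma residual_bounded_measurable:
  "g \<in> bounded_measurable M \<Longrightarrow> residual g \<in> bounded_measurable M"
  unfolding residual_def by (intro bounded_measurable_intros pow.kernel_op_bounded_measurable)

lemma residual_cong:
  "x \<in> C \<Longrightarrow> (\<And>y. y \<in> space M \<Longrightarrow> f y = g y) \<Longrightarrow> residual f x = residual g x"
  unfolding residual_def
  by (intro arg_cong2[of _ _ _ _ "\<lambda>a b. a - eps * b"] pow.kernel_op_cong Bochner_Integration.integral_cong)
     (auto simp: C_space space_nu)

lemma residual_scale: "residual (\<lambda>y. c * g y) x = c * residual g x"
  by (simp add: residual_def pow.kernel_op_scale algebra_simps)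

lemma residual_const: "x \<in> C \<Longrightarrow> residual (\<lambda>_. c) x = (1 - eps) * c"
  by (simp add: residual_def pow.kernel_op_const C_space algebra_simps)

lemma residual_add:
  "x \<in> C \<Longrightarrow> f \<in> bounded_measurable M \<Longrightarrow> g \<in> bounded_measurable M \<Longrightarrow>
    residual (\<lambda>y. f y + g y) x = residual f x + residual g x"
  by (simp add: residual_def pow.kernel_op_add C_space integrable_nu algebra_simps)

lemma residual_sum:
  "x \<in> C \<Longrightarrow> (\<And>i. i \<in> I \<Longrightarrow> f i \<in> bounded_measurable M) \<Longrightarrow>
    residual (\<lambda>y. \<Sum>i\<in>I. f i y) x = (\<Sum>i\<in>I. residual (f i) x)"
  by (induction I rule: infinite_finite_induct)
     (auto simp: residual_const[of x 0, simplified] residual_add bounded_measurable_sum)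

text \<open>
  The operators \<open>w\<^sub>t g(x) = E\<^sub>x[g(X\<^sub>t); T > t]\<close> and below the probabilities \<open>a\<^sub>s(x) = Pr\<^sub>x(T = s)\<close>, for the
  regeneration time \<open>T\<close>. They are defined by conditioning on the first step off \<open>C\<close> and on the
  first \<open>m\<close> steps on \<open>C\<close>, so that no path space and no bridge between times \<open>0\<close> and \<open>m\<close> is needed:
  no regeneration is possible before time \<open>m\<close>, and at time \<open>m\<close> only \<open>R\<close> remains.
\<close>
function taboo :: "nat \<Rightarrow> ('a \<Rightarrow> real) \<Rightarrow> 'a \<Rightarrow> real" where
  "taboo t g = (\<lambda>x.
     if x \<in> C then if t < m then Pt t g x else residual (taboo (t - m) g) x
     else if t = 0 then g x else kernel_op P (taboo (t - 1) g) x)"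
  by auto
termination using m_pos by (relation "Wellfounded.measure fst") auto

declare taboo.simps [simp del]

function regen :: "nat \<Rightarrow> 'a \<Rightarrow> real" where
  "regen s = (\<lambda>x.
     if x \<in> C then if s < m then 0 else if s = m then eps else residual (regen (s - m)) x
     else if s = 0 then 0 else kernel_op P (regen (s - 1)) x)"
  by auto
termination using m_pos by (relation "Wellfounded.measure id") auto

declare regen.simps [simp del]

lemma taboo_C_less: "x \<in> C \<Longrightarrow> t < m \<Longrightarrow> taboo t g x = Pt t g x"
  and taboo_C_add: "x \<in> C \<Longrightarrow> taboo (m + t) g x = residual (taboo t g) x"
  and taboo_notC_0: "x \<notin> C \<Longrightarrow> taboo 0 g x = g x"
  and taboo_notC_Suc: "x \<notin> C \<Longrightarrow> taboo (Suc t) g x = kernel_op P (taboo t g) x"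
  by (subst taboo.simps; simp)+

lemma regen_0: "regen 0 x = 0"
  using m_pos by (subst regen.simps) simp

lemma regen_C_less: "x \<in> C \<Longrightarrow> s < m \<Longrightarrow> regen s x = 0"
  and regen_C_m: "x \<in> C \<Longrightarrow> regen m x = eps"
  and regen_C_add: "x \<in> C \<Longrightarrow> 0 < s \<Longrightarrow> regen (m + s) x = residual (regen s) x"
  and regen_notC_Suc: "x \<notin> C \<Longrightarrow> regen (Suc s) x = kernel_op P (regen s) x"
  using m_pos by (subst regen.simps; simp)+

lemma bounded_measurable_split:
  assumes "f \<in> bounded_measurable M" "g \<in> bounded_measurable M"
    and "\<And>x. x \<in> C \<Longrightarrow> h x = f x" "\<And>x. x \<notin> C \<Longrightarrow> h x = g x"
  shows "h \<in> bounded_measurable M"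
proof -
  have C: "indicator C \<in> bounded_measurable M"
    by (rule bounded_measurableI[where b = 1]) (auto simp: indicator_def)
  have "(\<lambda>x. indicator C x * f x + (1 - indicator C x) * g x) \<in> bounded_measurable M"
    by (intro bounded_measurable_intros C assms(1,2))
  also have "(\<lambda>x. indicator C x * f x + (1 - indicator C x) * g x) = h"
    using assms(3,4) by (auto simp: fun_eq_iff indicator_def)
  finally show ?thesis .
qed

lemma taboo_bounded_measurable:
  assumes g: "g \<in> bounded_measurable M" shows "taboo t g \<in> bounded_measurable M"
proof (induction t rule: less_induct)
  case (less t)
  have "(if t < m then Pt t g else residual (taboo (t - m) g)) \<in> bounded_measurable M"
    using less m_pos g by (auto intro!: pow.kernel_op_bounded_measurable residual_bounded_measurable)
  moreover have "(if t = 0 then g else kernel_op P (taboo (t - 1) g)) \<in> bounded_measurable M"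
    using less g by (auto intro!: kernel_op_bounded_measurable)
  ultimately show ?case
    by (rule bounded_measurable_split) (subst taboo.simps; simp)+
qed

lemma regen_bounded_measurable: "regen s \<in> bounded_measurable M"
proof (induction s rule: less_induct)
  case (less s)
  have "(if s < m then \<lambda>_. 0 else if s = m then \<lambda>_. eps else residual (regen (s - m))) \<in> bounded_measurable M"
    using less m_pos by (auto intro!: bounded_measurable_const residual_bounded_measurable)
  moreover have "(if s = 0 then \<lambda>_. 0 else kernel_op P (regen (s - 1))) \<in> bounded_measurable M"
    using less by (auto intro!: bounded_measurable_const kernel_op_bounded_measurable)
  ultimately show ?case
    by (rule bounded_measurable_split) (subst regen.simps; simp)+
qed

text \<open>
  Induction along the common recursion of \<open>taboo\<close> and \<open>regen\<close>.
\<close>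
lemma taboo_induct [consumes 1, case_names start run less cycle]:
  assumes "x \<in> space M"
    and "\<And>x. x \<in> space M \<Longrightarrow> x \<notin> C \<Longrightarrow> Q 0 x"
    and "\<And>t x. x \<in> space M \<Longrightarrow> x \<notin> C \<Longrightarrow> (\<And>y. y \<in> space M \<Longrightarrow> Q t y) \<Longrightarrow> Q (Suc t) x"
    and "\<And>t x. x \<in> C \<Longrightarrow> t < m \<Longrightarrow> Q t x"
    and "\<And>t x. x \<in> C \<Longrightarrow> (\<And>y. y \<in> space M \<Longrightarrow> Q t y) \<Longrightarrow> Q (m + t) x"
  shows "Q (t::nat) x"
  using assms(1)
proof (induction t arbitrary: x rule: less_induct)
  case (less t)
  show ?case
  proof (cases "x \<in> C")
    case True
    show ?thesis
    proof (cases "t < m")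
      case False
      then have "t = m + (t - m)" "t - m < t" using m_pos by auto
      then show ?thesis using assms(5)[OF True, of "t - m"] less.IH[of "t - m"] by simp
    qed (rule assms(4)[OF True])
  next
    case False
    then show ?thesis using assms(2,3) less by (cases t) auto
  qed
qed

lemma taboo_nonneg:
  assumes "g \<in> bounded_measurable M" "\<And>y. y \<in> space M \<Longrightarrow> 0 \<le> g y" "x \<in> space M"
  shows "0 \<le> taboo t g x"
  using assms(3)
proof (induction t x rule: taboo_induct)
  case (start x)
  then show ?case using assms(2) by (simp add: taboo_notC_0)
next
  case (run t x)
  then have "kernel_op P (\<lambda>_. 0) x \<le> kernel_op P (taboo t g) x"
    using assms(1) by (intro kernel_op_mono bounded_measurable_const taboo_bounded_measurable) auto
  with run show ?case by (simp add: taboo_notC_Suc kernel_op_const)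
next
  case (less t x)
  then have "Pt t (\<lambda>_. 0) x \<le> Pt t g x"
    using assms by (intro pow.kernel_op_mono bounded_measurable_const) (auto simp: C_space)
  with less show ?case by (simp add: taboo_C_less pow.kernel_op_const C_space)
next
  case (cycle t x)
  then show ?case
    using assms(1) by (simp add: taboo_C_add)
      (intro residual_nonneg pow.integrable_kernel taboo_bounded_measurable, auto simp: C_space)
qed

lemma residual_diff_bounded:
  assumes "x \<in> C" "f \<in> bounded_measurable M" "g \<in> bounded_measurable M"
  shows "residual (\<lambda>y. f y - g y) x = residual f x - residual g x"
  using assms by (intro residual_diff integrable_nu pow.integrable_kernel) (auto simp: C_space)

lemma taboo_diff:
  assumes "f \<in> bounded_measurable M" "g \<in> bounded_measurable M" "x \<in> space M"
  shows "taboo t (\<lambda>y. f y - g y) x = taboo t f x - taboo t g x"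
  using assms(3)
proof (induction t x rule: taboo_induct)
  case (run t x)
  then have "kernel_op P (taboo t (\<lambda>y. f y - g y)) x = kernel_op P (\<lambda>y. taboo t f y - taboo t g y) x"
    by (intro kernel_op_cong) auto
  with run show ?case
    using assms by (simp add: taboo_notC_Suc kernel_op_diff taboo_bounded_measurable)
next
  case (cycle t x)
  then have "residual (taboo t (\<lambda>y. f y - g y)) x = residual (\<lambda>y. taboo t f y - taboo t g y) x"
    by (intro residual_cong) auto
  with cycle show ?case
    using assms by (simp add: taboo_C_add residual_diff_bounded taboo_bounded_measurable)
qed (use assms in \<open>auto simp: taboo_notC_0 taboo_C_less pow.kernel_op_diff C_space\<close>)

abbreviation survival :: "nat \<Rightarrow> 'a \<Rightarrow> real" where
  "survival t \<equiv> taboo t (\<lambda>_. 1)"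

lemma survival_bounded_measurable: "survival t \<in> bounded_measurable M"
  by (rule taboo_bounded_measurable) (rule bounded_measurable_const)

lemma taboo_le_survival:
  assumes "g \<in> bounded_measurable M" "\<And>y. y \<in> space M \<Longrightarrow> g y \<le> 1" "x \<in> space M"
  shows "taboo t g x \<le> survival t x"
proof -
  have "0 \<le> taboo t (\<lambda>y. 1 - g y) x"
    using assms by (intro taboo_nonneg bounded_measurable_intros) auto
  with assms show ?thesis by (simp add: taboo_diff bounded_measurable_const)
qed

lemma regen_nonneg: "x \<in> space M \<Longrightarrow> 0 \<le> regen t x"
proof (induction t x rule: taboo_induct)
  case (start x)
  then show ?case by (simp add: regen_0)
next
  case (run t x)
  then have "kernel_op P (\<lambda>_. 0) x \<le> kernel_op P (regen t) x"
    by (intro kernel_op_mono bounded_measurable_const regen_bounded_measurable) auto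
  with run show ?case by (simp add: regen_notC_Suc kernel_op_const)
next
  case (less t x)
  then show ?case by (simp add: regen_C_less)
next
  case (cycle t x)
  then have "0 \<le> residual (regen t) x"
    by (intro residual_nonneg pow.integrable_kernel regen_bounded_measurable) (auto simp: C_space)
  with cycle show ?case using eps_pos by (cases "t = 0") (auto simp: regen_C_add regen_C_m)
qed

text \<open>
  Decomposition according to the regeneration time. On \<open>C\<close>, the term \<open>\<epsilon>\<nu>(P\<^sup>t g)\<close> of
  \<open>P\<^sup>m (P\<^sup>t g) = R (P\<^sup>t g) + \<epsilon>\<nu>(P\<^sup>t g)\<close> is the summand for \<open>T = m\<close>.
\<close>
lemma renewal:
  assumes g: "g \<in> bounded_measurable M" and "x \<in> space M"
  shows "Pt t g x = taboo t g x + (\<Sum>s\<le>t. regen s x * (\<integral>y. Pt (t - s) g y \<partial>\<nu>))"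
  using assms(2)
proof (induction t x rule: taboo_induct)
  case (start x)
  then show ?case using kernel_power_op_0[of x g] g by (simp add: taboo_notC_0 regen_0 bounded_measurable_measurable del: kernel_power.simps)
next
  case (run t x)
  let ?n = "\<lambda>s. \<integral>y. Pt (t - s) g y \<partial>\<nu>"
  have "Pt (Suc t) g x = kernel_op P (Pt t g) x"
    using g run.hyps(1) by (rule kernel_power_op_Suc')
  also have "\<dots> = kernel_op P (\<lambda>y. taboo t g y + (\<Sum>s\<le>t. ?n s * regen s y)) x"
    using run by (intro kernel_op_cong) (auto simp: mult.commute)
  also have "\<dots> = kernel_op P (taboo t g) x + (\<Sum>s\<le>t. ?n s * kernel_op P (regen s) x)"
    using run g
    by (subst kernel_op_add)
       (auto simp: taboo_bounded_measurable regen_bounded_measurable kernel_op_sum kernel_op_scale bounded_measurable_scale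
         intro!: bounded_measurable_sum bounded_measurable_scale)
  also have "\<dots> = taboo (Suc t) g x + (\<Sum>s\<le>t. regen (Suc s) x * (\<integral>y. Pt (Suc t - Suc s) g y \<partial>\<nu>))"
    using run by (simp add: taboo_notC_Suc regen_notC_Suc mult.commute)
  also have "\<dots> = taboo (Suc t) g x + (\<Sum>s\<le>Suc t. regen s x * (\<integral>y. Pt (Suc t - s) g y \<partial>\<nu>))"
    by (subst sum.atMost_Suc_shift) (simp add: regen_0)
  finally show ?case .
next
  case (less t x)
  then show ?case by (simp add: taboo_C_less regen_C_less)
next
  case (cycle t x)
  let ?n = "\<lambda>s. \<integral>y. Pt (t - s) g y \<partial>\<nu>"
  note x = C_space[OF cycle.hyps(1)]
  have shift: "regen (m + s) x = residual (regen s) x + (if s = 0 then eps else 0)" for s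
  proof (cases "s = 0")
    case True
    have "residual (regen 0) x = residual (\<lambda>_. 0) x"
      using cycle by (intro residual_cong) (auto simp: regen_0)
    with True cycle show ?thesis by (simp add: regen_C_m residual_const)
  qed (use cycle in \<open>simp add: regen_C_add\<close>)
  have "Pt (m + t) g x = residual (Pt t g) x + eps * ?n 0"
    using kernel_power_op_add[OF g x, of m t] by (simp add: residual_def)
  also have "residual (Pt t g) x = residual (\<lambda>y. taboo t g y + (\<Sum>s\<le>t. ?n s * regen s y)) x"
    using cycle by (intro residual_cong) (auto simp: mult.commute)
  also have "\<dots> = residual (taboo t g) x + (\<Sum>s\<le>t. ?n s * residual (regen s) x)"
    using cycle g
    by (subst residual_add)
       (auto simp: taboo_bounded_measurable regen_bounded_measurable residual_sum residual_scale bounded_measurable_scale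
         intro!: bounded_measurable_sum bounded_measurable_scale)
  finally have "Pt (m + t) g x = residual (taboo t g) x +
      ((\<Sum>s\<le>t. ?n s * residual (regen s) x) + eps * ?n 0)"
    by simp
  also have "(\<Sum>s\<le>t. ?n s * residual (regen s) x) + eps * ?n 0 = (\<Sum>s\<le>t. regen (m + s) x * ?n s)"
  proof -
    have "(\<Sum>s\<le>t. regen (m + s) x * ?n s) =
      (\<Sum>s\<le>t. ?n s * residual (regen s) x + (if s = 0 then eps * ?n 0 else 0))"
      by (rule sum.cong, simp, subst shift, simp add: algebra_simps)
    then show ?thesis by (simp add: sum.distrib del: kernel_power.simps)
  qed
  also have "\<dots> = (\<Sum>s\<in>{m..m + t}. regen s x * (\<integral>y. Pt (m + t - s) g y \<partial>\<nu>))"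
    by (rule sum.reindex_bij_witness[of _ "\<lambda>s. s - m" "\<lambda>s. m + s"]) auto
  also have "\<dots> = (\<Sum>s\<le>m + t. regen s x * (\<integral>y. Pt (m + t - s) g y \<partial>\<nu>))"
    using cycle by (intro sum.mono_neutral_left) (auto simp: regen_C_less)
  finally show ?case using cycle by (simp add: taboo_C_add add.assoc)
qed

lemma survival_eq:
  assumes "x \<in> space M" shows "survival t x = 1 - (\<Sum>s\<le>t. regen s x)"
proof -
  have "(\<integral>y. Pt s (\<lambda>_. 1) y \<partial>\<nu>) = (\<integral>y. 1 \<partial>\<nu>)" for s
    by (rule Bochner_Integration.integral_cong) (auto simp: pow.kernel_op_const space_nu)
  then show ?thesis
    using renewal[OF bounded_measurable_const assms, of t 1] assms
    by (simp add: pow.kernel_op_const )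
qed

lemma survival_bounds:
  assumes "x \<in> space M" shows "0 \<le> survival t x" "survival t x \<le> 1"
  using taboo_nonneg[OF bounded_measurable_const _ assms, of 1 t] survival_eq[OF assms, of t]
    sum_nonneg[of "{..t}" "\<lambda>s. regen s x"] regen_nonneg[OF assms] by auto

text \<open>
  The function \<open>\<phi>\<close> decays by \<open>\<rho>\<close> per step off \<open>C\<close> on average, and a cycle of length \<open>m\<close>
  from \<open>C\<close> without regeneration brings it down to \<open>\<rho>\<^sup>m \<le> \<rho>\<^sup>m \<phi>\<close>. The factor \<open>\<rho>\<^sup>1\<^sup>-\<^sup>m\<close> pays for the first \<open>m - 1\<close> steps on \<open>C\<close>, when survival is certain.
\<close>
lemma survival_le:
  assumes \<phi>: "\<phi> \<in> borel_measurable M" "\<And>y. y \<in> space M \<Longrightarrow> 1 \<le> \<phi> y"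
    and \<rho>: "0 < \<rho>" "\<rho> \<le> 1"
    and off: "\<And>y. y \<in> space M \<Longrightarrow> y \<notin> C \<Longrightarrow> integrable (P y) \<phi> \<and> kernel_op P \<phi> y \<le> \<rho> * \<phi> y"
    and on: "\<And>y. y \<in> C \<Longrightarrow> integrable (kernel_power M P m y) \<phi> \<and> residual \<phi> y \<le> \<rho> ^ m"
    and "x \<in> space M"
  shows "survival t x \<le> \<rho> ^ (t + 1) / \<rho> ^ m * \<phi> x"
  using assms(7)
proof (induction t x rule: taboo_induct)
  case (start x)
  have "\<rho> ^ m \<le> \<rho> ^ 1" using \<rho> m_pos by (intro power_decreasing) auto
  then have "1 * 1 \<le> \<rho> ^ (0 + 1) / \<rho> ^ m * \<phi> x"
    using \<rho> \<phi>(2)[of x] start by (intro mult_mono) auto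
  with start show ?case by (simp add: taboo_notC_0)
next
  case (run t x)
  let ?c = "\<rho> ^ (t + 1) / \<rho> ^ m"
  have "survival (Suc t) x = (\<integral>y. survival t y \<partial>P x)"
    using run by (simp add: taboo_notC_Suc kernel_op_def)
  also have "\<dots> \<le> (\<integral>y. ?c * \<phi> y \<partial>P x)"
    using run off sets_eq_imp_space_eq[OF sets_kernel_eq[of x]]
    by (intro integral_mono integrable_kernel[OF survival_bounded_measurable] integrable_mult_right) auto
  also have "\<dots> = ?c * kernel_op P \<phi> x" by (simp add: kernel_op_def)
  also have "\<dots> \<le> ?c * (\<rho> * \<phi> x)" using off run \<rho> by (intro mult_left_mono) auto
  finally show ?case by (simp add: mult_ac)
next
  case (less t x)
  have "\<rho> ^ m \<le> \<rho> ^ (t + 1)" using \<rho> less by (intro power_decreasing) auto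
  then have "1 * 1 \<le> \<rho> ^ (t + 1) / \<rho> ^ m * \<phi> x"
    using \<rho> \<phi>(2)[of x] less by (intro mult_mono) (auto simp: C_space)
  with less show ?case by (simp add: taboo_C_less pow.kernel_op_const C_space)
next
  case (cycle t x)
  let ?c = "\<rho> ^ (t + 1) / \<rho> ^ m"
  have int: "integrable (kernel_power M P m x) \<phi>" using on cycle by blast
  have "integrable \<nu> \<phi>"
    using cycle int \<phi>(2) by (intro nu_dominated(1)) (auto intro: order_trans[OF zero_le_one])
  then have "integrable \<nu> (\<lambda>y. ?c * \<phi> y)" by simp
  moreover have "integrable (kernel_power M P m x) (\<lambda>y. ?c * \<phi> y)" using int by simp
  ultimately have "residual (survival t) x \<le> residual (\<lambda>y. ?c * \<phi> y) x"
    using cycle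
    by (intro residual_mono pow.integrable_kernel[OF survival_bounded_measurable C_space]
          integrable_nu[OF survival_bounded_measurable])
  also have "\<dots> = ?c * residual \<phi> x" by (rule residual_scale)
  also have "\<dots> \<le> ?c * \<rho> ^ m" using on cycle \<rho> by (intro mult_left_mono) auto
  also have "\<dots> \<le> ?c * \<rho> ^ m * \<phi> x"
    using mult_left_mono[of 1 "\<phi> x" "?c * \<rho> ^ m"] \<rho> \<phi>(2)[OF C_space] cycle by simp
  finally show ?case using cycle by (simp add: taboo_C_add power_add mult_ac)
qed

end

section \<open>Monotone solutions of renewal equations\<close>

text \<open>
  Summation by parts: convolving the increments of \<open>g\<close> with the tails \<open>p\<close> of \<open>a\<close> turns \<open>p\<^sub>n\<^sub>-\<^sub>1 - p\<^sub>n\<close> into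
  \<open>a\<^sub>n\<close>, and the renewal equation leaves only the boundary terms. In generating functions,
  \<open>(1 - z) G(z)\<close> times \<open>P(z) = (1 - A(z))/(1 - z)\<close> is \<open>(1 - A(z)) G(z) = E(z)\<close>.
\<close>
lemma renewal_sequence_increments:
  fixes g a e p :: "nat \<Rightarrow> real"
  assumes ren: "\<And>n. g n = e n + (\<Sum>s\<le>n. a s * g (n - s))"
    and p: "\<And>n. p n = 1 - (\<Sum>s\<le>n. a s)" and a0: "a 0 = 0"
  shows "(\<Sum>k\<in>{1..n}. (g (k - 1) - g k) * p (n - k)) = g 0 * p n - e n"
proof (cases n)
  case 0
  then show ?thesis using ren[of 0] p[of 0] a0 by simp
next
  case (Suc l)
  have pdiff: "p (l - j) - p (Suc l - j) = a (Suc l - j)" if "j \<le> l" for j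
    using that p[of "l - j"] p[of "Suc l - j"] by (simp add: Suc_diff_le)
  have "(\<Sum>k\<in>{1..Suc l}. (g (k - 1) - g k) * p (Suc l - k)) =
      (\<Sum>j\<le>l. g j * p (l - j)) - (\<Sum>j\<le>l. g (Suc j) * p (l - j))"
    by (subst sum.reindex_bij_witness[of _ Suc "\<lambda>k. k - 1" "{..l}" "\<lambda>j. (g j - g (Suc j)) * p (l - j)"])
       (auto simp: left_diff_distrib sum_subtractf)
  also have "(\<Sum>j\<le>l. g (Suc j) * p (l - j)) = (\<Sum>j\<le>Suc l. g j * p (Suc l - j)) - g 0 * p (Suc l)"
    by (subst sum.atMost_Suc_shift) simp
  also have "(\<Sum>j\<le>Suc l. g j * p (Suc l - j)) = (\<Sum>j\<le>l. g j * p (Suc l - j)) + g (Suc l)"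
    using p[of 0] a0 by simp
  also have "(\<Sum>j\<le>l. g j * p (l - j)) - ((\<Sum>j\<le>l. g j * p (Suc l - j)) + g (Suc l) - g 0 * p (Suc l))
      = (\<Sum>j\<le>l. g j * a (Suc l - j)) - g (Suc l) + g 0 * p (Suc l)"
    using pdiff by (simp add: sum_subtractf[symmetric] right_diff_distrib[symmetric])
  also have "(\<Sum>j\<le>l. g j * a (Suc l - j)) = (\<Sum>j\<le>Suc l. g j * a (Suc l - j))"
    using a0 by simp
  also have "\<dots> = (\<Sum>s\<le>Suc l. a s * g (Suc l - s))"
    by (rule sum.reindex_bij_witness[of _ "\<lambda>s. Suc l - s" "\<lambda>s. Suc l - s"]) auto
  finally show ?thesis using ren[of "Suc l"] Suc by simp
qed

text \<open>
  For \<open>0 < z < 1/\<rho>\<close> the series \<open>S = \<Sum>n. p\<^sub>n z\<^sup>n\<close> is finite, and multiplying the hypothesis by \<open>z\<^sup>n\<close> and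
  summing gives \<open>(\<Sum>k. d\<^sub>k z\<^sup>k) S \<le> c S\<close>, since all terms are nonnegative. Cancel \<open>S \<ge> p\<^sub>0 = 1\<close> and let \<open>z\<close>
  tend to \<open>1/\<rho>\<close>; the bound for finite \<open>n\<close> survives although \<open>S\<close> may diverge in the limit.
\<close>
lemma convolution_summable_bound:
  fixes d p :: "nat \<Rightarrow> real"
  assumes d: "\<And>k. 0 \<le> d k" and p: "\<And>n. 0 \<le> p n" and p0: "p 0 = 1" and W: "\<And>n. p n \<le> W * \<rho> ^ n"
    and \<rho>: "0 < \<rho>" and conv: "\<And>n. (\<Sum>k\<in>{1..n}. d k * p (n - k)) \<le> c * p n"
  shows "(\<Sum>k\<in>{1..n}. d k / \<rho> ^ k) \<le> c"
proof -
  have *: "(\<Sum>k\<in>{1..n}. d k * z ^ k) \<le> c" if z: "0 < z" "z < 1 / \<rho>" for z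
  proof -
    have zr: "\<bar>\<rho> * z\<bar> < 1" using z \<rho> by (simp add: field_simps abs_mult)
    define S where "S N = (\<Sum>j\<le>N. p j * z ^ j)" for N
    have "summable (\<lambda>j. p j * z ^ j)"
    proof (rule summable_comparison_test')
      show "summable (\<lambda>j. W * (\<rho> * z) ^ j)" using zr by (intro summable_mult summable_geometric) simp
      show "norm (p j * z ^ j) \<le> W * (\<rho> * z) ^ j" if "0 \<le> j" for j
        using mult_right_mono[OF W[of j], of "z ^ j"] p[of j] z by (simp add: power_mult_distrib)
    qed
    then have S_lim: "S \<longlonglongrightarrow> (\<Sum>j. p j * z ^ j)"
      unfolding S_def [abs_def] by (rule summable_LIMSEQ')
    have "1 \<le> S 0" by (simp add: S_def p0)
    also have "S 0 \<le> (\<Sum>j. p j * z ^ j)"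
      unfolding S_def using \<open>summable _\<close> p z by (intro sum_le_suminf) auto
    finally have S_pos: "0 < (\<Sum>j. p j * z ^ j)" by simp
    have main: "(\<Sum>k\<in>{1..n}. d k * z ^ k) * S N \<le> c * S (n + N)" for N
    proof -
      have "(\<Sum>k\<in>{1..n}. d k * z ^ k) * S N = (\<Sum>(k,j)\<in>{1..n} \<times> {..N}. (d k * z ^ k) * (p j * z ^ j))"
        unfolding S_def sum_product by (simp add: sum.cartesian_product)
      also have "\<dots> = (\<Sum>(k,j)\<in>{1..n} \<times> {..N}. d k * p j * z ^ (k + j))"
        by (intro sum.cong) (auto simp: power_add)
  \<comment> \<open>Enlarge the rectangle to the triangle \<open>k + j = l \<le> n + N\<close>, on whose diagonals the hypothesis applies.\<close>
      also have "\<dots> \<le> (\<Sum>(k,j)\<in>(\<lambda>(l,k). (k, l - k)) ` (SIGMA l:{..n + N}. {1..l}). d k * p j * z ^ (k + j))"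
      proof (rule sum_mono2)
        show "{1..n} \<times> {..N} \<subseteq> (\<lambda>(l,k). (k, l - k)) ` (SIGMA l:{..n + N}. {1..l})"
        proof
          fix q assume "q \<in> {1..n} \<times> {..N}"
          then obtain k j where "q = (k, j)" "1 \<le> k" "k \<le> n" "j \<le> N" by auto
          then have "q = (\<lambda>(l,k). (k, l - k)) (k + j, k)" "(k + j, k) \<in> (SIGMA l:{..n + N}. {1..l})" by auto
          then show "q \<in> (\<lambda>(l,k). (k, l - k)) ` (SIGMA l:{..n + N}. {1..l})" by (rule image_eqI)
        qed
      qed (use d p z in auto)
      also have "\<dots> = (\<Sum>(l,k)\<in>(SIGMA l:{..n + N}. {1..l}). d k * p (l - k) * z ^ l)"
        by (subst sum.reindex) (auto simp: inj_on_def intro!: sum.cong)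
      also have "\<dots> = (\<Sum>l\<le>n + N. (\<Sum>k\<in>{1..l}. d k * p (l - k)) * z ^ l)"
        by (simp add: sum.Sigma[symmetric] sum_distrib_right)
      also have "\<dots> \<le> (\<Sum>l\<le>n + N. (c * p l) * z ^ l)"
        using conv z by (intro sum_mono mult_right_mono) auto
      also have "\<dots> = c * S (n + N)" by (simp add: S_def sum_distrib_left mult.assoc)
      finally show ?thesis .
    qed
    have "(\<Sum>k\<in>{1..n}. d k * z ^ k) * (\<Sum>j. p j * z ^ j) \<le> c * (\<Sum>j. p j * z ^ j)"
    proof (rule LIMSEQ_le)
      show "(\<lambda>N. (\<Sum>k\<in>{1..n}. d k * z ^ k) * S N) \<longlonglongrightarrow> (\<Sum>k\<in>{1..n}. d k * z ^ k) * (\<Sum>j. p j * z ^ j)"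
        by (intro tendsto_intros S_lim)
      show "(\<lambda>N. c * S (n + N)) \<longlonglongrightarrow> c * (\<Sum>j. p j * z ^ j)"
        using LIMSEQ_ignore_initial_segment[OF S_lim, of n] by (intro tendsto_intros) (simp add: add.commute)
    qed (use main in auto)
    then show ?thesis using S_pos by simp
  qed
  have "(\<Sum>k\<in>{1..n}. d k * (1 / \<rho>) ^ k) \<le> c"
  proof (rule tendsto_upperbound)
    show "((\<lambda>z. \<Sum>k\<in>{1..n}. d k * z ^ k) \<longlongrightarrow> (\<Sum>k\<in>{1..n}. d k * (1 / \<rho>) ^ k)) (at_left (1 / \<rho>))"
      by (intro tendsto_intros)
    show "eventually (\<lambda>z. (\<Sum>k\<in>{1..n}. d k * z ^ k) \<le> c) (at_left (1 / \<rho>))"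
      using \<rho> by (intro eventually_at_leftI[of 0]) (auto intro: * simp del: One_nat_def)
  qed simp
  then show ?thesis by (simp add: power_divide)
qed

text \<open>
  The weighted increments sum to at most \<open>g 0\<close>, so the tail sum from \<open>n + 1\<close> is at most \<open>\<rho>\<^sup>n\<^sup>+\<^sup>1 g 0\<close>. This
  bounds \<open>g n - l\<close>, and the instance \<open>n = 0\<close> feeds back into the estimate by bounding \<open>g 0\<close> itself.
  Monotonicity of \<open>g\<close> replaces any analysis of the poles of its generating function.
\<close>
lemma renewal_sequence_convergence:
  fixes g a e p :: "nat \<Rightarrow> real"
  assumes ren: "\<And>n. g n = e n + (\<Sum>s\<le>n. a s * g (n - s))"
    and p: "\<And>n. p n = 1 - (\<Sum>s\<le>n. a s)" and a0: "a 0 = 0"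
    and e: "\<And>n. 0 \<le> e n" and p_nonneg: "\<And>n. 0 \<le> p n" and W: "\<And>n. p n \<le> W * \<rho> ^ n"
    and \<rho>: "0 < \<rho>" "\<rho> < 1" and dec: "decseq g" and g0: "0 \<le> g 0" and lim: "g \<longlonglongrightarrow> l" "l \<le> 1"
  shows "g n - 1 \<le> \<rho> ^ (n + 1) / (1 - \<rho>)"
proof -
  have d: "0 \<le> g (k - 1) - g k" for k
    using decseqD[OF dec, of "k - 1" k] by simp
  have sum_le: "(\<Sum>k\<in>{1..N}. (g (k - 1) - g k) / \<rho> ^ k) \<le> g 0" for N
  proof (rule convolution_summable_bound[OF d p_nonneg _ W \<rho>(1)])
    show "p 0 = 1" using p[of 0] a0 by simp
    show "(\<Sum>k\<in>{1..i}. (g (k - 1) - g k) * p (i - k)) \<le> g 0 * p i" for i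
      using renewal_sequence_increments[OF ren p a0, of i] e[of i] by simp
  qed
  have tail: "g i - g (i + N) \<le> \<rho> ^ (i + 1) * g 0" for i N
  proof -
    have "g i - g (i + N) = (\<Sum>k\<in>{i + 1..i + N}. g (k - 1) - g k)"
      by (induction N) auto
    also have "\<dots> \<le> (\<Sum>k\<in>{i + 1..i + N}. \<rho> ^ (i + 1) * ((g (k - 1) - g k) / \<rho> ^ k))"
    proof (rule sum_mono)
      fix k assume "k \<in> {i + 1..i + N}"
      then have "\<rho> ^ k \<le> \<rho> ^ (i + 1)" using \<rho> by (intro power_decreasing) auto
      then have "(g (k - 1) - g k) * 1 \<le> (g (k - 1) - g k) * (\<rho> ^ (i + 1) / \<rho> ^ k)"
        using d[of k] \<rho> by (intro mult_left_mono) (auto simp: field_simps)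
      then show "g (k - 1) - g k \<le> \<rho> ^ (i + 1) * ((g (k - 1) - g k) / \<rho> ^ k)" by (simp add: mult_ac)
    qed
    also have "\<dots> \<le> \<rho> ^ (i + 1) * (\<Sum>k\<in>{1..i + N}. (g (k - 1) - g k) / \<rho> ^ k)"
      unfolding sum_distrib_left[symmetric]
      using d \<rho> by (intro mult_left_mono sum_mono2) auto
    also have "\<dots> \<le> \<rho> ^ (i + 1) * g 0"
      using sum_le \<rho> by (intro mult_left_mono) auto
    finally show ?thesis .
  qed
  have bound: "g i - 1 \<le> \<rho> ^ (i + 1) * g 0" for i
  proof -
    have "g i - l \<le> \<rho> ^ (i + 1) * g 0"
    proof (rule LIMSEQ_le_const2)
      show "(\<lambda>N. g i - g (N + i)) \<longlonglongrightarrow> g i - l"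
        by (intro tendsto_intros LIMSEQ_ignore_initial_segment lim)
      show "\<exists>K. \<forall>N\<ge>K. g i - g (N + i) \<le> \<rho> ^ (i + 1) * g 0"
        using tail[of i] by (auto simp: add.commute)
    qed
    with lim(2) show ?thesis by simp
  qed
  have "g 0 \<le> 1 / (1 - \<rho>)"
    using bound[of 0] \<rho> by (simp add: field_simps)
  then have "\<rho> ^ (n + 1) * g 0 \<le> \<rho> ^ (n + 1) * (1 / (1 - \<rho>))"
    using \<rho> by (intro mult_left_mono) auto
  with bound[of n] show ?thesis by simp
qed

text \<open>
  Summation by parts with \<open>a (Suc n) = p n - p (Suc n)\<close>, carried out as an induction on \<open>t\<close>; each step contributes
  one \<open>(1 - \<rho>) p\<^sub>t\<close>, which is the origin of the linear factor in \<open>t\<close>.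
\<close>
lemma renewal_forcing_bound:
  fixes a p :: "nat \<Rightarrow> real"
  assumes p: "\<And>n. p n = 1 - (\<Sum>s\<le>n. a s)" and a0: "a 0 = 0"
    and W: "\<And>n. p n \<le> W * \<rho> ^ n" and \<rho>: "0 < \<rho>" "\<rho> \<le> 1"
  shows "(\<Sum>s\<le>t. a s * \<rho> ^ (t - s)) \<le> \<rho> ^ t - p t + (1 - \<rho>) / \<rho> * W * real t * \<rho> ^ t"
proof (induction t)
  case 0
  then show ?case using p[of 0] a0 by simp
next
  case (Suc t)
  have "(\<Sum>s\<le>Suc t. a s * \<rho> ^ (Suc t - s)) = \<rho> * (\<Sum>s\<le>t. a s * \<rho> ^ (t - s)) + a (Suc t)"
    by (simp add: sum_distrib_left Suc_diff_le mult_ac)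
  also have "a (Suc t) = p t - p (Suc t)" using p[of t] p[of "Suc t"] by simp
  also have "\<rho> * (\<Sum>s\<le>t. a s * \<rho> ^ (t - s)) \<le> \<rho> * (\<rho> ^ t - p t + (1 - \<rho>) / \<rho> * W * real t * \<rho> ^ t)"
    using Suc \<rho> by (intro mult_left_mono) auto
  also have "\<dots> + (p t - p (Suc t)) = \<rho> ^ Suc t - p (Suc t) + (1 - \<rho>) * p t + (1 - \<rho>) * W * real t * \<rho> ^ t"
    using \<rho> by (simp add: field_simps)
  also have "\<dots> \<le> \<rho> ^ Suc t - p (Suc t) + (1 - \<rho>) * (W * \<rho> ^ t) + (1 - \<rho>) * W * real t * \<rho> ^ t"
    using mult_left_mono[OF W[of t], of "1 - \<rho>"] \<rho> by simp
  also have "\<dots> = \<rho> ^ Suc t - p (Suc t) + (1 - \<rho>) / \<rho> * W * real (Suc t) * \<rho> ^ Suc t"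
    using \<rho> by (simp add: field_simps)
  finally show ?case by simp
qed

section \<open>Convergence from the regeneration measure\<close>

locale reversible_minorized_kernel = reversible_kernel M P \<pi> + minorized_kernel M P C m eps \<nu>
  for M :: "'a measure" and P \<pi> C m eps \<nu> +
  assumes nonneg: "nonneg_eigenvalues P \<pi>"
begin

interpretation pow: markov_kernel M "kernel_power M P t" for t
  by (rule markov_kernel_power)

lemma integral_survival_tendsto_0:
  assumes "\<And>x. x \<in> space M \<Longrightarrow> (\<lambda>t. survival t x) \<longlonglongrightarrow> 0"
  shows "(\<lambda>t. \<integral>x. survival t x \<partial>\<pi>) \<longlonglongrightarrow> 0"
proof -
  have "(\<lambda>t. \<integral>x. survival t x \<partial>\<pi>) \<longlonglongrightarrow> (\<integral>x. 0 \<partial>\<pi>)"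
  proof (rule integral_dominated_convergence[where w = "\<lambda>_. 1"])
    show "survival t \<in> borel_measurable \<pi>" for t
      using survival_bounded_measurable by (simp add: bounded_measurable_measurable)
    show "integrable \<pi> (\<lambda>_. 1::real)" by (rule integrable_pi[OF bounded_measurable_const])
    show "AE x in \<pi>. norm (survival t x) \<le> 1" for t
      using survival_bounds by (intro AE_I2) (auto simp: space_pi)
  qed (use assms in \<open>auto simp: space_pi\<close>)
  then show ?thesis by simp
qed

text \<open>
  If \<open>\<pi>(C) = 0\<close>, stationarity propagates \<open>\<integral> a\<^sub>s d\<pi> = 0\<close> from \<open>s = 0\<close> to all \<open>s\<close>, so a chain started from
  \<open>\<pi>\<close> never regenerates, although survival probabilities tend to \<open>0\<close>.
\<close>
lemma measure_C_pos:
  assumes "\<And>x. x \<in> space M \<Longrightarrow> (\<lambda>t. survival t x) \<longlonglongrightarrow> 0"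
  shows "0 < measure \<pi> C"
proof (rule ccontr)
  interpret pi: prob_space \<pi> by (rule prob_pi)
  assume "\<not> 0 < measure \<pi> C"
  then have "emeasure \<pi> C = 0"
    using measure_nonneg[of \<pi> C] by (simp add: pi.emeasure_eq_measure)
  then have ae: "AE x in \<pi>. x \<notin> C"
    using C_sets sets_pi by (intro AE_not_in) (auto simp: null_sets_def)
  have zero: "(\<integral>x. regen s x \<partial>\<pi>) = 0" for s
  proof (induction s)
    case 0
    then show ?case by (simp add: regen_0)
  next
    case (Suc s)
    have "(\<integral>x. regen (Suc s) x \<partial>\<pi>) = (\<integral>x. kernel_op P (regen s) x \<partial>\<pi>)"
    proof (rule integral_cong_AE)
      show "AE x in \<pi>. regen (Suc s) x = kernel_op P (regen s) x"
        using ae by eventually_elim (rule regen_notC_Suc)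
    qed (use regen_bounded_measurable kernel_op_bounded_measurable in \<open>auto simp: bounded_measurable_measurable\<close>)
    also have "\<dots> = 0" using Suc by (simp add: integral_kernel_op regen_bounded_measurable)
    finally show ?case .
  qed
  have "(\<integral>x. survival t x \<partial>\<pi>) = 1" for t
  proof -
    have "(\<integral>x. survival t x \<partial>\<pi>) = (\<integral>x. 1 - (\<Sum>s\<le>t. regen s x) \<partial>\<pi>)"
      by (intro Bochner_Integration.integral_cong) (auto simp: space_pi survival_eq)
    also have "\<dots> = (\<integral>x. 1 \<partial>\<pi>) - (\<integral>x. (\<Sum>s\<le>t. regen s x) \<partial>\<pi>)"
      by (intro Bochner_Integration.integral_diff integrable_pi bounded_measurable_intros regen_bounded_measurable)
    also have "(\<integral>x. (\<Sum>s\<le>t. regen s x) \<partial>\<pi>) = (\<Sum>s\<le>t. \<integral>x. regen s x \<partial>\<pi>)"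
      by (intro Bochner_Integration.integral_sum integrable_pi regen_bounded_measurable)
    finally show ?thesis by (simp add: zero pi.prob_space)
  qed
  with integral_survival_tendsto_0[OF assms] show False
    using LIMSEQ_unique[of "\<lambda>t. 1::real" 1 0] by simp
qed

text \<open>
  From \<open>\<pi> = \<pi>P\<^sup>m \<ge> \<epsilon> \<pi>(C) \<nu>\<close> the density of \<open>\<nu>\<close> is at most \<open>1/(\<epsilon> \<pi>(C))\<close> almost everywhere; truncating it makes it
  bounded everywhere.
\<close>
lemma nu_density:
  assumes C_pos: "0 < measure \<pi> C"
  obtains f where "f \<in> bounded_measurable M" "\<And>x. 0 \<le> f x"
    "\<And>g. g \<in> bounded_measurable M \<Longrightarrow> (\<integral>x. g x \<partial>\<nu>) = inner_pi f g"
proof -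
  interpret pi: prob_space \<pi> by (rule prob_pi)
  interpret nu: prob_space \<nu> by (rule prob_nu)
  have ind: "indicator S \<in> bounded_measurable M" if "S \<in> sets M" for S
    using that by (intro bounded_measurableI[where b = 1]) (auto simp: indicator_def)
  define k where "k = 1 / (eps * measure \<pi> C)"
  have k: "0 < k" using C_pos eps_pos by (simp add: k_def)
  have dom: "measure \<nu> S \<le> k * measure \<pi> S" if S: "S \<in> sets M" for S
  proof -
    have "eps * measure \<nu> S * measure \<pi> C = (\<integral>x. eps * measure \<nu> S * indicator C x \<partial>\<pi>)"
      using C_sets sets_pi by simp
    also have "\<dots> \<le> (\<integral>x. Pt m (indicator S) x \<partial>\<pi>)"
    proof (rule integral_mono)
      fix x assume "x \<in> space \<pi>"
      then have x: "x \<in> space M" by (simp add: space_pi)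
      have Pt: "Pt m (indicator S) x = measure (kernel_power M P m x) S"
        using S pow.sets_kernel_eq[OF x, of m] by (simp add: kernel_op_def)
      show "eps * measure \<nu> S * indicator C x \<le> Pt m (indicator S) x"
        unfolding Pt using minorization[OF _ S, of x] by (auto simp: indicator_def)
    qed (intro integrable_pi bounded_measurable_intros ind C_sets pow.kernel_op_bounded_measurable S)+
    also have "\<dots> = measure \<pi> S"
      using S sets_pi by (simp add: integral_power ind)
    finally show ?thesis using C_pos eps_pos by (simp add: k_def field_simps)
  qed
  have ac: "absolutely_continuous \<pi> \<nu>"
  proof -
    have "S \<in> null_sets \<nu>" if "S \<in> null_sets \<pi>" for S
      using that dom[of S] measure_nonneg[of \<nu> S]
      by (auto simp: null_sets_def sets_pi sets_nu nu.emeasure_eq_measure pi.emeasure_eq_measure)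
    then show ?thesis by (auto simp: absolutely_continuous_def)
  qed
  define h where "h x = enn2real (RN_deriv \<pi> \<nu> x)" for x
  have sets_eq: "sets \<nu> = sets \<pi>" by (simp add: sets_pi sets_nu)
  have h_meas: "h \<in> borel_measurable M"
    using borel_measurable_RN_deriv[of \<pi> \<nu>] unfolding h_def[abs_def] by (simp flip: borel_measurable_pi)
  have h_int: "integrable \<pi> (\<lambda>x. h x * g x)" "(\<integral>x. g x \<partial>\<nu>) = (\<integral>x. h x * g x \<partial>\<pi>)"
    if g: "g \<in> bounded_measurable M" for g
    using pi.RN_deriv_integrable[OF nu.sigma_finite_measure_axioms ac sets_eq, of g]
      pi.RN_deriv_integral[OF nu.sigma_finite_measure_axioms ac sets_eq, of g]
      integrable_nu[OF g] g by (auto simp: h_def bounded_measurable_measurable)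
  have ae: "AE x in \<pi>. h x \<le> k"
  proof -
    define S where "S = {x \<in> space M. k < h x}"
    have S: "S \<in> sets M" unfolding S_def using h_meas by measurable
    have i1: "integrable \<pi> (\<lambda>x. h x * indicator S x)" and i2: "integrable \<pi> (\<lambda>x. k * indicator S x)"
      by (rule h_int(1)[OF ind[OF S]], intro integrable_pi bounded_measurable_scale ind S)
    have "(\<integral>x. h x * indicator S x - k * indicator S x \<partial>\<pi>) = measure \<nu> S - k * measure \<pi> S"
      using h_int(2)[OF ind[OF S]] i1 i2 S sets_pi sets_nu by simp
    also have "\<dots> \<le> 0" using dom[OF S] by simp
    finally have "(\<integral>x. h x * indicator S x - k * indicator S x \<partial>\<pi>) \<le> 0" .
    moreover have "AE x in \<pi>. 0 \<le> h x * indicator S x - k * indicator S x"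
      by (intro AE_I2) (auto simp: S_def indicator_def)
    moreover have "integrable \<pi> (\<lambda>x. h x * indicator S x - k * indicator S x)"
      using i1 i2 by (rule Bochner_Integration.integrable_diff)
    ultimately have "AE x in \<pi>. h x * indicator S x - k * indicator S x = 0"
      by (subst integral_nonneg_eq_0_iff_AE[symmetric]) (auto intro!: antisym integral_nonneg_AE)
    then show ?thesis
      by (rule AE_mp) (intro AE_I2, auto simp: S_def indicator_def space_pi split: if_splits)
  qed
  show ?thesis
  proof
    show "(\<lambda>x. min (h x) k) \<in> bounded_measurable M"
    proof (rule bounded_measurableI)
      show "(\<lambda>x. min (h x) k) \<in> borel_measurable M" using h_meas by measurable
      show "\<bar>min (h x) k\<bar> \<le> k" for x using k by (simp add: h_def abs_le_iff min_def)
    qed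
    show "0 \<le> min (h x) k" for x using k by (simp add: h_def)
    show "(\<integral>x. g x \<partial>\<nu>) = inner_pi (\<lambda>x. min (h x) k) g" if g: "g \<in> bounded_measurable M" for g
      unfolding h_int(2)[OF g] inner_pi_def
    proof (rule integral_cong_AE)
      show "AE x in \<pi>. h x * g x = min (h x) k * g x"
        using ae by eventually_elim (simp add: min_def)
    qed (use h_meas g in \<open>auto simp: bounded_measurable_measurable\<close>)
  qed
qed

text \<open>
  The sequence \<open>g n = \<langle>f, P\<^sup>n f\<rangle>\<close> satisfies the renewal equation, because it is also \<open>\<nu>(P\<^sup>n f)\<close>. Its limit \<open>l\<close>
  is at most \<open>1\<close>: from every point \<open>P\<^sup>t f \<ge> l Pr(T \<le> t)\<close>, and \<open>P\<^sup>t f\<close> has \<open>\<pi>\<close>-integral \<open>1\<close>.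
\<close>
lemma inner_pi_power_le:
  assumes f: "f \<in> bounded_measurable M" "\<And>x. 0 \<le> f x"
    and nu_f: "\<And>g. g \<in> bounded_measurable M \<Longrightarrow> (\<integral>x. g x \<partial>\<nu>) = inner_pi f g"
    and surv: "\<And>x. x \<in> space M \<Longrightarrow> (\<lambda>t. survival t x) \<longlonglongrightarrow> 0"
    and W: "\<And>n. (\<integral>x. survival n x \<partial>\<nu>) \<le> W * \<rho> ^ n" and \<rho>: "0 < \<rho>" "\<rho> < 1"
  shows "inner_pi f (Pt n f) - 1 \<le> \<rho> ^ (n + 1) / (1 - \<rho>)"
proof -
  define g where "g n = inner_pi f (Pt n f)" for n
  note Ptf = pow.kernel_op_bounded_measurable[OF f(1)]
  have g_nu: "(\<integral>x. Pt n f x \<partial>\<nu>) = g n" for n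
    unfolding g_def by (rule nu_f[OF Ptf])
  have dec: "decseq g" unfolding g_def by (rule inner_pi_power_decseq[OF nonneg f(1)])
  have g_nonneg: "0 \<le> g n" for n
  proof -
    have "0 \<le> Pt n f x" if "x \<in> space M" for x
      using that f pow.kernel_op_mono[OF bounded_measurable_const f(1) that, of 0 n]
      by (simp add: pow.kernel_op_const)
    then show ?thesis unfolding g_def inner_pi_def using f(2)
      by (intro integral_nonneg_AE AE_I2) (auto simp: space_pi)
  qed
  obtain l where l: "g \<longlonglongrightarrow> l" using decseq_convergent[OF dec, of 0] g_nonneg by blast
  have int_f: "(\<integral>x. f x \<partial>\<pi>) = 1"
    using nu_f[OF bounded_measurable_const, of 1] by (simp add: inner_pi_def)
  have "l * (1 - (\<integral>x. survival t x \<partial>\<pi>)) \<le> 1" for t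
  proof -
    have "l * (1 - survival t x) \<le> Pt t f x" if x: "x \<in> space M" for x
    proof -
      have "l * (1 - survival t x) = (\<Sum>s\<le>t. regen s x * l)"
        by (simp add: survival_eq[OF x] sum_distrib_left mult.commute)
      also have "\<dots> \<le> (\<Sum>s\<le>t. regen s x * g (t - s))"
        using decseq_ge[OF dec l] regen_nonneg[OF x] by (intro sum_mono mult_left_mono) auto
      also have "\<dots> \<le> Pt t f x"
        using renewal[OF f(1) x, of t] taboo_nonneg[OF f(1) _ x, of t] f(2) by (simp add: g_nu)
      finally show ?thesis .
    qed
    then have "(\<integral>x. l * (1 - survival t x) \<partial>\<pi>) \<le> (\<integral>x. Pt t f x \<partial>\<pi>)"
      by (intro integral_mono integrable_pi bounded_measurable_intros survival_bounded_measurable Ptf)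
         (auto simp: space_pi)
    then show ?thesis
      using integral_power[OF f(1), of t] int_f integrable_pi[OF survival_bounded_measurable, of t]
        integrable_pi[OF bounded_measurable_const, of 1] prob_space.prob_space[OF prob_pi]
      by simp
  qed
  moreover have "(\<lambda>t. l * (1 - (\<integral>x. survival t x \<partial>\<pi>))) \<longlonglongrightarrow> l * (1 - 0)"
    by (intro tendsto_intros integral_survival_tendsto_0 surv)
  ultimately have l1: "l \<le> 1"
    using LIMSEQ_le_const2[of "\<lambda>t. l * (1 - (\<integral>x. survival t x \<partial>\<pi>))" "l * (1 - 0)" 1] by simp
  have "g n - 1 \<le> \<rho> ^ (n + 1) / (1 - \<rho>)"
  proof (rule renewal_sequence_convergence[OF _ _ _ _ _ W \<rho> dec g_nonneg l l1])
    show "g n = (\<integral>x. taboo n f x \<partial>\<nu>) + (\<Sum>s\<le>n. (\<integral>x. regen s x \<partial>\<nu>) * g (n - s))" for n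
    proof -
      have "g n = (\<integral>x. taboo n f x + (\<Sum>s\<le>n. regen s x * g (n - s)) \<partial>\<nu>)"
        unfolding g_nu[of n, symmetric]
        by (rule Bochner_Integration.integral_cong) (auto simp: space_nu renewal[OF f(1)] g_nu)
      also have "\<dots> = (\<integral>x. taboo n f x \<partial>\<nu>) + (\<integral>x. (\<Sum>s\<le>n. regen s x * g (n - s)) \<partial>\<nu>)"
        by (intro Bochner_Integration.integral_add integrable_nu bounded_measurable_intros
            taboo_bounded_measurable regen_bounded_measurable f)
      also have "(\<integral>x. (\<Sum>s\<le>n. regen s x * g (n - s)) \<partial>\<nu>) = (\<Sum>s\<le>n. \<integral>x. regen s x * g (n - s) \<partial>\<nu>)"
        by (intro Bochner_Integration.integral_sum integrable_nu bounded_measurable_intros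
            regen_bounded_measurable)
      finally show ?thesis by simp
    qed
    show "(\<integral>x. survival n x \<partial>\<nu>) = 1 - (\<Sum>s\<le>n. \<integral>x. regen s x \<partial>\<nu>)" for n
    proof -
      have "(\<integral>x. survival n x \<partial>\<nu>) = (\<integral>x. 1 - (\<Sum>s\<le>n. regen s x) \<partial>\<nu>)"
        by (intro Bochner_Integration.integral_cong) (auto simp: space_nu survival_eq)
      also have "\<dots> = (\<integral>x. 1 \<partial>\<nu>) - (\<integral>x. (\<Sum>s\<le>n. regen s x) \<partial>\<nu>)"
        by (intro Bochner_Integration.integral_diff integrable_nu bounded_measurable_intros regen_bounded_measurable)
      also have "(\<integral>x. (\<Sum>s\<le>n. regen s x) \<partial>\<nu>) = (\<Sum>s\<le>n. \<integral>x. regen s x \<partial>\<nu>)"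
        by (intro Bochner_Integration.integral_sum integrable_nu regen_bounded_measurable)
      finally show ?thesis by simp
    qed
    show "(\<integral>x. regen 0 x \<partial>\<nu>) = 0" by (simp add: regen_0)
    show "0 \<le> (\<integral>x. taboo n f x \<partial>\<nu>)" for n
      using taboo_nonneg[OF f(1)] f(2) by (intro integral_nonneg_AE AE_I2) (auto simp: space_nu)
    show "0 \<le> (\<integral>x. survival n x \<partial>\<nu>)" for n
      using survival_bounds by (intro integral_nonneg_AE AE_I2) (auto simp: space_nu)
  qed
  then show ?thesis by (simp add: g_def)
qed

text \<open>
  As \<open>P\<^sup>n f - 1\<close> is orthogonal to constants, \<open>u\<close> may be replaced by \<open>u - 1/2\<close>, whose modulus is at most \<open>1/2\<close>;
  then the square of the error is at most a quarter of \<open>\<parallel>P\<^sup>n f - 1\<parallel>\<^sup>2 = \<langle>f, P\<^sup>2\<^sup>n f\<rangle> - 1\<close>.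
\<close>
lemma nu_power_convergence:
  assumes surv: "\<And>x. x \<in> space M \<Longrightarrow> (\<lambda>t. survival t x) \<longlonglongrightarrow> 0"
    and W: "\<And>n. (\<integral>x. survival n x \<partial>\<nu>) \<le> W * \<rho> ^ n" and \<rho>: "0 < \<rho>" "\<rho> < 1"
    and u: "u \<in> bounded_measurable M" "\<And>x. x \<in> space M \<Longrightarrow> 0 \<le> u x" "\<And>x. x \<in> space M \<Longrightarrow> u x \<le> 1"
  shows "\<bar>(\<integral>x. Pt n u x \<partial>\<nu>) - (\<integral>x. u x \<partial>\<pi>)\<bar> \<le> 1 / 2 * sqrt (\<rho> / (1 - \<rho>)) * \<rho> ^ n"
proof -
  interpret pi: prob_space \<pi> by (rule prob_pi)
  obtain f where f: "f \<in> bounded_measurable M" "\<And>x. 0 \<le> f x"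
    and nu_f: "\<And>g. g \<in> bounded_measurable M \<Longrightarrow> (\<integral>x. g x \<partial>\<nu>) = inner_pi f g"
    using nu_density[OF measure_C_pos[OF surv]] by blast
  note Ptf = pow.kernel_op_bounded_measurable[OF f(1)]
  define w where "w = (\<lambda>x. Pt n f x - 1)"
  define z where "z = (\<lambda>x. u x - 1 / 2)"
  have w: "w \<in> bounded_measurable M" and z: "z \<in> bounded_measurable M"
    unfolding w_def z_def by (intro bounded_measurable_intros Ptf u(1))+
  have one: "(\<lambda>_. 1) \<in> bounded_measurable M" by (rule bounded_measurable_const)
  have int_f: "(\<integral>x. f x \<partial>\<pi>) = 1"
    using nu_f[OF one] by (simp add: inner_pi_def)
  have int_Ptf: "(\<integral>x. Pt n f x \<partial>\<pi>) = 1"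
    using integral_power[OF f(1)] int_f by simp
  have half: "(\<lambda>_. 1 / 2) \<in> bounded_measurable M" by (rule bounded_measurable_const)
  have inner_pi_half: "inner_pi v (\<lambda>_. c) = c * (\<integral>x. v x \<partial>\<pi>)" for v c
    by (simp add: inner_pi_def mult.commute)
  have "(\<integral>x. Pt n u x \<partial>\<nu>) = inner_pi (Pt n f) u"
    using u(1) f(1) by (simp add: nu_f inner_pi_power pow.kernel_op_bounded_measurable)
  then have diff: "(\<integral>x. Pt n u x \<partial>\<nu>) - (\<integral>x. u x \<partial>\<pi>) = inner_pi w z"
    unfolding w_def z_def using Ptf u(1) one half
    by (simp add: inner_pi_diff_left inner_pi_diff_right bounded_measurable_diff inner_pi_half int_Ptf inner_pi_const_left integrable_pi pi.prob_space)
  have "(inner_pi w z)\<^sup>2 \<le> (\<integral>x. (w x * z x)\<^sup>2 \<partial>\<pi>)"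
    using pi.variance_positive[of "\<lambda>x. w x * z x"]
    by (subst (asm) pi.variance_eq)
       (auto simp: inner_pi_def intro!: integrable_pi bounded_measurable_intros w z)
  also have "\<dots> \<le> (\<integral>x. 1 / 4 * (w x)\<^sup>2 \<partial>\<pi>)"
  proof (rule integral_mono)
    fix x assume "x \<in> space \<pi>"
    then have "0 \<le> u x" "u x \<le> 1" using u(2,3) by (auto simp: space_pi)
    then have "\<bar>z x\<bar> \<le> 1 / 2" unfolding z_def by arith
    then have "(z x)\<^sup>2 \<le> 1 / 4"
      using abs_le_square_iff[of "z x" "1 / 2"] by (simp add: power2_eq_square)
    then have "(w x)\<^sup>2 * (z x)\<^sup>2 \<le> (w x)\<^sup>2 * (1 / 4)" by (intro mult_left_mono) auto
    then show "(w x * z x)\<^sup>2 \<le> 1 / 4 * (w x)\<^sup>2" by (simp add: power_mult_distrib mult.commute)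
  qed (intro integrable_pi bounded_measurable_intros w z)+
  also have "\<dots> = 1 / 4 * inner_pi w w" by (simp add: inner_pi_def power2_eq_square)
  also have "inner_pi w w = inner_pi (Pt n f) (Pt n f) - 1"
    unfolding w_def using Ptf one
    by (simp add: inner_pi_diff_left inner_pi_diff_right bounded_measurable_diff inner_pi_half inner_pi_const_left int_Ptf integrable_pi pi.prob_space)
  also have "inner_pi (Pt n f) (Pt n f) = inner_pi f (Pt n (Pt n f))"
    using f(1) by (simp add: inner_pi_power pow.kernel_op_bounded_measurable)
  also have "inner_pi f (Pt n (Pt n f)) = inner_pi f (Pt (2 * n) f)"
    unfolding mult_2 by (rule inner_pi_cong) (auto intro: kernel_power_op_add[OF f(1), symmetric])
  also have "1 / 4 * (inner_pi f (Pt (2 * n) f) - 1) \<le> 1 / 4 * (\<rho> ^ (2 * n + 1) / (1 - \<rho>))"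
    using inner_pi_power_le[OF f nu_f surv W \<rho>] by (intro mult_left_mono) auto
  also have "\<dots> = (1 / 2 * sqrt (\<rho> / (1 - \<rho>)) * \<rho> ^ n)\<^sup>2"
    using \<rho> by (simp add: power_mult_distrib power_divide power_mult[symmetric] mult.commute)
  finally have "\<bar>inner_pi w z\<bar> \<le> \<bar>1 / 2 * sqrt (\<rho> / (1 - \<rho>)) * \<rho> ^ n\<bar>"
    by (simp only: abs_le_square_iff)
  also have "\<dots> = 1 / 2 * sqrt (\<rho> / (1 - \<rho>)) * \<rho> ^ n" using \<rho> by simp
  finally show ?thesis by (simp add: diff)
qed

text \<open>
  By the renewal identity the error is at most \<open>Pr(T > t)\<close> plus the expectation of \<open>D \<rho>\<^sup>t\<^sup>-\<^sup>T\<close> on \<open>T \<le> t\<close>. Summation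
  by parts produces a term \<open>-D Pr(T > t)\<close>, whence the factor \<open>(1 - D)\<^sub>+\<close>.
\<close>
lemma power_convergence:
  assumes W_x: "\<And>n. survival n x \<le> W * \<rho> ^ n" and \<rho>: "0 < \<rho>" "\<rho> \<le> 1" and D: "0 \<le> D"
    and nu: "\<And>n. \<bar>(\<integral>y. Pt n u y \<partial>\<nu>) - (\<integral>y. u y \<partial>\<pi>)\<bar> \<le> D * \<rho> ^ n"
    and u: "u \<in> bounded_measurable M" "\<And>y. y \<in> space M \<Longrightarrow> 0 \<le> u y" "\<And>y. y \<in> space M \<Longrightarrow> u y \<le> 1"
    and x: "x \<in> space M"
  shows "\<bar>Pt t u x - (\<integral>y. u y \<partial>\<pi>)\<bar> \<le> (max (1 - D) 0 * W + D + (1 - \<rho>) / \<rho> * D * W * real t) * \<rho> ^ t"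
proof -
  interpret pi: prob_space \<pi> by (rule prob_pi)
  define c where "c = (\<integral>y. u y \<partial>\<pi>)"
  have "0 \<le> c" unfolding c_def using u(2) by (intro integral_nonneg_AE AE_I2) (simp add: space_pi)
  moreover have "c \<le> (\<integral>y. 1 \<partial>\<pi>)"
    unfolding c_def using u(3)
    by (intro integral_mono integrable_pi[OF u(1)] integrable_pi[OF bounded_measurable_const]) (simp add: space_pi)
  ultimately have c: "0 \<le> c" "c \<le> 1" by (auto simp: pi.prob_space)
  define S where "S = (\<Sum>s\<le>t. regen s x * ((\<integral>y. Pt (t - s) u y \<partial>\<nu>) - c))"
  have surv: "survival t x = 1 - (\<Sum>s\<le>t. regen s x)" by (rule survival_eq[OF x])
  have "Pt t u x - c = taboo t u x - survival t x * c + S"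
    unfolding S_def surv using renewal[OF u(1) x, of t]
    by (simp add: right_diff_distrib sum_subtractf sum_distrib_right left_diff_distrib)
  moreover have "\<bar>taboo t u x - survival t x * c\<bar> \<le> survival t x"
    using taboo_nonneg[OF u(1,2) x, of t] taboo_le_survival[OF u(1,3) x, of t] survival_bounds(1)[OF x, of t] c
      mult_left_le[of c "survival t x"] mult_nonneg_nonneg[OF survival_bounds(1)[OF x, of t] c(1)]
    unfolding abs_le_iff by (intro conjI) linarith+
  moreover have "\<bar>S\<bar> \<le> D * (\<Sum>s\<le>t. regen s x * \<rho> ^ (t - s))"
  proof -
    have "\<bar>S\<bar> \<le> (\<Sum>s\<le>t. \<bar>regen s x * ((\<integral>y. Pt (t - s) u y \<partial>\<nu>) - c)\<bar>)"
      unfolding S_def by (rule sum_abs)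
    also have "\<dots> \<le> (\<Sum>s\<le>t. regen s x * (D * \<rho> ^ (t - s)))"
      using nu regen_nonneg[OF x] by (intro sum_mono) (auto simp: abs_mult c_def intro!: mult_left_mono)
    finally show ?thesis by (simp add: sum_distrib_left mult_ac)
  qed
  moreover have "D * (\<Sum>s\<le>t. regen s x * \<rho> ^ (t - s)) \<le>
      D * (\<rho> ^ t - survival t x + (1 - \<rho>) / \<rho> * W * real t * \<rho> ^ t)"
    using D \<rho> by (intro mult_left_mono renewal_forcing_bound survival_eq x regen_0 W_x) auto
  ultimately have "\<bar>Pt t u x - c\<bar> \<le>
      survival t x + D * (\<rho> ^ t - survival t x + (1 - \<rho>) / \<rho> * W * real t * \<rho> ^ t)"
    by linarith
  also have "\<dots> = (1 - D) * survival t x + D * \<rho> ^ t + (1 - \<rho>) / \<rho> * D * W * real t * \<rho> ^ t"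
    by (simp add: algebra_simps)
  also have "(1 - D) * survival t x \<le> max (1 - D) 0 * survival t x"
    using survival_bounds(1)[OF x] by (intro mult_right_mono) auto
  also have "\<dots> \<le> max (1 - D) 0 * (W * \<rho> ^ t)"
    using W_x by (intro mult_left_mono) auto
  finally show ?thesis by (simp add: c_def algebra_simps)
qed

end

section \<open>Drift and convergence in the weighted norm\<close>

context markov_kernel
begin

interpretation pow: markov_kernel M "kernel_power M P t" for t
  by (rule markov_kernel_power)

lemma nn_integral_bind_kernel:
  assumes "sets N = sets M" "u \<in> borel_measurable M"
  shows "(\<integral>\<^sup>+y. u y \<partial>(N \<bind> P)) = (\<integral>\<^sup>+x. \<integral>\<^sup>+y. u y \<partial>P x \<partial>N)"
  using assms kernel_subprob by (intro nn_integral_bind) (auto cong: measurable_cong_sets)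

text \<open>
  The start is left general: time \<open>0\<close> and the bound \<open>V x\<close>, or time \<open>1\<close> and the bound \<open>K\<close> for \<open>x \<in> C\<close>.
\<close>
lemma nn_integral_power_drift:
  assumes V: "V \<in> borel_measurable M" "\<And>y. y \<in> space M \<Longrightarrow> 0 \<le> V y"
    and lam: "0 < lam" "lam < 1" and b: "0 \<le> b"
    and drift: "\<And>y. y \<in> space M \<Longrightarrow> (\<integral>\<^sup>+z. ennreal (V z) \<partial>P y) \<le> ennreal (lam * V y + b)"
    and x: "x \<in> space M"
    and start: "(\<integral>\<^sup>+y. ennreal (V y) \<partial>kernel_power M P s x) \<le> ennreal q" and q: "0 \<le> q"
  shows "(\<integral>\<^sup>+y. ennreal (V y) \<partial>kernel_power M P (s + t) x) \<le> ennreal (lam ^ t * q + b * (1 - lam ^ t) / (1 - lam))"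
proof (induction t)
  case 0
  then show ?case using start by simp
next
  case (Suc t)
  let ?N = "kernel_power M P (s + t) x"
  interpret N: prob_space ?N by (rule pow.prob_space_kernel[OF x])
  note sets_N = pow.sets_kernel_eq[OF x, of "s + t"]
  note space_N = sets_eq_imp_space_eq[OF sets_N]
  have VN: "V \<in> borel_measurable ?N" using V(1) sets_N by (simp cong: measurable_cong_sets)
  have "(\<integral>\<^sup>+y. ennreal (V y) \<partial>kernel_power M P (s + Suc t) x) = (\<integral>\<^sup>+y. \<integral>\<^sup>+z. ennreal (V z) \<partial>P y \<partial>?N)"
    using V(1) by (simp add: nn_integral_bind_kernel[OF sets_N])
  also have "\<dots> \<le> (\<integral>\<^sup>+y. ennreal lam * ennreal (V y) + ennreal b \<partial>?N)"
    using drift V(2) lam b space_N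
    by (intro nn_integral_mono) (auto simp: ennreal_mult[symmetric] ennreal_plus[symmetric] simp del: ennreal_plus)
  also have "\<dots> = ennreal lam * (\<integral>\<^sup>+y. ennreal (V y) \<partial>?N) + ennreal b"
    using VN by (simp add: nn_integral_add nn_integral_cmult N.emeasure_space_1)
  also have "\<dots> \<le> ennreal lam * ennreal (lam ^ t * q + b * (1 - lam ^ t) / (1 - lam)) + ennreal b"
    using Suc by (intro add_mono mult_left_mono) auto
  also have "\<dots> = ennreal (lam * (lam ^ t * q + b * (1 - lam ^ t) / (1 - lam)) + b)"
    using lam b q by (simp add: ennreal_mult[symmetric] ennreal_plus[symmetric] power_le_one del: ennreal_plus)
  also have "lam * (lam ^ t * q + b * (1 - lam ^ t) / (1 - lam)) + b = lam ^ Suc t * q + b * (1 - lam ^ Suc t) / (1 - lam)"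
    using lam by (simp add: field_simps)
  finally show ?case .
qed

lemma integral_bind_kernel_nonneg:
  assumes N: "sets N = sets M" and u: "u \<in> borel_measurable M" "\<And>y. y \<in> space M \<Longrightarrow> 0 \<le> u y"
    and int: "integrable (N \<bind> P) u" and int_P: "\<And>y. y \<in> space M \<Longrightarrow> integrable (P y) u"
    and ne: "space M \<noteq> {}"
  shows "integrable N (kernel_op P u)" "(\<integral>y. u y \<partial>(N \<bind> P)) = (\<integral>y. kernel_op P u y \<partial>N)"
proof -
  have space_N: "space N = space M" by (rule sets_eq_imp_space_eq[OF N])
  have P_N: "P \<in> N \<rightarrow>\<^sub>M subprob_algebra M"
    using kernel_subprob N by (simp cong: measurable_cong_sets)
  have space_bind: "space (N \<bind> P) = space M"
    using P_N ne space_N by (simp add: space_bind_measurable)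
  have meas: "kernel_op P u \<in> borel_measurable N"
    using kernel_op_measurable[OF u(1)] N by (simp cong: measurable_cong_sets)
  have nonneg: "0 \<le> kernel_op P u y" if "y \<in> space M" for y
    unfolding kernel_op_def using u(2) sets_eq_imp_space_eq[OF sets_kernel_eq[OF that]]
    by (intro integral_nonneg_AE AE_I2) auto
  have "(\<integral>\<^sup>+y. ennreal (u y) \<partial>(N \<bind> P)) = (\<integral>\<^sup>+x. \<integral>\<^sup>+y. ennreal (u y) \<partial>P x \<partial>N)"
    using u(1) by (simp add: nn_integral_bind_kernel[OF N])
  also have "\<dots> = (\<integral>\<^sup>+x. ennreal (kernel_op P u x) \<partial>N)"
    unfolding kernel_op_def
    using u(2) int_P sets_eq_imp_space_eq[OF sets_kernel_eq] space_N
    by (intro nn_integral_cong nn_integral_eq_integral) auto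
  finally have eq: "(\<integral>\<^sup>+x. ennreal (kernel_op P u x) \<partial>N) = (\<integral>\<^sup>+y. ennreal (u y) \<partial>(N \<bind> P))" ..
  also have "\<dots> = ennreal (\<integral>y. u y \<partial>(N \<bind> P))"
    using int u(2) space_bind by (intro nn_integral_eq_integral) auto
  finally have eq': "(\<integral>\<^sup>+x. ennreal (kernel_op P u x) \<partial>N) = ennreal (\<integral>y. u y \<partial>(N \<bind> P))" .
  show "integrable N (kernel_op P u)"
    using meas nonneg space_N eq' by (intro integrableI_nonneg) auto
  have "0 \<le> (\<integral>y. u y \<partial>(N \<bind> P))" using u(2) space_bind by (intro integral_nonneg_AE AE_I2) auto
  with eq' show "(\<integral>y. u y \<partial>(N \<bind> P)) = (\<integral>y. kernel_op P u y \<partial>N)"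
    using meas nonneg space_N by (subst integral_eq_nn_integral) auto
qed

text \<open>
  The Chapman-Kolmogorov equation for unbounded \<open>f\<close>, from the nonnegative functions \<open>f + V\<close> and \<open>V\<close>.
\<close>
lemma integral_bind_kernel_dominated:
  assumes N: "sets N = sets M" and V: "V \<in> borel_measurable M"
    and f: "f \<in> borel_measurable M" "\<And>y. y \<in> space M \<Longrightarrow> \<bar>f y\<bar> \<le> V y"
    and int: "integrable (N \<bind> P) V" and int_P: "\<And>y. y \<in> space M \<Longrightarrow> integrable (P y) V"
    and ne: "space M \<noteq> {}"
  shows "(\<integral>y. f y \<partial>(N \<bind> P)) = (\<integral>y. kernel_op P f y \<partial>N)"
proof -
  have space_N: "space N = space M" by (rule sets_eq_imp_space_eq[OF N])
  have P_N: "P \<in> N \<rightarrow>\<^sub>M subprob_algebra M"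
    using kernel_subprob N by (simp cong: measurable_cong_sets)
  have sets_bind: "sets (N \<bind> P) = sets M"
    using P_N ne space_N by (simp add: sets_bind_measurable)
  note space_bind = sets_eq_imp_space_eq[OF sets_bind]
  have V_nonneg: "0 \<le> V y" if "y \<in> space M" for y using f(2)[OF that] by simp
  have int_f: "integrable (N \<bind> P) f"
    using f V_nonneg sets_bind space_bind
    by (intro Bochner_Integration.integrable_bound[OF int]) (auto intro!: AE_I2 cong: measurable_cong_sets)
  have int_Pf: "integrable (P y) f" if y: "y \<in> space M" for y
    using f V_nonneg sets_kernel_eq[OF y] sets_eq_imp_space_eq[OF sets_kernel_eq[OF y]]
    by (intro Bochner_Integration.integrable_bound[OF int_P[OF y]]) (auto intro!: AE_I2 cong: measurable_cong_sets)
  have sum_nonneg: "0 \<le> f y + V y" if "y \<in> space M" for y using f(2)[OF that] by simp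
  note V_id = integral_bind_kernel_nonneg[OF N V V_nonneg int int_P ne]
  have fV_id: "integrable N (kernel_op P (\<lambda>y. f y + V y))"
    "(\<integral>y. f y + V y \<partial>(N \<bind> P)) = (\<integral>y. kernel_op P (\<lambda>y. f y + V y) y \<partial>N)"
    using f(1) V sum_nonneg int int_f int_P int_Pf ne
    by (intro integral_bind_kernel_nonneg[OF N]; simp)+
  have "(\<integral>y. f y \<partial>(N \<bind> P)) = (\<integral>y. f y + V y \<partial>(N \<bind> P)) - (\<integral>y. V y \<partial>(N \<bind> P))"
    using int int_f by simp
  also have "\<dots> = (\<integral>y. kernel_op P (\<lambda>y. f y + V y) y - kernel_op P V y \<partial>N)"
    using V_id fV_id by simp
  also have "\<dots> = (\<integral>y. kernel_op P f y \<partial>N)"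
    using int_P int_Pf space_N by (intro Bochner_Integration.integral_cong) (auto simp: kernel_op_def)
  finally show ?thesis .
qed

end

context reversible_kernel
begin

interpretation pow: markov_kernel M "kernel_power M P t" for t
  by (rule markov_kernel_power)

lemma nonempty: "space M \<noteq> {}"
  using prob_space.not_empty[OF prob_pi] by (simp add: space_pi)

lemma pi_bind: "\<pi> \<bind> P = \<pi>"
proof (rule measure_eqI)
  have P_pi: "P \<in> \<pi> \<rightarrow>\<^sub>M subprob_algebra M"
    using kernel_subprob sets_pi by (simp cong: measurable_cong_sets)
  show sets_eq: "sets (\<pi> \<bind> P) = sets \<pi>"
    using P_pi nonempty by (simp add: sets_bind_measurable space_pi sets_pi)
  fix S assume "S \<in> sets (\<pi> \<bind> P)"
  then have S: "S \<in> sets M" by (simp add: sets_eq sets_pi)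
  have ind: "indicator S \<in> bounded_measurable M"
    using S by (intro bounded_measurableI[where b = 1]) (auto simp: indicator_def)
  have "(\<integral>x. indicator S x \<partial>(\<pi> \<bind> P)) = (\<integral>x. indicator S x \<partial>\<pi> :: real)"
    using integral_bind_kernel[OF prob_pi sets_pi ind] integral_kernel_op[OF ind] by (rule trans)
  then have "measure (\<pi> \<bind> P) S = measure \<pi> S"
    using S sets_eq sets_pi by simp
  moreover have "prob_space (\<pi> \<bind> P)"
    using prob_pi sets_pi kernel by (intro prob_space_bind'[of \<pi> M]) (auto simp: space_prob_algebra)
  ultimately show "emeasure (\<pi> \<bind> P) S = emeasure \<pi> S"
    using prob_pi by (simp add: finite_measure.emeasure_eq_measure prob_space_def)
qed

text \<open>
  Integrability of \<open>V\<close> cannot be used before it is proved, so stationarity is applied to the truncations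
  \<open>min V N\<close>: \<open>\<pi>(min V N) = \<pi>(P\<^sup>t (min V N)) \<le> \<pi>(min (\<lambda>\<^sup>t V + b/(1 - \<lambda>)) N)\<close>, and \<open>t \<rightarrow> \<infinity>\<close> by dominated convergence.
\<close>
lemma stationary_drift_bound:
  assumes V: "V \<in> borel_measurable M" "\<And>y. y \<in> space M \<Longrightarrow> 0 \<le> V y"
    and lam: "0 < lam" "lam < 1" and b: "0 \<le> b"
    and drift: "\<And>y. y \<in> space M \<Longrightarrow> (\<integral>\<^sup>+z. ennreal (V z) \<partial>P y) \<le> ennreal (lam * V y + b)"
  shows "integrable \<pi> V" "(\<integral>y. V y \<partial>\<pi>) \<le> b / (1 - lam)"
proof -
  interpret pi: prob_space \<pi> by (rule prob_pi)
  define c where "c = b / (1 - lam)"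
  have c: "0 \<le> c" using b lam by (simp add: c_def)
  have trunc: "(\<integral>y. min (V y) (real N) \<partial>\<pi>) \<le> c" for N
  proof -
    have VN: "(\<lambda>y. min (V y) (real N)) \<in> bounded_measurable M"
      using V by (intro bounded_measurableI[where b = "real N"]) auto
    have bound: "Pt t (\<lambda>y. min (V y) (real N)) x \<le> min (lam ^ t * V x + c) (real N)" if x: "x \<in> space M" for x t
    proof -
      let ?N = "kernel_power M P t x"
      note space_N = sets_eq_imp_space_eq[OF pow.sets_kernel_eq[OF x, of t]]
      have "(\<integral>\<^sup>+y. ennreal (V y) \<partial>kernel_power M P 0 x) \<le> ennreal (V x)"
        using x V(1) by (simp add: nn_integral_return)
      from nn_integral_power_drift[OF V lam b drift x this V(2)[OF x], of t]
      have "(\<integral>\<^sup>+y. ennreal (V y) \<partial>?N) \<le> ennreal (lam ^ t * V x + b * (1 - lam ^ t) / (1 - lam))" by simp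
      also have "\<dots> \<le> ennreal (lam ^ t * V x + c)"
        unfolding c_def using lam b by (intro ennreal_leI add_left_mono divide_right_mono mult_left_le) auto
      finally have "(\<integral>\<^sup>+y. ennreal (V y) \<partial>?N) \<le> ennreal (lam ^ t * V x + c)" .
      moreover have "(\<integral>\<^sup>+y. ennreal (min (V y) (real N)) \<partial>?N) \<le> (\<integral>\<^sup>+y. ennreal (V y) \<partial>?N)"
        by (intro nn_integral_mono ennreal_leI) simp
      ultimately have "Pt t (\<lambda>y. min (V y) (real N)) x \<le> lam ^ t * V x + c"
        unfolding kernel_op_def using lam c V(2)[OF x] by (intro integral_real_bounded) auto
      moreover have "Pt t (\<lambda>y. min (V y) (real N)) x \<le> Pt t (\<lambda>_. real N) x"
        by (intro pow.kernel_op_mono VN bounded_measurable_const x) simp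
      ultimately show ?thesis by (simp add: pow.kernel_op_const x)
    qed
    have "(\<lambda>t. \<integral>x. min (lam ^ t * V x + c) (real N) \<partial>\<pi>) \<longlonglongrightarrow> (\<integral>x. min (0 * V x + c) (real N) \<partial>\<pi>)"
    proof (rule integral_dominated_convergence[where w = "\<lambda>_. real N"])
      show "AE x in \<pi>. (\<lambda>t. min (lam ^ t * V x + c) (real N)) \<longlonglongrightarrow> min (0 * V x + c) (real N)"
        using lam by (intro AE_I2 tendsto_intros) auto
      show "AE x in \<pi>. norm (min (lam ^ t * V x + c) (real N)) \<le> real N" for t
        using V(2) lam c by (intro AE_I2) (auto simp: space_pi min_def)
    qed (use V(1) in auto)
    moreover have "(\<integral>y. min (V y) (real N) \<partial>\<pi>) \<le> (\<integral>x. min (lam ^ t * V x + c) (real N) \<partial>\<pi>)" for t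
    proof -
      have "(\<integral>y. min (V y) (real N) \<partial>\<pi>) = (\<integral>y. Pt t (\<lambda>y. min (V y) (real N)) y \<partial>\<pi>)"
        using integral_power[OF VN] by simp
      also have "\<dots> \<le> (\<integral>x. min (lam ^ t * V x + c) (real N) \<partial>\<pi>)"
      proof (rule integral_mono)
        have "(\<lambda>x. min (lam ^ t * V x + c) (real N)) \<in> bounded_measurable M"
        proof (rule bounded_measurableI)
          show "(\<lambda>x. min (lam ^ t * V x + c) (real N)) \<in> borel_measurable M" using V(1) by measurable
          show "\<bar>min (lam ^ t * V x + c) (real N)\<bar> \<le> real N" if "x \<in> space M" for x
            using V(2)[OF that] lam c by (auto simp: min_def)
        qed
        then show "integrable \<pi> (\<lambda>x. min (lam ^ t * V x + c) (real N))" by (rule integrable_pi)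
      qed (use bound in \<open>auto simp: space_pi intro: integrable_pi pow.kernel_op_bounded_measurable VN\<close>)
      finally show ?thesis .
    qed
    ultimately have "(\<integral>y. min (V y) (real N) \<partial>\<pi>) \<le> (\<integral>x. min (0 * V x + c) (real N) \<partial>\<pi>)"
      by (intro LIMSEQ_le_const) auto
    then show ?thesis by (simp add: pi.prob_space)
  qed
  have "(\<integral>\<^sup>+y. ennreal (V y) \<partial>\<pi>) = (\<integral>\<^sup>+y. (SUP N. ennreal (min (V y) (real N))) \<partial>\<pi>)"
  proof (rule nn_integral_cong)
    fix y
    obtain N :: nat where "V y \<le> real N" using real_arch_simple by blast
    then show "ennreal (V y) = (SUP N. ennreal (min (V y) (real N)))"
      by (intro antisym SUP_upper2[of N] SUP_least ennreal_leI) auto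
  qed
  also have "\<dots> = (SUP N. \<integral>\<^sup>+y. ennreal (min (V y) (real N)) \<partial>\<pi>)"
    using V(1)
    by (intro nn_integral_monotone_convergence_SUP) (auto simp: incseq_def le_fun_def intro!: ennreal_leI)
  also have "\<dots> \<le> ennreal c"
  proof (rule SUP_least)
    fix N
    have "(\<integral>\<^sup>+y. ennreal (min (V y) (real N)) \<partial>\<pi>) = ennreal (\<integral>y. min (V y) (real N) \<partial>\<pi>)"
      using V by (intro nn_integral_eq_integral integrable_pi bounded_measurableI[where b = "real N"])
        (auto simp: space_pi)
    then show "(\<integral>\<^sup>+y. ennreal (min (V y) (real N)) \<partial>\<pi>) \<le> ennreal c"
      using trunc[of N] by (simp add: ennreal_leI)
  qed
  finally have le: "(\<integral>\<^sup>+y. ennreal (V y) \<partial>\<pi>) \<le> ennreal c" .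
  show "integrable \<pi> V"
    using V le by (intro integrableI_nonneg) (auto simp: space_pi intro: le_less_trans)
  show "(\<integral>y. V y \<partial>\<pi>) \<le> b / (1 - lam)"
    using le c unfolding c_def by (rule integral_real_bounded[rotated])
qed

end

context reversible_minorized_kernel
begin

interpretation pow: markov_kernel M "kernel_power M P t" for t
  by (rule markov_kernel_power)

text \<open>
  Write \<open>P f = g + \<lambda> h\<close> with \<open>g\<close> supported on \<open>C\<close> and bounded by \<open>K\<close>, and \<open>h\<close> supported off \<open>C\<close> and bounded by \<open>V\<close>.
  An affine map takes \<open>g\<close> to a function with values in the unit interval, which gives the factor \<open>2K\<close>; the induction
  hypothesis applies to \<open>h\<close>.
\<close>
lemma weighted_convergence:
  assumes V: "V \<in> borel_measurable M" "\<And>y. y \<in> space M \<Longrightarrow> 1 \<le> V y"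
    and lam: "0 < lam" and K: "0 < K"
    and off: "\<And>y. y \<in> space M \<Longrightarrow> y \<notin> C \<Longrightarrow> kernel_op P V y \<le> lam * V y"
    and on: "\<And>y. y \<in> C \<Longrightarrow> kernel_op P V y \<le> K"
    and int_P: "\<And>y. y \<in> space M \<Longrightarrow> integrable (P y) V"
    and int_x: "\<And>t. integrable (kernel_power M P t x) V" and int_pi: "integrable \<pi> V"
    and x: "x \<in> space M"
    and \<tau>: "\<And>u t. u \<in> bounded_measurable M \<Longrightarrow> (\<And>y. y \<in> space M \<Longrightarrow> 0 \<le> u y) \<Longrightarrow>
      (\<And>y. y \<in> space M \<Longrightarrow> u y \<le> 1) \<Longrightarrow> \<bar>Pt t u x - (\<integral>y. u y \<partial>\<pi>)\<bar> \<le> \<tau> t"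
    and v0: "V x + (\<integral>y. V y \<partial>\<pi>) \<le> v 0" and v_Suc: "\<And>t. lam * v t + 2 * K * \<tau> t \<le> v (Suc t)"
    and f: "f \<in> borel_measurable M" "\<And>y. y \<in> space M \<Longrightarrow> \<bar>f y\<bar> \<le> V y"
  shows "\<bar>(\<integral>y. f y \<partial>kernel_power M P t x) - (\<integral>y. f y \<partial>\<pi>)\<bar> \<le> v t"
  using f
proof (induction t arbitrary: f)
  case 0
  have "\<bar>\<integral>y. f y \<partial>\<pi>\<bar> \<le> (\<integral>y. V y \<partial>\<pi>)"
  proof -
    have "\<bar>\<integral>y. f y \<partial>\<pi>\<bar> \<le> (\<integral>y. \<bar>f y\<bar> \<partial>\<pi>)"
      using integral_norm_bound[of \<pi> f] by simp
    also have "\<dots> \<le> (\<integral>y. V y \<partial>\<pi>)"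
    proof (rule integral_mono[OF integrable_abs int_pi])
      show "integrable \<pi> f"
        using 0 V(2) by (intro Bochner_Integration.integrable_bound[OF int_pi]) (force simp: space_pi intro!: AE_I2)+
    qed (use 0 in \<open>simp add: space_pi\<close>)
    finally show ?thesis .
  qed
  moreover have "(\<integral>y. f y \<partial>kernel_power M P 0 x) = f x"
    using kernel_power_op_0[OF x 0(1)] by (simp add: kernel_op_def)
  ultimately show ?case using 0(2)[OF x] v0 by linarith
next
  case (Suc t)
  let ?N = "kernel_power M P t x"
  note sets_N = pow.sets_kernel_eq[OF x, of t]
  note space_N = sets_eq_imp_space_eq[OF sets_N]
  have Pf: "kernel_op P f \<in> borel_measurable M" by (rule kernel_op_measurable[OF Suc.prems(1)])
  have abs_Pf: "\<bar>kernel_op P f y\<bar> \<le> kernel_op P V y" if y: "y \<in> space M" for y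
  proof -
    note sp = sets_eq_imp_space_eq[OF sets_kernel_eq[OF y]]
    have "integrable (P y) f"
      using Suc.prems V(2) sets_kernel_eq[OF y] sp
      by (intro Bochner_Integration.integrable_bound[OF int_P[OF y]]) (force intro!: AE_I2 cong: measurable_cong_sets)+
    then have "(\<integral>z. \<bar>f z\<bar> \<partial>P y) \<le> (\<integral>z. V z \<partial>P y)"
      using Suc.prems(2) sp by (intro integral_mono int_P y) auto
    then show ?thesis
      unfolding kernel_op_def by (rule order_trans[OF integral_abs_bound])
  qed
  define g where "g y = indicator C y * kernel_op P f y" for y
  define h where "h y = (1 - indicator C y) * kernel_op P f y / lam" for y
  have g_meas: "g \<in> borel_measurable M" unfolding g_def[abs_def] using Pf by measurable
  have h_meas: "h \<in> borel_measurable M" unfolding h_def[abs_def] using Pf by measurable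
  have split: "kernel_op P f = (\<lambda>y. g y + lam * h y)"
    using lam by (auto simp: g_def h_def field_simps)
  have g_bound: "\<bar>g y\<bar> \<le> K" if "y \<in> space M" for y
    using abs_Pf[OF that] on[of y] K by (auto simp: g_def indicator_def)
  have g: "g \<in> bounded_measurable M" by (rule bounded_measurableI[OF g_meas g_bound])
  have h_bound: "\<bar>h y\<bar> \<le> V y" if "y \<in> space M" for y
    using abs_Pf[OF that] off[OF that] V(2)[OF that] lam
    by (auto simp: h_def indicator_def abs_mult field_simps)
  have int_h: "integrable ?N h" "integrable \<pi> h"
    using h_meas h_bound V(2) sets_N space_N
    by (auto intro!: Bochner_Integration.integrable_bound[OF int_x] Bochner_Integration.integrable_bound[OF int_pi]
        AE_I2 order_trans[OF h_bound] simp: space_pi cong: measurable_cong_sets)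
  have int_g: "integrable ?N g" "integrable \<pi> g"
    using pow.integrable_kernel[OF g x] integrable_pi[OF g] by auto
  have "(\<integral>y. f y \<partial>kernel_power M P (Suc t) x) = (\<integral>y. kernel_op P f y \<partial>?N)"
    using integral_bind_kernel_dominated[OF sets_N V(1) Suc.prems _ int_P nonempty] int_x[of "Suc t"] by simp
  also have "\<dots> = (\<integral>y. g y \<partial>?N) + lam * (\<integral>y. h y \<partial>?N)"
    unfolding split using int_g int_h by simp
  finally have N_eq: "(\<integral>y. f y \<partial>kernel_power M P (Suc t) x) = (\<integral>y. g y \<partial>?N) + lam * (\<integral>y. h y \<partial>?N)" .
  have "(\<integral>y. f y \<partial>\<pi>) = (\<integral>y. kernel_op P f y \<partial>\<pi>)"
    using integral_bind_kernel_dominated[OF sets_pi V(1) Suc.prems _ int_P nonempty] int_pi by (simp add: pi_bind)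
  also have "\<dots> = (\<integral>y. g y \<partial>\<pi>) + lam * (\<integral>y. h y \<partial>\<pi>)"
    unfolding split using int_g int_h by simp
  finally have pi_eq: "(\<integral>y. f y \<partial>\<pi>) = (\<integral>y. g y \<partial>\<pi>) + lam * (\<integral>y. h y \<partial>\<pi>)" .
  \<comment> \<open>The affine map from \<open>[-K, K]\<close> onto the unit interval.\<close>
  define u where "u y = 1 / (2 * K) * g y + 1 / 2" for y
  have u: "u \<in> bounded_measurable M"
    unfolding u_def[abs_def] by (intro bounded_measurable_intros g)
  have u01: "0 \<le> u y" "u y \<le> 1" if "y \<in> space M" for y
    using g_bound[OF that] K by (auto simp: u_def field_simps abs_le_iff)
  have Pt_u: "Pt t u x = 1 / (2 * K) * (\<integral>y. g y \<partial>?N) + 1 / 2"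
    using int_g pow.integrable_kernel[OF bounded_measurable_const x, of t "1/2"]
      prob_space.prob_space[OF pow.prob_space_kernel[OF x, of t]]
    by (simp add: kernel_op_def u_def)
  have pi_u: "(\<integral>y. u y \<partial>\<pi>) = 1 / (2 * K) * (\<integral>y. g y \<partial>\<pi>) + 1 / 2"
    using int_g integrable_pi[OF bounded_measurable_const, of "1/2"] prob_space.prob_space[OF prob_pi] by (simp add: u_def)
  have "\<bar>1 / (2 * K) * ((\<integral>y. g y \<partial>?N) - (\<integral>y. g y \<partial>\<pi>))\<bar> \<le> \<tau> t"
    using \<tau>[OF u u01, of t] unfolding Pt_u pi_u by (simp add: right_diff_distrib)
  then have "\<bar>(\<integral>y. g y \<partial>?N) - (\<integral>y. g y \<partial>\<pi>)\<bar> \<le> 2 * K * \<tau> t"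
    using K by (simp add: abs_mult field_simps)
  moreover have "\<bar>lam * ((\<integral>y. h y \<partial>?N) - (\<integral>y. h y \<partial>\<pi>))\<bar> \<le> lam * v t"
    using Suc.IH[OF h_meas h_bound] lam by (simp add: abs_mult)
  ultimately show ?case
    using v_Suc[of t] unfolding N_eq pi_eq right_diff_distrib by linarith
qed

end

section \<open>The choice of the rate\<close>

text \<open>
  The power function lies below its tangent at \<open>c\<close>.
\<close>
lemma powr_le_tangent:
  fixes a c r :: real
  assumes "0 < a" "0 < c" "0 \<le> r" "r \<le> 1"
  shows "a powr r \<le> r * c powr (r - 1) * a + (1 - r) * c powr r"
proof -
  have "a powr r * c powr (1 - r) \<le> r * a + (1 - r) * c"
    using Youngs_inequality_0[of r "1 - r" a c] assms by simp
  then have le: "c powr (r - 1) * (a powr r * c powr (1 - r)) \<le> c powr (r - 1) * (r * a + (1 - r) * c)"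
    by (intro mult_left_mono) auto
  have "a powr r = c powr (r - 1) * (a powr r * c powr (1 - r))"
    using assms by (simp add: mult.left_commute powr_add[symmetric])
  also note le
  also have "c powr (r - 1) * (r * a + (1 - r) * c) = r * c powr (r - 1) * a + (1 - r) * (c powr (r - 1) * c)"
    by (simp add: algebra_simps)
  also have "c powr (r - 1) * c = c powr r"
    using assms powr_add[of c "r - 1" 1] by simp
  finally show ?thesis .
qed

context minorized_kernel
begin

interpretation pow: markov_kernel M "kernel_power M P t" for t
  by (rule markov_kernel_power)

lemma eps_le_1: assumes "x \<in> C" shows "eps \<le> 1"
proof -
  interpret nu: prob_space \<nu> by (rule prob_nu)
  have "eps * measure \<nu> (space M) \<le> measure (kernel_power M P m x) (space M)"
    using assms by (intro minorization) auto
  also have "\<dots> \<le> 1" by (rule prob_space.prob_le_1[OF pow.prob_space_kernel[OF C_space[OF assms]]])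
  finally show ?thesis using nu.prob_space by (simp add: space_nu)
qed

text \<open>
  If \<open>C\<close> were empty, the infimum \<open>c\<close> of \<open>V\<close> would satisfy \<open>c \<le> \<lambda> c\<close>.
\<close>
lemma drift_set_nonempty:
  assumes ne: "space M \<noteq> {}" and V: "V \<in> borel_measurable M" "\<And>y. y \<in> space M \<Longrightarrow> 1 \<le> V y"
    and lam: "0 < lam" "lam < 1"
    and off: "\<And>y. y \<in> space M \<Longrightarrow> y \<notin> C \<Longrightarrow> (\<integral>\<^sup>+z. ennreal (V z) \<partial>P y) \<le> ennreal (lam * V y)"
  shows "C \<noteq> {}"
proof
  assume C: "C = {}"
  define c where "c = (INF y\<in>space M. V y)"
  have bdd: "bdd_below (V ` space M)" using V(2) by (intro bdd_belowI[of _ 1]) auto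
  have c1: "1 \<le> c" unfolding c_def using ne V(2) by (intro cINF_greatest) auto
  have "c / lam \<le> V y" if y: "y \<in> space M" for y
  proof -
    interpret prob_space "P y" by (rule prob_space_kernel[OF y])
    have "ennreal c = (\<integral>\<^sup>+z. ennreal c \<partial>P y)" by (simp add: emeasure_space_1)
    also have "\<dots> \<le> (\<integral>\<^sup>+z. ennreal (V z) \<partial>P y)"
      using sets_eq_imp_space_eq[OF sets_kernel_eq[OF y]] bdd
      by (intro nn_integral_mono ennreal_leI) (auto simp: c_def intro!: cINF_lower)
    also have "\<dots> \<le> ennreal (lam * V y)" using off y C by auto
    finally have "c \<le> lam * V y" using lam V(2)[OF y] by (simp add: ennreal_le_iff)
    then show ?thesis using lam by (simp add: field_simps)
  qed
  then have "c / lam \<le> c" unfolding c_def using ne by (intro cINF_greatest) auto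
  then have "c \<le> c * lam" using lam by (simp add: field_simps)
  moreover have "c * lam < c * 1" using lam c1 by (intro mult_strict_left_mono) auto
  ultimately show False by simp
qed

text \<open>
  Jensen for the concave power function, by the tangent at \<open>\<lambda> V(x)\<close>.
\<close>
lemma kernel_op_powr_le:
  assumes V: "V \<in> borel_measurable M" "\<And>y. y \<in> space M \<Longrightarrow> 1 \<le> V y"
    and r: "0 \<le> r" "r \<le> 1" and x: "x \<in> space M" and int: "integrable (P x) V"
    and le: "kernel_op P V x \<le> lam * V x" and lam: "0 < lam"
  shows "integrable (P x) (\<lambda>y. V y powr r)" "kernel_op P (\<lambda>y. V y powr r) x \<le> lam powr r * V x powr r"
proof -
  note sp = sets_eq_imp_space_eq[OF sets_kernel_eq[OF x]]
  have meas: "(\<lambda>y. V y powr r) \<in> borel_measurable (P x)"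
    using V(1) sets_kernel_eq[OF x] by (simp cong: measurable_cong_sets)
  have "V y powr r \<le> V y" if "y \<in> space M" for y
    using powr_mono[of r 1 "V y"] r V(2)[OF that] by simp
  then show int_r: "integrable (P x) (\<lambda>y. V y powr r)"
    using meas V(2) sp
    by (intro Bochner_Integration.integrable_bound[OF int]) (force intro!: AE_I2)+
  define c where "c = lam * V x"
  have c: "0 < c" using lam V(2)[OF x] by (simp add: c_def)
  have "kernel_op P (\<lambda>y. V y powr r) x \<le> (\<integral>y. r * c powr (r - 1) * V y + (1 - r) * c powr r \<partial>P x)"
    unfolding kernel_op_def
  proof (rule integral_mono[OF int_r])
    show "integrable (P x) (\<lambda>y. r * c powr (r - 1) * V y + (1 - r) * c powr r)"
      using int integrable_kernel[OF bounded_measurable_const x] by simp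
    show "V y powr r \<le> r * c powr (r - 1) * V y + (1 - r) * c powr r" if "y \<in> space (P x)" for y
      using V(2)[of y] that sp c r by (intro powr_le_tangent) auto
  qed
  also have "\<dots> = r * c powr (r - 1) * kernel_op P V x + (1 - r) * c powr r"
    using int integrable_kernel[OF bounded_measurable_const x] prob_space.prob_space[OF prob_space_kernel[OF x]]
    by (simp add: kernel_op_def)
  also have "\<dots> \<le> r * c powr (r - 1) * c + (1 - r) * c powr r"
    using le r by (intro add_right_mono mult_left_mono) (auto simp: c_def)
  also have "\<dots> = c powr r"
    using c powr_add[of c "r - 1" 1] by (simp add: algebra_simps)
  also have "\<dots> = lam powr r * V x powr r"
    using lam V(2)[OF x] by (simp add: c_def powr_mult)
  finally show "kernel_op P (\<lambda>y. V y powr r) x \<le> lam powr r * V x powr r" .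
qed

text \<open>
  Jensen for the measure \<open>R(x,\<cdot>)\<close> of mass \<open>1 - \<epsilon>\<close>, using \<open>R V(x) \<le> b - \<epsilon>\<nu>(V) \<le> b - \<epsilon>\<close>. The tangent is taken at
  the bound \<open>(b - \<epsilon>)/(1 - \<epsilon>)\<close> for the mean of \<open>V\<close> under the normalised measure.
\<close>
lemma residual_powr_le:
  assumes V: "V \<in> borel_measurable M" "\<And>y. y \<in> space M \<Longrightarrow> 1 \<le> V y"
    and r: "0 \<le> r" "r \<le> 1" and x: "x \<in> C" and int: "integrable (kernel_power M P m x) V"
    and le: "Pt m V x \<le> b" and eps: "eps < 1"
  shows "integrable (kernel_power M P m x) (\<lambda>y. V y powr r)"
    "residual (\<lambda>y. V y powr r) x \<le> (1 - eps) * ((b - eps) / (1 - eps)) powr r"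
proof -
  note xM = C_space[OF x]
  let ?Q = "kernel_power M P m x"
  note sp = sets_eq_imp_space_eq[OF pow.sets_kernel_eq[OF xM, of m]]
  have meas: "(\<lambda>y. V y powr r) \<in> borel_measurable ?Q"
    using V(1) pow.sets_kernel_eq[OF xM, of m] by (simp cong: measurable_cong_sets)
  have "V y powr r \<le> V y" if "y \<in> space M" for y
    using powr_mono[of r 1 "V y"] r V(2)[OF that] by simp
  then show int_r: "integrable ?Q (\<lambda>y. V y powr r)"
    using meas V(2) sp by (intro Bochner_Integration.integrable_bound[OF int]) (force intro!: AE_I2)+
  have V_nonneg: "0 \<le> V y" if "y \<in> space M" for y using V(2)[OF that] by simp
  have int_nu: "integrable \<nu> V" by (rule nu_dominated(1)[OF x int V_nonneg])
  have int_nu_r: "integrable \<nu> (\<lambda>y. V y powr r)" by (rule nu_dominated(1)[OF x int_r]) simp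
  have const: "integrable ?Q (\<lambda>_. d::real)" "integrable \<nu> (\<lambda>_. d)" for d
    using pow.integrable_kernel[OF bounded_measurable_const xM] integrable_nu[OF bounded_measurable_const] by auto
  have "(\<integral>y. 1 \<partial>?Q) \<le> Pt m V x"
    unfolding kernel_op_def using V(2) sp by (intro integral_mono const int) auto
  then have b1: "1 \<le> b"
    using le prob_space.prob_space[OF pow.prob_space_kernel[OF xM, of m]] by simp
  have "(\<integral>y. 1 \<partial>\<nu>) \<le> (\<integral>y. V y \<partial>\<nu>)"
    using V(2) by (intro integral_mono const int_nu) (auto simp: space_nu)
  then have "eps * 1 \<le> eps * (\<integral>y. V y \<partial>\<nu>)"
    using eps_pos by (intro mult_left_mono) auto
  then have res_V: "residual V x \<le> b - eps" using le by (simp add: residual_def)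
  define c where "c = (b - eps) / (1 - eps)"
  have c: "0 < c" using b1 eps by (simp add: c_def)
  define \<alpha> where "\<alpha> = r * c powr (r - 1)"
  define \<beta> where "\<beta> = (1 - r) * c powr r"
  have "residual (\<lambda>y. V y powr r) x \<le> residual (\<lambda>y. \<alpha> * V y + \<beta>) x"
  proof (rule residual_mono[OF x int_r int_nu_r])
    show "V y powr r \<le> \<alpha> * V y + \<beta>" if "y \<in> space M" for y
      unfolding \<alpha>_def \<beta>_def using V(2)[OF that] c r by (intro powr_le_tangent) auto
  qed (use int int_nu const in auto)
  also have "\<dots> = \<alpha> * residual V x + (1 - eps) * \<beta>"
    using int int_nu const prob_space.prob_space[OF pow.prob_space_kernel[OF xM, of m]]
    by (simp add: residual_def kernel_op_def algebra_simps)
  also have "\<dots> \<le> \<alpha> * ((1 - eps) * c) + (1 - eps) * \<beta>"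
    using res_V r eps by (intro add_right_mono mult_left_mono) (auto simp: \<alpha>_def c_def)
  also have "\<dots> = (1 - eps) * (r * (c powr (r - 1) * c) + (1 - r) * c powr r)"
    by (simp add: \<alpha>_def \<beta>_def algebra_simps)
  also have "c powr (r - 1) * c = c powr r"
    using c powr_add[of c "r - 1" 1] by simp
  finally show "residual (\<lambda>y. V y powr r) x \<le> (1 - eps) * ((b - eps) / (1 - eps)) powr r"
    by (simp add: c_def algebra_simps)
qed

text \<open>
  Here \<open>P\<^sup>m(x,\<cdot>) \<ge> \<nu>\<close>, and two probability measures coincide if one dominates the other.
\<close>
lemma residual_eq_0:
  assumes eps: "eps = 1" and x: "x \<in> C" shows "residual g x = 0"
proof -
  note xM = C_space[OF x]
  let ?Q = "kernel_power M P m x"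
  interpret Q: prob_space ?Q by (rule pow.prob_space_kernel[OF xM])
  interpret nu: prob_space \<nu> by (rule prob_nu)
  note sets = pow.sets_kernel_eq[OF xM, of m]
  note sp = sets_eq_imp_space_eq[OF sets]
  have "?Q = \<nu>"
  proof (rule measure_eqI)
    fix S assume "S \<in> sets ?Q"
    then have S: "S \<in> sets M" by (simp add: sets)
    then have "measure \<nu> S \<le> measure ?Q S" "measure \<nu> (space M - S) \<le> measure ?Q (space M - S)"
      using minorization[OF x] eps by force+
    moreover have "measure \<nu> (space M - S) = 1 - measure \<nu> S" "measure ?Q (space M - S) = 1 - measure ?Q S"
      using nu.prob_compl[of S] Q.prob_compl[of S] S by (auto simp: sets sets_nu sp space_nu)
    ultimately show "emeasure ?Q S = emeasure \<nu> S"
      by (simp add: Q.emeasure_eq_measure nu.emeasure_eq_measure)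
  qed (simp add: sets sets_nu)
  then show ?thesis unfolding residual_def kernel_op_def using eps by simp
qed

end

text \<open>
  The last conclusion says, in logarithms, that \<open>r\<close> times the denominator in the definition of \<open>\<rho>\<close> is at
  most \<open>-ln (1 - \<epsilon>)\<close>. The second entry of the maximum is the \<open>\<rho>\<close> for which equality holds.
\<close>
lemma rate_exponent:
  fixes eps B lam \<rho> r :: real and m :: nat
  assumes lam: "0 < lam" "lam < 1" and eps: "0 < eps" "eps < 1" and B: "1 \<le> B"
    and \<rho>: "\<rho> = max lam (exp (- ln (1 - eps) * ln lam / (- real m * ln lam + ln (B - eps) - ln (1 - eps))))"
    and r: "r = ln \<rho> / ln lam" and m: "1 \<le> m"
  shows "lam \<le> \<rho>" "\<rho> < 1" "0 < r" "r \<le> 1" "lam powr r = \<rho>"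
    "(1 - eps) * ((B - eps) / (1 - eps)) powr r \<le> \<rho> ^ m"
proof -
  define q where "q = - real m * ln lam + ln (B - eps) - ln (1 - eps)"
  have l: "ln lam < 0" using lam by simp
  have e: "ln (1 - eps) < 0" using eps by simp
  have "ln (1 - eps) \<le> ln (B - eps)" using eps B by simp
  moreover have "0 < - real m * ln lam" using l m by (simp add: mult_less_0_iff)
  ultimately have q: "0 < q" by (simp add: q_def)
  show lam_\<rho>: "lam \<le> \<rho>" using \<rho> by simp
  have ex: "- ln (1 - eps) * ln lam / q < 0"
    using l e q by (intro divide_neg_pos mult_pos_neg) auto
  then show \<rho>1: "\<rho> < 1" using lam unfolding \<rho> q_def[symmetric] by simp
  have \<rho>0: "0 < \<rho>" using lam lam_\<rho> by simp
  have ln_\<rho>: "ln \<rho> < 0" using \<rho>0 \<rho>1 by simp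
  show "0 < r" unfolding r using l ln_\<rho> by (simp add: divide_neg_neg)
  have "ln lam \<le> ln \<rho>" using lam lam_\<rho> by simp
  then show "r \<le> 1" unfolding r using l by (simp add: field_simps)
  show "lam powr r = \<rho>" unfolding r powr_def using l lam \<rho>0 by simp
  have "- ln (1 - eps) * ln lam / q \<le> ln \<rho>"
    unfolding \<rho> q_def[symmetric] using lam by (subst ln_exp[symmetric]) (intro ln_mono, auto simp del: ln_exp)
  then have "- ln (1 - eps) / q * ln lam \<le> r * ln lam" unfolding r using l by (simp add: field_simps)
  then have "r \<le> - ln (1 - eps) / q" using l by (simp only: mult_le_cancel_right)
  then have rq: "r * q \<le> - ln (1 - eps)" using q by (simp only: pos_le_divide_eq)
  have c: "0 < (B - eps) / (1 - eps)" using eps B by simp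
  have "ln ((1 - eps) * ((B - eps) / (1 - eps)) powr r) = ln (1 - eps) + r * (ln (B - eps) - ln (1 - eps))"
    using eps B c by (simp add: ln_mult ln_powr ln_div)
  also have "\<dots> \<le> real m * (r * ln lam)" using rq by (simp add: q_def algebra_simps)
  also have "\<dots> = ln (\<rho> ^ m)" using l \<rho>0 by (simp add: r ln_realpow)
  finally show "(1 - eps) * ((B - eps) / (1 - eps)) powr r \<le> \<rho> ^ m"
    using eps c \<rho>0 by (subst (asm) ln_le_cancel_iff) (auto simp: zero_less_mult_iff)
qed

theorem theorem4p1:
  fixes M :: "'a measure" and P :: "'a \<Rightarrow> 'a measure" and \<pi> \<nu> :: "'a measure"
    and C :: "'a set" and V :: "'a \<Rightarrow> real" and lam K eps B \<rho> r D :: real and m :: nat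
    and F0 F1 G0 G1 G2 H0 H1 :: "'a \<Rightarrow> real"
  assumes kernel: "P \<in> M \<rightarrow>\<^sub>M prob_algebra M"
    and pi: "prob_space \<pi>" "sets \<pi> = sets M"
    and reversible: "reversible M P \<pi>"
    and nonneg: "nonneg_eigenvalues P \<pi>"
    and drift: "drift_function M P C V lam K"
    and small: "small_set M P C m eps \<nu>"
    and B: "B = (1 - lam ^ m) / (1 - lam) * (K - lam) + lam ^ m"
    and rho_r_1: "eps = 1 \<Longrightarrow> \<rho> = lam \<and> r = 1"
    and rho_r_less: "eps < 1 \<Longrightarrow>
      \<rho> = max lam (exp (- ln (1 - eps) * ln lam /
                          (- real m * ln lam + ln (B - eps) - ln (1 - eps)))) \<and>
      r = ln \<rho> / ln lam"
    and D: "D = 1 / 2 * sqrt (((B - (1 - eps)) / eps) powr r * (\<rho> powi (2 - int m) / (1 - \<rho>)))"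
    and F0: "\<And>x. F0 x = max (1 - D) 0 * \<rho> powi (1 - int m) * V x powr r + D"
    and F1: "\<And>x. F1 x = (1 - \<rho>) * \<rho> powi (- int m) * D * V x powr r"
    and G0: "\<And>x. G0 x = V x + (K - lam) / (1 - lam)"
    and G1: "\<And>x. \<rho> = lam \<Longrightarrow> G1 x = K * inverse lam * (2 * F0 x - F1 x)"
    and G2: "\<And>x. \<rho> = lam \<Longrightarrow> G2 x = K * inverse lam * F1 x"
    and H0: "\<And>x. \<rho> > lam \<Longrightarrow> H0 x = 2 * K * (F0 x / (\<rho> - lam) - \<rho> * F1 x / (\<rho> - lam)\<^sup>2)"
    and H1: "\<And>x. \<rho> > lam \<Longrightarrow> H1 x = 2 * K * F1 x / (\<rho> - lam)"
  shows "(\<forall>x\<in>space M. \<forall>t::nat.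
            tv_dist (kernel_power M P t x) \<pi> \<le> (F1 x * real t + F0 x) * \<rho> ^ t) \<and>
         (\<rho> = lam \<longrightarrow> (\<forall>x\<in>space M. \<forall>t::nat.
            V_dist V (kernel_power M P t x) \<pi>
              \<le> ereal ((G2 x * (real t)\<^sup>2 + G1 x * real t + G0 x) * lam ^ t))) \<and>
         (\<rho> > lam \<longrightarrow> (\<forall>x\<in>space M. \<forall>t::nat.
            V_dist V (kernel_power M P t x) \<pi>
              \<le> ereal ((H1 x * real t + H0 x) * \<rho> ^ t + (G0 x - H0 x) * lam ^ t)))"
proof -
  have V_meas: "V \<in> borel_measurable M" and V1: "\<And>x. x \<in> space M \<Longrightarrow> 1 \<le> V x"
    and lam: "0 < lam" "lam < 1"
    and off: "\<And>y. y \<in> space M \<Longrightarrow> y \<notin> C \<Longrightarrow> (\<integral>\<^sup>+z. ennreal (V z) \<partial>P y) \<le> ennreal (lam * V y)"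
    and on: "\<And>y. y \<in> C \<Longrightarrow> (\<integral>\<^sup>+z. ennreal (V z) \<partial>P y) \<le> ennreal K"
    using drift unfolding drift_function_def by blast+
  have V0: "0 \<le> V x" if "x \<in> space M" for x using V1[OF that] by linarith
  interpret reversible_minorized_kernel M P \<pi> C m eps \<nu>
    by (intro reversible_minorized_kernel.intro reversible_minorized_kernel_axioms.intro
        reversible_kernel.intro reversible_kernel_axioms.intro minorized_kernel.intro
        minorized_kernel_axioms.intro markov_kernel.intro) (fact kernel pi reversible small nonneg)+
  interpret pow: markov_kernel M "kernel_power M P t" for t
    by (rule markov_kernel_power)
  interpret pi: prob_space \<pi> by (rule prob_pi)
  obtain x0 where x0: "x0 \<in> C"
    using drift_set_nonempty[OF nonempty V_meas V1 lam off] by blast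
  have K1: "1 \<le> K"
  proof -
    interpret prob_space "P x0" by (rule prob_space_kernel[OF C_space[OF x0]])
    have "1 = (\<integral>\<^sup>+z. ennreal 1 \<partial>P x0)" by (simp add: emeasure_space_1)
    also have "\<dots> \<le> (\<integral>\<^sup>+z. ennreal (V z) \<partial>P x0)"
      using V1 sets_eq_imp_space_eq[OF sets_kernel_eq[OF C_space[OF x0]]]
      by (intro nn_integral_mono ennreal_leI) auto
    also have "\<dots> \<le> ennreal K" by (rule on[OF x0])
    finally show ?thesis by simp
  qed
  have b0: "0 \<le> K - lam" using K1 lam by simp
  \<comment> \<open>On \<open>C\<close> this holds because \<open>V \<ge> 1\<close>, so that \<open>K \<le> \<lambda> V + (K - \<lambda>)\<close>.\<close>
  have global: "(\<integral>\<^sup>+z. ennreal (V z) \<partial>P y) \<le> ennreal (lam * V y + (K - lam))" if y: "y \<in> space M" for y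
  proof (cases "y \<in> C")
    case True
    have "K \<le> lam * V y + (K - lam)" using mult_left_mono[OF V1[OF y], of lam] lam by simp
    then show ?thesis by (rule order_trans[OF on[OF True] ennreal_leI])
  next
    case False
    show ?thesis using b0 by (intro order_trans[OF off[OF y False] ennreal_leI]) simp
  qed
  have V_P: "V \<in> borel_measurable (kernel_power M P t y)" if "y \<in> space M" for t y
    using V_meas pow.sets_kernel_eq[OF that] by (simp cong: measurable_cong_sets)
  have V_P1: "V \<in> borel_measurable (P y)" if "y \<in> space M" for y
    using V_meas sets_kernel_eq[OF that] by (simp cong: measurable_cong_sets)
  have int_P: "integrable (P y) V" if y: "y \<in> space M" for y
    using V_P1[OF y] V0 le_less_trans[OF global[OF y] ennreal_less_top]
      sets_eq_imp_space_eq[OF sets_kernel_eq[OF y]]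
    by (intro integrableI_nonneg) auto
  have off': "kernel_op P V y \<le> lam * V y" if "y \<in> space M" "y \<notin> C" for y
    unfolding kernel_op_def using off[OF that] V0[OF that(1)] lam by (intro integral_real_bounded) auto
  have on': "kernel_op P V y \<le> K" if "y \<in> C" for y
    unfolding kernel_op_def using on[OF that] K1 by (intro integral_real_bounded) auto
  have int_x: "integrable (kernel_power M P t x) V" if x: "x \<in> space M" for x t
  proof -
    have "(\<integral>\<^sup>+y. ennreal (V y) \<partial>kernel_power M P 0 x) \<le> ennreal (V x)"
      using x V_meas by (simp add: nn_integral_return)
    from le_less_trans[OF nn_integral_power_drift[OF V_meas V0 lam b0 global x this V0[OF x], of t] ennreal_less_top]
    have "(\<integral>\<^sup>+y. ennreal (V y) \<partial>kernel_power M P t x) < \<infinity>"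
      by (simp del: kernel_power.simps)
    then show ?thesis
      using V0 sets_eq_imp_space_eq[OF pow.sets_kernel_eq[OF x]]
      by (intro integrableI_nonneg V_P[OF x]) auto
  qed
  \<comment> \<open>\<open>B\<close> is the result of one step from \<open>C\<close>, bounded by \<open>K\<close>, followed by \<open>m - 1\<close> drift steps.\<close>
  have B_eq: "lam ^ (m - 1) * K + (K - lam) * (1 - lam ^ (m - 1)) / (1 - lam) = B"
  proof -
    obtain l where "m = Suc l" using m_pos by (cases m) auto
    then show ?thesis using lam by (simp add: B field_simps)
  qed
  have B1: "1 \<le> B"
  proof -
    have "0 \<le> (1 - lam ^ m) / (1 - lam)" using lam by (simp add: power_le_one)
    then have "(1 - lam ^ m) / (1 - lam) * (1 - lam) \<le> (1 - lam ^ m) / (1 - lam) * (K - lam)"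
      using K1 by (intro mult_left_mono) auto
    then show ?thesis using lam by (simp add: B)
  qed
  have PmV: "Pt m V x \<le> B" if x: "x \<in> C" for x
  proof -
    have "(\<integral>\<^sup>+y. ennreal (V y) \<partial>kernel_power M P 1 x) \<le> ennreal K"
      using on[OF x] bind_return[OF kernel_subprob C_space[OF x]] by simp
    from nn_integral_power_drift[OF V_meas V0 lam b0 global C_space[OF x] this, of "m - 1"]
    have "(\<integral>\<^sup>+y. ennreal (V y) \<partial>kernel_power M P m x) \<le> ennreal B"
      using K1 m_pos B_eq by (simp del: kernel_power.simps)
    then show ?thesis unfolding kernel_op_def using B1 by (intro integral_real_bounded) auto
  qed
  have rate: "lam \<le> \<rho> \<and> \<rho> < 1 \<and> 0 < r \<and> r \<le> 1 \<and> lam powr r = \<rho>"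
  proof (cases "eps < 1")
    case True
    then show ?thesis
      using rate_exponent(1-5)[OF lam eps_pos True B1 conjunct1[OF rho_r_less[OF True]]
          conjunct2[OF rho_r_less[OF True]] m_pos] by simp
  next
    case False
    then have "eps = 1" using eps_le_1[OF x0] by simp
    then show ?thesis using rho_r_1 lam by simp
  qed
  then have \<rho>: "0 < \<rho>" "\<rho> < 1" "lam \<le> \<rho>" and r: "0 \<le> r" "r \<le> 1" and lam_r: "lam powr r = \<rho>"
    using lam by auto
  define \<phi> where "\<phi> = (\<lambda>x. V x powr r)"
  have \<phi>_meas: "\<phi> \<in> borel_measurable M" unfolding \<phi>_def using V_meas by measurable
  have \<phi>1: "1 \<le> \<phi> x" if "x \<in> space M" for x
    unfolding \<phi>_def using V1[OF that] r by (simp add: ge_one_powr_ge_zero)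
  have \<phi>_off: "integrable (P y) \<phi> \<and> kernel_op P \<phi> y \<le> \<rho> * \<phi> y" if y: "y \<in> space M" "y \<notin> C" for y
    using kernel_op_powr_le[OF V_meas V1 r y(1) int_P[OF y(1)] off'[OF y] lam(1)]
    by (simp add: \<phi>_def lam_r)
  have \<phi>_on: "integrable (kernel_power M P m y) \<phi> \<and> residual \<phi> y \<le> \<rho> ^ m" if y: "y \<in> C" for y
  proof (cases "eps < 1")
    case True
    note R = residual_powr_le[OF V_meas V1 r y int_x[OF C_space[OF y]] PmV[OF y] True]
    have "(1 - eps) * ((B - eps) / (1 - eps)) powr r \<le> \<rho> ^ m"
      by (rule rate_exponent(6)[OF lam eps_pos True B1 conjunct1[OF rho_r_less[OF True]]
            conjunct2[OF rho_r_less[OF True]] m_pos])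
    with R show ?thesis by (simp add: \<phi>_def)
  next
    case False
    then have eps: "eps = 1" using eps_le_1[OF x0] by simp
    have "integrable (kernel_power M P m y) \<phi>"
    proof (rule Bochner_Integration.integrable_bound[OF int_x[OF C_space[OF y]]])
      note sets = pow.sets_kernel_eq[OF C_space[OF y], of m]
      show "\<phi> \<in> borel_measurable (kernel_power M P m y)"
        using \<phi>_meas sets by (simp cong: measurable_cong_sets)
      show "AE z in kernel_power M P m y. norm (\<phi> z) \<le> norm (V z)"
        using rho_r_1[OF eps] V1 sets_eq_imp_space_eq[OF sets] by (intro AE_I2) (auto simp: \<phi>_def)
    qed
    then show ?thesis using residual_eq_0[OF eps y] \<rho> by simp
  qed
  \<comment> \<open>As \<open>\<phi>\<close> does not depend on \<open>t\<close>, it becomes part of the constant \<open>W\<close> of the general estimates.\<close>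
  have surv: "survival t x \<le> \<rho> / \<rho> ^ m * \<phi> x * \<rho> ^ t" if x: "x \<in> space M" for x t
    using survival_le[OF \<phi>_meas \<phi>1 \<rho>(1) less_imp_le[OF \<rho>(2)] \<phi>_off \<phi>_on x, of t]
    by (simp add: mult_ac)
  have surv_lim: "(\<lambda>t. survival t x) \<longlonglongrightarrow> 0" if x: "x \<in> space M" for x
  proof (rule tendsto_sandwich[of "\<lambda>_. 0" _ _ "\<lambda>t. \<rho> / \<rho> ^ m * \<phi> x * \<rho> ^ t"])
    show "(\<lambda>t. \<rho> / \<rho> ^ m * \<phi> x * \<rho> ^ t) \<longlonglongrightarrow> 0"
      using \<rho> by (intro tendsto_mult_right_zero LIMSEQ_power_zero) auto
  qed (use surv[OF x] survival_bounds[OF x] in auto)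
  have \<phi>_nu: "integrable \<nu> \<phi>"
  proof (rule nu_dominated(1)[OF x0])
    show "0 \<le> \<phi> y" for y by (simp add: \<phi>_def)
  qed (use \<phi>_on[OF x0] in blast)
  have surv_nu: "(\<integral>x. survival n x \<partial>\<nu>) \<le> \<rho> / \<rho> ^ m * (\<integral>x. \<phi> x \<partial>\<nu>) * \<rho> ^ n" for n
  proof -
    have "(\<integral>x. survival n x \<partial>\<nu>) \<le> (\<integral>x. \<rho> / \<rho> ^ m * \<rho> ^ n * \<phi> x \<partial>\<nu>)"
    proof (rule integral_mono[OF integrable_nu[OF survival_bounded_measurable]])
      show "integrable \<nu> (\<lambda>x. \<rho> / \<rho> ^ m * \<rho> ^ n * \<phi> x)" using \<phi>_nu by simp
      show "survival n x \<le> \<rho> / \<rho> ^ m * \<rho> ^ n * \<phi> x" if "x \<in> space \<nu>" for x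
        using surv[of x n] that by (simp add: space_nu mult_ac)
    qed
    also have "\<dots> = \<rho> / \<rho> ^ m * \<rho> ^ n * (\<integral>x. \<phi> x \<partial>\<nu>)" by simp
    finally show ?thesis by (simp add: mult_ac)
  qed
  \<comment> \<open>The factors of \<open>4D\<^sup>2\<close> besides \<open>\<rho>/(1 - \<rho>)\<close> are at least \<open>1\<close>, as \<open>B \<ge> 1\<close> and \<open>\<rho>\<^sup>1\<^sup>-\<^sup>m \<ge> 1\<close>.\<close>
  have D_ge: "1 / 2 * sqrt (\<rho> / (1 - \<rho>)) \<le> D"
  proof -
    have X: "1 \<le> ((B - (1 - eps)) / eps) powr r"
      using B1 eps_pos r by (intro ge_one_powr_ge_zero) (auto simp: field_simps)
    have pow: "\<rho> powi (2 - int m) = \<rho> * (\<rho> / \<rho> ^ m)"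
      using \<rho> by (simp add: power_int_diff power2_eq_square)
    have "\<rho> ^ m \<le> \<rho> ^ 1" using \<rho> m_pos by (intro power_decreasing) auto
    then have "1 \<le> \<rho> / \<rho> ^ m" using \<rho> by simp
    then have "\<rho> * 1 \<le> \<rho> powi (2 - int m)"
      unfolding pow using \<rho> by (intro mult_left_mono) auto
    then have "1 * (\<rho> / (1 - \<rho>)) \<le> ((B - (1 - eps)) / eps) powr r * (\<rho> powi (2 - int m) / (1 - \<rho>))"
      using X \<rho> by (intro mult_mono divide_right_mono) auto
    then show ?thesis unfolding D by simp
  qed
  have "0 \<le> sqrt (\<rho> / (1 - \<rho>))" using \<rho> by simp
  with D_ge have D0: "0 \<le> D" by linarith
  have bound: "\<bar>Pt t u x - (\<integral>y. u y \<partial>\<pi>)\<bar> \<le> (F1 x * real t + F0 x) * \<rho> ^ t"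
    if x: "x \<in> space M" and u: "u \<in> bounded_measurable M" "\<And>y. y \<in> space M \<Longrightarrow> 0 \<le> u y"
      "\<And>y. y \<in> space M \<Longrightarrow> u y \<le> 1" for x t u
  proof -
    have nu: "\<bar>(\<integral>y. Pt n u y \<partial>\<nu>) - (\<integral>y. u y \<partial>\<pi>)\<bar> \<le> D * \<rho> ^ n" for n
    proof -
      have "\<bar>(\<integral>y. Pt n u y \<partial>\<nu>) - (\<integral>y. u y \<partial>\<pi>)\<bar> \<le> 1 / 2 * sqrt (\<rho> / (1 - \<rho>)) * \<rho> ^ n"
        by (rule nu_power_convergence[OF surv_lim surv_nu \<rho>(1,2) u])
      also have "\<dots> \<le> D * \<rho> ^ n" using D_ge \<rho> by (intro mult_right_mono) auto
      finally show ?thesis .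
    qed
    have p1: "\<rho> powi (1 - int m) = \<rho> / \<rho> ^ m" and p0: "\<rho> powi (- int m) = 1 / \<rho> ^ m"
      using \<rho> by (simp_all add: power_int_diff power_int_minus_divide)
    define W where "W = \<rho> / \<rho> ^ m * \<phi> x"
    have "F1 x = (1 - \<rho>) / \<rho> * D * W"
      using \<rho> by (simp add: F1 p0 \<phi>_def W_def)
    moreover have "F0 x = max (1 - D) 0 * W + D"
      unfolding F0 p1 \<phi>_def W_def by (simp only: mult.assoc)
    ultimately have "F1 x * real t + F0 x = max (1 - D) 0 * W + D + (1 - \<rho>) / \<rho> * D * W * real t"
      by simp
    moreover have "survival n x \<le> W * \<rho> ^ n" for n
      unfolding W_def by (rule surv[OF x])
    ultimately show ?thesis
      using power_convergence[OF _ \<rho>(1) less_imp_le[OF \<rho>(2)] D0 nu u x, of W t] by (simp only:)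
  qed
  have tv: "tv_dist (kernel_power M P t x) \<pi> \<le> (F1 x * real t + F0 x) * \<rho> ^ t" if x: "x \<in> space M" for x t
    unfolding tv_dist_def
  proof (rule cSUP_least)
    note sets = pow.sets_kernel_eq[OF x, of t]
    show "sets (kernel_power M P t x) \<noteq> {}" by (auto simp: sets)
    fix S assume "S \<in> sets (kernel_power M P t x)"
    then have S: "S \<in> sets M" by (simp add: sets)
    have "Pt t (indicator S) x = measure (kernel_power M P t x) S"
      using S sets by (simp add: kernel_op_def)
    moreover have "(\<integral>y. indicator S y \<partial>\<pi>) = measure \<pi> S"
      using S sets_pi by simp
    moreover have "indicator S \<in> bounded_measurable M"
      using S by (intro bounded_measurableI[where b = 1]) (auto simp: indicator_def)
    ultimately show "\<bar>measure (kernel_power M P t x) S - measure \<pi> S\<bar> \<le> (F1 x * real t + F0 x) * \<rho> ^ t"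
      using bound[OF x, of "indicator S" t] by (simp only: indicator_pos_le indicator_le_1)
  qed
  have stat: "integrable \<pi> V" "(\<integral>y. V y \<partial>\<pi>) \<le> (K - lam) / (1 - lam)"
    by (rule stationary_drift_bound[OF V_meas V0 lam b0 global]; assumption)+
  have V_dist_le: "V_dist V (kernel_power M P t x) \<pi> \<le> ereal (v t)"
    if x: "x \<in> space M" and v0: "v 0 = G0 x"
      and v_Suc: "\<And>t. v (Suc t) = lam * v t + 2 * K * ((F1 x * real t + F0 x) * \<rho> ^ t)" for x t v
  proof -
    note sets = pow.sets_kernel_eq[OF x, of t]
    have v0': "V x + (\<integral>y. V y \<partial>\<pi>) \<le> v 0" using stat(2) by (simp add: v0 G0)
    have v_Suc': "lam * v t + 2 * K * ((F1 x * real t + F0 x) * \<rho> ^ t) \<le> v (Suc t)" for t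
      by (simp only: v_Suc order_refl)
    have K0: "0 < K" using K1 by simp
    show ?thesis
      unfolding V_dist_def
    proof (subst if_P[OF conjI[OF int_x[OF x] stat(1)]], rule SUP_least)
      fix f assume "f \<in> {f \<in> borel_measurable (kernel_power M P t x).
        \<forall>y\<in>space (kernel_power M P t x). \<bar>f y\<bar> \<le> V y}"
      then have f: "f \<in> borel_measurable M" "\<And>y. y \<in> space M \<Longrightarrow> \<bar>f y\<bar> \<le> V y"
        using measurable_cong_sets[OF sets refl, of borel] sets_eq_imp_space_eq[OF sets] by auto
      have "\<bar>(\<integral>y. f y \<partial>kernel_power M P t x) - (\<integral>y. f y \<partial>\<pi>)\<bar> \<le> v t"
        by (rule weighted_convergence[where \<tau> = "\<lambda>t. (F1 x * real t + F0 x) * \<rho> ^ t" and v = v,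
              OF V_meas V1 lam(1) K0 off' on' int_P int_x[OF x] stat(1) x bound[OF x] v0' v_Suc' f])
      then show "ereal \<bar>(\<integral>y. f y \<partial>kernel_power M P t x) - (\<integral>y. f y \<partial>\<pi>)\<bar> \<le> ereal (v t)"
        by simp
    qed
  qed
  \<comment> \<open>It remains to check that the closed forms solve the recursion of \<open>V_dist_le\<close>.\<close>
  have V_eq: "V_dist V (kernel_power M P t x) \<pi> \<le> ereal ((G2 x * (real t)\<^sup>2 + G1 x * real t + G0 x) * lam ^ t)"
    if x: "x \<in> space M" and eq: "\<rho> = lam" for x t
  proof -
    let ?v = "\<lambda>t. (G2 x * (real t)\<^sup>2 + G1 x * real t + G0 x) * lam ^ t"
    have "?v (Suc t) = lam * ?v t + 2 * K * ((F1 x * real t + F0 x) * \<rho> ^ t)" for t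
    proof -
      have "?v (Suc t) = lam * ?v t + (lam * G2 x * (2 * real t + 1) + lam * G1 x) * lam ^ t"
        by (simp add: algebra_simps power2_eq_square)
      also have "lam * G2 x * (2 * real t + 1) + lam * G1 x = 2 * K * (F1 x * real t + F0 x)"
      proof -
        have "lam * G2 x = K * F1 x" "lam * G1 x = K * (2 * F0 x - F1 x)"
          using lam by (simp_all add: G1[OF eq] G2[OF eq])
        then show ?thesis by (simp add: algebra_simps)
      qed
      finally show ?thesis by (simp add: eq mult.assoc)
    qed
    then show ?thesis using V_dist_le[OF x, of ?v t] by simp
  qed
  have V_gt: "V_dist V (kernel_power M P t x) \<pi> \<le> ereal ((H1 x * real t + H0 x) * \<rho> ^ t + (G0 x - H0 x) * lam ^ t)"
    if x: "x \<in> space M" and gt: "\<rho> > lam" for x t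
  proof -
    have step: "\<rho> * (H1 x * (real t + 1) + H0 x) = lam * (H1 x * real t + H0 x) + 2 * K * (F1 x * real t + F0 x)" for t :: nat
    proof -
      have H1': "(\<rho> - lam) * H1 x = 2 * K * F1 x" using gt by (simp add: H1)
      have H0': "(\<rho> - lam) * H0 x = 2 * K * F0 x - \<rho> * H1 x"
      proof -
        define d where "d = \<rho> - lam"
        have "d \<noteq> 0" using gt by (simp add: d_def)
        then show ?thesis
          unfolding H0[OF gt] H1[OF gt] d_def[symmetric] by (simp add: field_simps power2_eq_square)
      qed
      have "\<rho> * (H1 x * (real t + 1) + H0 x) - lam * (H1 x * real t + H0 x)
          = (\<rho> - lam) * H1 x * real t + \<rho> * H1 x + (\<rho> - lam) * H0 x"
        by (simp add: algebra_simps)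
      also have "\<dots> = 2 * K * (F1 x * real t + F0 x)"
        unfolding H1' H0' by (simp add: algebra_simps)
      finally show ?thesis by simp
    qed
    let ?v = "\<lambda>t. (H1 x * real t + H0 x) * \<rho> ^ t + (G0 x - H0 x) * lam ^ t"
    have "?v (Suc t) = lam * ?v t + 2 * K * ((F1 x * real t + F0 x) * \<rho> ^ t)" for t
    proof -
      have "?v (Suc t) = \<rho> * (H1 x * (real t + 1) + H0 x) * \<rho> ^ t + lam * ((G0 x - H0 x) * lam ^ t)"
        by (simp add: algebra_simps)
      also have "\<dots> = lam * ?v t + 2 * K * ((F1 x * real t + F0 x) * \<rho> ^ t)"
        unfolding step by (simp add: algebra_simps)
      finally show ?thesis .
    qed
    then show ?thesis using V_dist_le[OF x, of ?v t] by simp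
  qed
  show ?thesis using tv V_eq V_gt by blast
qed

end
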